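(* Let $A\in\mathbb{R}^{n\times n}$ be an unreduced tridiagonal matrix and let $\Delta\in\mathbb{R}^{n\times n}$ be an entrywise nonnegative matrix having the same zero structure, i.e., $A_{ij}=0\Rightarrow \Delta_{ij}=0$. Then the regularity radius $r(A,\Delta)$ is computable in polynomial time with arbitrary precision.
   Context: For $A\in\mathbb{R}^{n\times n}$ and an entrywise nonnegative $\Delta\in\mathbb{R}^{n\times n}$, the regularity radius is $r(A,\Delta)=\min\{\delta\ge 0 : [A-\delta\Delta,A+\delta\Delta]\text{ is singular}\}$, with value $\infty$ if no such $\delta$ exists. Here $[A-\delta\Delta,A+\delta\Delta]$ is the interval matrix, i.e., the set of all real matrices $A'$ with $A-\delta\Delta\le A'\le A+\delta\Delta$ entrywise; an interval matrix is called regular if it contains only nonsingular matrices, and singular otherwise. A tridiagonal matrix ($A_{ij}=0$ for $|i-j|>1$) is unreduced if $A_{k,k+1}\ne 0$ and $A_{k+1,k}\neq 0$ for all $1\le k\le n-1$. For the computational statement, inputs are rational matrices $A,\Delta$ and a rational precision $\varepsilon>0$; "computable in polynomial time with arbitrary precision" means that there is an algorithm that outputs a value of $r(A,\Delta)$ up to error $\varepsilon$ (reporting $\infty$ if the radius is infinite) in time polynomial in the bit size of $A,\Delta$ and in $\log(1/\varepsilon)$.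
   Formalization: The proved running time is polynomial in the bit sizes of A, Δ and in log(1/ε), plus a term linear in the bit size of ε, needed to read an arbitrary rational ε; for ε = 1/q that term is absorbed. *)

theory Defs
  imports
    "HOL-Library.Extended_Real"
    "HOL-Library.Log_Nat"
    "HOL-Computational_Algebra.Polynomial"
    "Jordan_Normal_Form.Matrix"
begin

section \<open>Matrices\<close>

text \<open>The order on matrices is the entrywise one, and rows and columns are numbered from \<open>0\<close>.\<close>

definition interval_matrix :: "real mat \<Rightarrow> real mat \<Rightarrow> real \<Rightarrow> real mat set" where
  "interval_matrix A \<Delta> \<delta> = {A - \<delta> \<cdot>\<^sub>m \<Delta> .. A + \<delta> \<cdot>\<^sub>m \<Delta>}"

definition regular_interval :: "real mat set \<Rightarrow> bool" where
  "regular_interval I \<longleftrightarrow> (\<forall>A' \<in> I. invertible_mat A')"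

text \<open>
  The \<open>LEAST\<close> is a genuine minimum: the set of all \<open>\<delta> \<ge> 0\<close> with singular interval matrix is
  closed, because the interval matrices are compact.
\<close>

definition regularity_radius :: "real mat \<Rightarrow> real mat \<Rightarrow> ereal" where
  "regularity_radius A \<Delta> =
     (if \<exists>\<delta>\<ge>0. \<not> regular_interval (interval_matrix A \<Delta> \<delta>)
      then ereal (LEAST \<delta>. 0 \<le> \<delta> \<and> \<not> regular_interval (interval_matrix A \<Delta> \<delta>))
      else \<infinity>)"

definition tridiagonal :: "'a::zero mat \<Rightarrow> bool" where
  "tridiagonal A \<longleftrightarrow>
     (\<forall>i < dim_row A. \<forall>j < dim_col A. \<bar>int i - int j\<bar> > 1 \<longrightarrow> A $$ (i, j) = 0)"

definition unreduced_tridiagonal :: "'a::zero mat \<Rightarrow> bool" where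
  "unreduced_tridiagonal A \<longleftrightarrow> tridiagonal A \<and>
     (\<forall>k. k + 1 < dim_row A \<longrightarrow> A $$ (k, k + 1) \<noteq> 0 \<and> A $$ (k + 1, k) \<noteq> 0)"


section \<open>Bit sizes\<close>

text \<open>One bit for the sign and the length of the binary expansion of the absolute value.\<close>

definition int_size :: "int \<Rightarrow> nat" where
  "int_size x = floorlog 2 (nat \<bar>x\<bar>) + 1"

definition rat_size :: "rat \<Rightarrow> nat" where
  "rat_size q = int_size (fst (quotient_of q)) + int_size (snd (quotient_of q))"

definition mat_size :: "rat mat \<Rightarrow> nat" where
  "mat_size A = (\<Sum>i < dim_row A. \<Sum>j < dim_col A. rat_size (A $$ (i, j)))"


section \<open>Random access machines with logarithmic cost\<close>

text \<open>
  The model is the random access machine of Aho, Hopcroft and Ullman, with structured control flow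
  in place of jumps. A memory cell holds an integer of arbitrary length, and addresses are
  integers too. Every operation is charged the bit sizes of its operands, and a memory access
  is charged the bit sizes of both the address and the content. With this cost measure, polynomial
  time is the same as polynomial time on Turing machines: a product is no longer than
  its two factors together, so that time \<open>t\<close> allows only for numbers of bit size \<open>O(t)\<close>.
\<close>

type_synonym memory = "int \<Rightarrow> int"

datatype expr =
    Const int
  | Load expr
  | Add expr expr
  | Sub expr expr
  | Mult expr expr
  | Div expr expr

text \<open>\<open>Div\<close> rounds towards minus infinity, and division by zero yields zero.\<close>

fun expr_val :: "expr \<Rightarrow> memory \<Rightarrow> int" where
  "expr_val (Const c) m = c"
| "expr_val (Load e) m = m (expr_val e m)"
| "expr_val (Add e f) m = expr_val e m + expr_val f m"
| "expr_val (Sub e f) m = expr_val e m - expr_val f m"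
| "expr_val (Mult e f) m = expr_val e m * expr_val f m"
| "expr_val (Div e f) m = expr_val e m div expr_val f m"

fun expr_cost :: "expr \<Rightarrow> memory \<Rightarrow> nat" where
  "expr_cost (Const c) m = int_size c"
| "expr_cost (Load e) m =
     expr_cost e m + int_size (expr_val e m) + int_size (m (expr_val e m))"
| "expr_cost (Add e f) m =
     expr_cost e m + expr_cost f m + int_size (expr_val e m) + int_size (expr_val f m)"
| "expr_cost (Sub e f) m =
     expr_cost e m + expr_cost f m + int_size (expr_val e m) + int_size (expr_val f m)"
| "expr_cost (Mult e f) m =
     expr_cost e m + expr_cost f m + int_size (expr_val e m) + int_size (expr_val f m)"
| "expr_cost (Div e f) m =
     expr_cost e m + expr_cost f m + int_size (expr_val e m) + int_size (expr_val f m)"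

datatype program =
    Skip
  | Store expr expr
  | Seq program program
  | Cond expr program program
  | While expr program

text \<open>
  \<open>exec P m t m'\<close>: started in memory \<open>m\<close>, the program \<open>P\<close> halts after time \<open>t\<close> in memory \<open>m'\<close>.
  A condition is taken to be true if its value is positive.
\<close>

inductive exec :: "program \<Rightarrow> memory \<Rightarrow> nat \<Rightarrow> memory \<Rightarrow> bool" where
  Skip: "exec Skip m 1 m"
| Store: "exec (Store e f) m
     (expr_cost e m + expr_cost f m + int_size (expr_val e m) + int_size (expr_val f m))
     (m(expr_val e m := expr_val f m))"
| Seq: "exec P m t m' \<Longrightarrow> exec Q m' t' m'' \<Longrightarrow> exec (Seq P Q) m (t + t') m''"
| CondTrue: "expr_val e m > 0 \<Longrightarrow> exec P m t m' \<Longrightarrow>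
     exec (Cond e P Q) m (expr_cost e m + int_size (expr_val e m) + t) m'"
| CondFalse: "\<not> expr_val e m > 0 \<Longrightarrow> exec Q m t m' \<Longrightarrow>
     exec (Cond e P Q) m (expr_cost e m + int_size (expr_val e m) + t) m'"
| WhileFalse: "\<not> expr_val e m > 0 \<Longrightarrow>
     exec (While e P) m (expr_cost e m + int_size (expr_val e m)) m"
| WhileTrue: "expr_val e m > 0 \<Longrightarrow> exec P m t m' \<Longrightarrow> exec (While e P) m' t' m'' \<Longrightarrow>
     exec (While e P) m (expr_cost e m + int_size (expr_val e m) + t + t') m''"

lemma exec_deterministic:
  "exec P m t m' \<Longrightarrow> exec P m s n \<Longrightarrow> s = t \<and> n = m'"
proof (induction arbitrary: s n rule: exec.induct)
  case (Seq P m t m' Q t' m'')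
  from Seq.prems show ?case by (cases rule: exec.cases) (use Seq.IH in blast)+
next
  case (WhileTrue e m P t m' t' m'')
  from WhileTrue.prems show ?case
    by (cases rule: exec.cases) (use WhileTrue.IH WhileTrue.hyps in blast)+
next
  case (CondTrue e m P t m' Q)
  from CondTrue.prems show ?case
    by (cases rule: exec.cases) (use CondTrue.IH CondTrue.hyps in blast)+
next
  case (CondFalse e m Q t m' P)
  from CondFalse.prems show ?case
    by (cases rule: exec.cases) (use CondFalse.IH CondFalse.hyps in blast)+
qed (auto elim: exec.cases)


section \<open>Computability in polynomial time with arbitrary precision\<close>

definition rat_code :: "rat \<Rightarrow> int list" where
  "rat_code q = [fst (quotient_of q), snd (quotient_of q)]"

definition mat_code :: "rat mat \<Rightarrow> int list" where
  "mat_code A =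
     concat [rat_code (A $$ (i, j)). i \<leftarrow> [0..<dim_row A], j \<leftarrow> [0..<dim_col A]]"

text \<open>The input consists of the dimension and the entries of both matrices, row by row, and \<open>\<epsilon>\<close>.\<close>

definition input_code :: "rat mat \<Rightarrow> rat mat \<Rightarrow> rat \<Rightarrow> int list" where
  "input_code A \<Delta> \<epsilon> = int (dim_row A) # mat_code A @ mat_code \<Delta> @ rat_code \<epsilon>"

definition initial_memory :: "int list \<Rightarrow> memory" where
  "initial_memory xs = (\<lambda>a. if 0 \<le> a \<and> a < int (length xs) then xs ! nat a else 0)"

text \<open>
  Cell \<open>0\<close> tells whether the output is finite; if it is, cells \<open>1\<close> and \<open>2\<close> hold its numerator and
  its positive denominator.
\<close>

definition output_approx :: "memory \<Rightarrow> ereal \<Rightarrow> real \<Rightarrow> bool" where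
  "output_approx m r \<epsilon> \<longleftrightarrow>
     (case r of
        ereal x \<Rightarrow> m 0 = 1 \<and> m 2 > 0 \<and> \<bar>of_int (m 1) / of_int (m 2) - x\<bar> \<le> \<epsilon>
      | PInfty \<Rightarrow> m 0 = 0
      | MInfty \<Rightarrow> False)"

text \<open>
  \<open>nat\<close> turns \<open>log (1/\<epsilon>)\<close> into \<open>0\<close> if \<open>\<epsilon> \<ge> 1\<close>. The time is polynomial in the bit sizes of the
  matrices and in \<open>log (1/\<epsilon>)\<close>. The linear term is the cost of reading \<open>\<epsilon>\<close>, whose numerator and
  denominator may be much longer than \<open>log (1/\<epsilon>)\<close>; for \<open>\<epsilon> = 1/q\<close> it is absorbed by the polynomial.
\<close>

definition poly_time_arbitrary_precision ::
  "(rat mat \<times> rat mat) set \<Rightarrow> (rat mat \<Rightarrow> rat mat \<Rightarrow> ereal) \<Rightarrow> bool" where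
  "poly_time_arbitrary_precision D f \<longleftrightarrow>
     (\<exists>(P :: program) (p :: nat poly) (c :: nat).
        \<forall>(A, \<Delta>) \<in> D. \<forall>\<epsilon> > 0. \<exists>t m.
          exec P (initial_memory (input_code A \<Delta> \<epsilon>)) t m \<and>
          t \<le> poly p (mat_size A + mat_size \<Delta> + nat \<lceil>log 2 (1 / real_of_rat \<epsilon>)\<rceil>)
               + c * rat_size \<epsilon> \<and>
          output_approx m (f A \<Delta>) (real_of_rat \<epsilon>))"

end

theory Submission
  imports Defs "Jordan_Normal_Form.Determinant"
begin

text \<open>
  The leading principal minors of a tridiagonal matrix satisfy
  \<open>D (k + 1) = a k * D k - b k * c k * D (k - 1)\<close>, so that the determinant is multiaffine in the
  entries. Hence the interval matrix is regular iff the determinant has the same strict sign at all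
  vertices of the box of entries. To decide this in linear time, propagate the cone of all vectors
  \<open>(D k, D (k - 1))\<close> that are reachable from vertices: in the regular case the remaining factors act as a linear
  functional without zeros on these vectors, so that the cone is pointed and determined by two
  extremal vectors, and the final two decide. Since the determinant is multiaffine with rational
  coefficients, a finite radius is at most an explicit number of polynomial size, and bisection
  between \<open>0\<close> and this number, with a denominator \<open>N \<ge> 1 / \<epsilon>\<close>, finds the radius.
\<close>

section \<open>Multiaffine products of two by two matrices\<close>

text \<open>Two things keep the cone test cheap. Vectors are never combined: an extremal vector is
  always the image of \<open>(1, 0)\<close> under one choice of signs, so its entries grow by one
  factor \<open>K\<close> per parameter, and it can witness a wrong sign. A rejected vector in turn
  shows that no linear functional is positive on all generators. The bound for finite radii comes
  from the unit cube and not from the box of entries. If the determinant, cleared of denominators,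
  takes different values at two corners with parameters in {0, 1}, it changes along an edge; there
  it is affine with a nonzero integer slope, so that it has a root no larger than a corner value. If
  all corners agree, it is constant. On the machine the obstacle is that the general bound for a
  loop-free program multiplies the size of the numbers by a constant, which would compound over the
  iterations of a loop. Each loop invariant therefore restores one fixed size bound \<open>l\<close>
  from the mathematical bounds on the numbers, and the general bound pays only for the time of a
  single iteration.\<close>

text \<open>
  The pair \<open>(p, q)\<close> stands for two consecutive leading principal minors, up to a common factor. A
  parameter is \<open>(a + s * e) / d\<close>; it is either a diagonal entry, which completes a step of the
  recurrence, or an off-diagonal entry, which is multiplied to the second minor.
\<close>

fun act :: "bool \<times> 'a \<times> 'a \<times> 'a \<Rightarrow> 'a \<Rightarrow> 'a \<times> 'a \<Rightarrow> 'a \<times> 'a::comm_ring_1" where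
  "act (k, a, e, d) s (p, q) =
     (if k then ((a + s * e) * p - d * q, d * p) else (d * p, (a + s * e) * q))"

fun run :: "(bool \<times> 'a \<times> 'a \<times> 'a) list \<Rightarrow> 'a list \<Rightarrow> 'a \<times> 'a \<Rightarrow> 'a \<times> 'a::comm_ring_1" where
  "run (x # xs) (s # ss) w = run xs ss (act x s w)"
| "run _ _ w = w"

section \<open>Linearity in the vector and affinity in each parameter\<close>

definition comb :: "'a \<Rightarrow> 'a \<times> 'a \<Rightarrow> 'a \<Rightarrow> 'a \<times> 'a \<Rightarrow> 'a \<times> 'a::comm_ring_1" where
  "comb \<alpha> u \<beta> v = (\<alpha> * fst u + \<beta> * fst v, \<alpha> * snd u + \<beta> * snd v)"

lemma act_comb: "act x s (comb \<alpha> u \<beta> v) = comb \<alpha> (act x s u) \<beta> (act x s v)"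
  by (cases x; cases u; cases v) (auto simp: comb_def algebra_simps)

lemma run_comb: "run xs ss (comb \<alpha> u \<beta> v) = comb \<alpha> (run xs ss u) \<beta> (run xs ss v)"
  by (induction xs ss u arbitrary: v rule: run.induct) (simp_all add: act_comb)

lemma act_affine:
  assumes "\<alpha> + \<beta> = 1"
  shows "act x (\<alpha> * s + \<beta> * t) w = comb \<alpha> (act x s w) \<beta> (act x t w)"
proof -
  obtain k a e d p q where [simp]: "x = (k, a, e, d)" "w = (p, q)"
    by (metis prod.exhaust)
  have [simp]: "\<beta> = 1 - \<alpha>"
    using assms by (simp add: algebra_simps)
  show ?thesis
    by (auto simp: comb_def algebra_simps)
qed

text \<open>The remaining factors are linear maps, so that the final minor is the inner product of
  the current vector with a fixed vector. The failure case of the cone test rests on this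
  functional.\<close>

lemma fst_run_linear:
  "fst (run xs ss w) = fst w * fst (run xs ss (1, 0)) + snd w * fst (run xs ss (0, 1))"
proof -
  have "w = comb (fst w) (1, 0) (snd w) (0, 1)"
    by (simp add: comb_def)
  then show ?thesis
    by (metis run_comb comb_def fst_conv)
qed

lemma fst_run_affine:
  assumes "\<alpha> + \<beta> = 1"
  shows "fst (run xs ss (act x (\<alpha> * s + \<beta> * t) w)) =
         \<alpha> * fst (run xs ss (act x s w)) + \<beta> * fst (run xs ss (act x t w))"
  unfolding act_affine[OF assms] run_comb by (simp add: comb_def)

text \<open>Regula falsi: the weights are the barycentric coordinates of the zero of an affine
  function with distinct values \<open>f0\<close> and \<open>f1\<close>. The zero may lie outside
  the segment from \<open>s\<close> to \<open>t\<close>; this is the case of interest in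
  \<open>run_bounded_zero_edge\<close>.\<close>

lemma fst_run_zero_between:
  fixes s t :: real
  assumes "fst (run xs ss (act x s w)) \<noteq> fst (run xs ss (act x t w))"
  defines "f0 \<equiv> fst (run xs ss (act x s w))" and "f1 \<equiv> fst (run xs ss (act x t w))"
  shows "fst (run xs ss (act x (f1 / (f1 - f0) * s + - f0 / (f1 - f0) * t) w)) = 0"
proof -
  have "f1 - f0 \<noteq> 0"
    using assms by simp
  then have "f1 / (f1 - f0) + - f0 / (f1 - f0) = 1"
    by (simp add: diff_divide_distrib[symmetric])
  from fst_run_affine[OF this, of xs ss x s t w] show ?thesis
    by (simp add: f0_def[symmetric] f1_def[symmetric])
qed

section \<open>Sign changes of a multiaffine function on a box\<close>

lemma abs_convex_le:
  fixes s t :: real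
  assumes "0 \<le> \<alpha>" "0 \<le> \<beta>" "\<alpha> + \<beta> = 1" "\<bar>s\<bar> \<le> \<delta>" "\<bar>t\<bar> \<le> \<delta>"
  shows "\<bar>\<alpha> * s + \<beta> * t\<bar> \<le> \<delta>"
proof -
  have "\<bar>\<alpha> * s + \<beta> * t\<bar> \<le> \<alpha> * \<bar>s\<bar> + \<beta> * \<bar>t\<bar>"
    using assms by (metis abs_mult abs_of_nonneg abs_triangle_ineq)
  also have "\<dots> \<le> \<alpha> * \<delta> + \<beta> * \<delta>"
    using assms by (intro add_mono mult_left_mono)
  also have "\<dots> = \<delta>"
    using assms by (simp flip: distrib_right)
  finally show ?thesis .
qed

text \<open>The list \<open>s # ts'\<close> lies between \<open>ss = s # ss'\<close> and
  \<open>ts = t # ts'\<close>. The sign changes either from \<open>ss\<close> to it, where the heads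
  agree and the induction applies, or from it to \<open>ts\<close>, along a single coordinate, where
  the function is affine.\<close>

lemma run_intermediate_value:
  fixes xs :: "(bool \<times> real \<times> real \<times> real) list"
  assumes "length ss = length xs" "length ts = length xs"
    and "fst (run xs ss w) \<le> 0" "0 \<le> fst (run xs ts w)"
    and "\<forall>s\<in>set ss \<union> set ts. \<bar>s\<bar> \<le> \<delta>"
  shows "\<exists>rs. length rs = length xs \<and> (\<forall>r\<in>set rs. \<bar>r\<bar> \<le> \<delta>) \<and> fst (run xs rs w) = 0"
  using assms
proof (induction xs arbitrary: ss ts w)
  case Nil
  then show ?case by (intro exI[of _ "[]"]) simp
next
  case (Cons x xs)
  obtain s ss' where ss: "ss = s # ss'"
    using Cons.prems(1) by (cases ss) auto
  obtain t ts' where ts: "ts = t # ts'"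
    using Cons.prems(2) by (cases ts) auto
  let ?f = "\<lambda>r. fst (run xs ts' (act x r w))"
  show ?case
  proof (cases "0 \<le> ?f s")
    case True
    then obtain rs where "length rs = length xs" "\<forall>r\<in>set rs. \<bar>r\<bar> \<le> \<delta>"
      "fst (run xs rs (act x s w)) = 0"
      using Cons.IH[of ss' ts' "act x s w"] Cons.prems ss ts by auto
    then show ?thesis
      using Cons.prems ss by (intro exI[of _ "s # rs"]) auto
  next
    case False
    define \<alpha> where "\<alpha> = ?f t / (?f t - ?f s)"
    define \<beta> where "\<beta> = - ?f s / (?f t - ?f s)"
    have t: "0 \<le> ?f t"
      using Cons.prems ts by simp
    have "\<alpha> \<ge> 0" "\<beta> \<ge> 0" "\<alpha> + \<beta> = 1"
      using False t by (auto simp: \<alpha>_def \<beta>_def diff_divide_distrib[symmetric] divide_nonpos_pos)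
    moreover have "\<bar>s\<bar> \<le> \<delta>" "\<bar>t\<bar> \<le> \<delta>"
      using Cons.prems ss ts by auto
    ultimately have "\<bar>\<alpha> * s + \<beta> * t\<bar> \<le> \<delta>"
      by (rule abs_convex_le)
    moreover have "?f (\<alpha> * s + \<beta> * t) = 0"
      unfolding \<alpha>_def \<beta>_def by (rule fst_run_zero_between) (use False t in auto)
    ultimately show ?thesis
      using Cons.prems ts by (intro exI[of _ "(\<alpha> * s + \<beta> * t) # ts'"]) auto
  qed
qed

text \<open>On a box a multiaffine function averages its vertex values with nonnegative weights of
  sum 1. The induction moves one coordinate at a time from the ends of its interval to its value in
  \<open>rs\<close>.\<close>

lemma run_pos_from_vertices:
  fixes xs :: "(bool \<times> real \<times> real \<times> real) list"
  assumes "\<And>ss. length ss = length xs \<Longrightarrow> set ss \<subseteq> {\<delta>, - \<delta>} \<Longrightarrow> 0 < fst (run xs ss w)"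
    and "length rs = length xs" "\<forall>r\<in>set rs. \<bar>r\<bar> \<le> \<delta>"
  shows "0 < fst (run xs rs w)"
  using assms
proof (induction xs arbitrary: rs w)
  case Nil
  then show ?case by simp
next
  case (Cons x xs)
  obtain r rs' where rs: "rs = r # rs'"
    using Cons.prems(2) by (cases rs) auto
  have "0 < fst (run xs ss (act x r w))" if ss: "length ss = length xs" "set ss \<subseteq> {\<delta>, - \<delta>}" for ss
  proof (cases "\<delta> = 0")
    case True
    then show ?thesis
      using Cons.prems(1)[of "0 # ss"] Cons.prems(3) ss rs by auto
  next
    case False
    \<comment> \<open>The barycentric coordinates of \<open>r\<close> between
      \<open>\<delta>\<close> and \<open>- \<delta>\<close>; their denominator is the reason for
      treating \<open>\<delta> = 0\<close> separately.\<close>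
    define \<alpha> where "\<alpha> = (\<delta> + r) / (2 * \<delta>)"
    define \<beta> where "\<beta> = (\<delta> - r) / (2 * \<delta>)"
    have "\<bar>r\<bar> \<le> \<delta>"
      using Cons.prems(3) rs by simp
    then have \<alpha>\<beta>: "\<alpha> \<ge> 0" "\<beta> \<ge> 0" "\<alpha> + \<beta> = 1" and r: "\<alpha> * \<delta> + \<beta> * (- \<delta>) = r"
      using False by (auto simp: \<alpha>_def \<beta>_def field_simps)
    have "0 < fst (run xs ss (act x \<delta> w))" "0 < fst (run xs ss (act x (- \<delta>) w))"
      using Cons.prems(1)[of "\<delta> # ss"] Cons.prems(1)[of "(- \<delta>) # ss"] ss by auto
    moreover have "0 < \<alpha> \<or> 0 < \<beta>"
      using \<alpha>\<beta> by linarith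
    moreover have "fst (run xs ss (act x r w)) =
        \<alpha> * fst (run xs ss (act x \<delta> w)) + \<beta> * fst (run xs ss (act x (- \<delta>) w))"
      using fst_run_affine[OF \<alpha>\<beta>(3), of xs ss x \<delta> "- \<delta>" w] unfolding r .
    ultimately show ?thesis
      using \<alpha>\<beta>(1,2) by (auto intro: add_pos_nonneg add_nonneg_pos)
  qed
  moreover have "length rs' = length xs" "\<forall>r\<in>set rs'. \<bar>r\<bar> \<le> \<delta>"
    using Cons.prems(2,3) rs by auto
  ultimately have "0 < fst (run xs rs' (act x r w))"
    by (rule Cons.IH)
  then show ?case by (simp add: rs)
qed

lemma run_uminus: "run xs ss (- p, - q) = (- fst (run xs ss (p, q)), - snd (run xs ss (p, q)))"
  using run_comb[of xs ss "-1" "(p, q)" 0 "(p, q)"] by (simp add: comb_def)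

lemma run_no_zero_iff:
  fixes xs :: "(bool \<times> real \<times> real \<times> real) list"
  assumes "0 \<le> \<delta>"
  shows "(\<exists>rs. length rs = length xs \<and> (\<forall>r\<in>set rs. \<bar>r\<bar> \<le> \<delta>) \<and> fst (run xs rs w) = 0) \<longleftrightarrow>
    \<not> ((\<forall>ss. length ss = length xs \<longrightarrow> set ss \<subseteq> {\<delta>, - \<delta>} \<longrightarrow> 0 < fst (run xs ss w)) \<or>
       (\<forall>ss. length ss = length xs \<longrightarrow> set ss \<subseteq> {\<delta>, - \<delta>} \<longrightarrow> fst (run xs ss w) < 0))"
    (is "?Z \<longleftrightarrow> \<not> (?P \<or> ?N)")
proof
  assume ?Z
  then obtain rs where rs: "length rs = length xs" "\<forall>r\<in>set rs. \<bar>r\<bar> \<le> \<delta>" "fst (run xs rs w) = 0"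
    by auto
  have "\<not> ?P"
    using run_pos_from_vertices[of xs \<delta> w rs] rs by auto
  moreover have "\<not> ?N"
    using run_pos_from_vertices[of xs \<delta> "(- fst w, - snd w)" rs] rs
    by (auto simp: run_uminus)
  ultimately show "\<not> (?P \<or> ?N)" by simp
next
  assume "\<not> (?P \<or> ?N)"
  then obtain ss ts where "length ss = length xs" "length ts = length xs"
    "set ss \<subseteq> {\<delta>, - \<delta>}" "set ts \<subseteq> {\<delta>, - \<delta>}"
    "fst (run xs ss w) \<le> 0" "0 \<le> fst (run xs ts w)"
    by (auto simp: not_less)
  then show ?Z
    using assms by (intro run_intermediate_value[of ss _ ts]) auto
qed

section \<open>Zeros of bounded size for integer coefficients\<close>

definition weight :: "bool \<times> 'a \<times> 'a \<times> 'a \<Rightarrow> 'a::linordered_idom" where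
  "weight x = (case x of (k, a, e, d) \<Rightarrow> \<bar>a\<bar> + \<bar>e\<bar> + \<bar>d\<bar>)"

definition sup_norm :: "'a \<times> 'a \<Rightarrow> 'a::linordered_idom" where
  "sup_norm w = max \<bar>fst w\<bar> \<bar>snd w\<bar>"

text \<open>The operator norm for the maximum norm is the largest absolute row sum of the two by two
  matrix, and the factor on the right dominates both rows for either kind of parameter.\<close>

lemma sup_norm_act_le:
  assumes "\<bar>s\<bar> \<le> c" "1 \<le> c"
  shows "sup_norm (act (k, a, e, d) s w) \<le> (\<bar>a\<bar> + c * \<bar>e\<bar> + \<bar>d\<bar>) * sup_norm w"
proof -
  obtain p q where w: "w = (p, q)" by (cases w)
  let ?N = "sup_norm (p, q)"
  have N: "\<bar>p\<bar> \<le> ?N" "\<bar>q\<bar> \<le> ?N" "0 \<le> ?N"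
    by (auto simp: sup_norm_def)
  have "\<bar>a + s * e\<bar> \<le> \<bar>a\<bar> + \<bar>s\<bar> * \<bar>e\<bar>"
    by (metis abs_mult abs_triangle_ineq)
  also have "\<dots> \<le> \<bar>a\<bar> + c * \<bar>e\<bar>"
    using assms by (intro add_left_mono mult_right_mono) auto
  finally have t: "\<bar>a + s * e\<bar> \<le> \<bar>a\<bar> + c * \<bar>e\<bar>" .
  have c0: "0 \<le> \<bar>a\<bar> + c * \<bar>e\<bar>"
    using assms by simp
  have tp: "\<bar>(a + s * e) * r\<bar> \<le> (\<bar>a\<bar> + c * \<bar>e\<bar>) * ?N" if "\<bar>r\<bar> \<le> ?N" for r
    unfolding abs_mult using t that c0 by (intro mult_mono) auto
  have dp: "\<bar>d * r\<bar> \<le> \<bar>d\<bar> * ?N" if "\<bar>r\<bar> \<le> ?N" for r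
    unfolding abs_mult using that by (intro mult_left_mono) auto
  have "\<bar>(a + s * e) * p - d * q\<bar> \<le> \<bar>(a + s * e) * p\<bar> + \<bar>d * q\<bar>"
    by (rule abs_triangle_ineq4)
  then have 1: "\<bar>(a + s * e) * p - d * q\<bar> \<le> (\<bar>a\<bar> + c * \<bar>e\<bar> + \<bar>d\<bar>) * ?N"
    using tp[OF N(1)] dp[OF N(2)] by (simp add: distrib_right)
  have 2: "\<bar>d * p\<bar> \<le> (\<bar>a\<bar> + c * \<bar>e\<bar> + \<bar>d\<bar>) * ?N"
    using dp[OF N(1)] mult_nonneg_nonneg[OF c0 N(3)] by (simp add: distrib_right)
  have 3: "\<bar>(a + s * e) * q\<bar> \<le> (\<bar>a\<bar> + c * \<bar>e\<bar> + \<bar>d\<bar>) * ?N"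
    using tp[OF N(2)] mult_nonneg_nonneg[OF abs_ge_zero[of d] N(3)] by (simp add: distrib_right)
  show ?thesis
    unfolding w using 1 2 3 by (cases k) (simp_all add: sup_norm_def[of "(_, _)"] max_def)
qed

text \<open>\<open>r = (1 - r) * 0 + r * 1\<close> holds for every real \<open>r\<close>, also
  outside the unit interval, so that the corners of the unit cube determine a multiaffine function
  everywhere.\<close>

lemma run_const_from_vertices:
  fixes xs :: "(bool \<times> real \<times> real \<times> real) list"
  assumes "\<And>ss. length ss = length xs \<Longrightarrow> set ss \<subseteq> {0, 1} \<Longrightarrow> fst (run xs ss w) = c"
    and "length rs = length xs"
  shows "fst (run xs rs w) = c"
  using assms
proof (induction xs arbitrary: rs w)
  case Nil
  then show ?case by simp
next
  case (Cons x xs)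
  obtain r rs' where rs: "rs = r # rs'"
    using Cons.prems(2) by (cases rs) auto
  have "fst (run xs ss (act x r w)) = c" if "length ss = length xs" "set ss \<subseteq> {0, 1}" for ss
  proof -
    have "fst (run xs ss (act x r w)) =
        (1 - r) * fst (run xs ss (act x 0 w)) + r * fst (run xs ss (act x 1 w))"
      using fst_run_affine[of "1 - r" r xs ss x 0 1 w] by simp
    moreover have "fst (run xs ss (act x 0 w)) = c" "fst (run xs ss (act x 1 w)) = c"
      using Cons.prems(1)[of "0 # ss"] Cons.prems(1)[of "1 # ss"] that by auto
    ultimately show ?thesis
      by (simp add: algebra_simps)
  qed
  moreover have "length rs' = length xs"
    using Cons.prems(2) rs by auto
  ultimately have "fst (run xs rs' (act x r w)) = c"
    by (rule Cons.IH)
  then show ?case by (simp add: rs)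
qed

definition real_pair :: "int \<times> int \<Rightarrow> real \<times> real" where
  "real_pair w = (of_int (fst w), of_int (snd w))"

definition real_param :: "bool \<times> int \<times> int \<times> int \<Rightarrow> bool \<times> real \<times> real \<times> real" where
  "real_param x = (case x of (k, a, e, d) \<Rightarrow> (k, of_int a, of_int e, of_int d))"

lemma fst_real_pair [simp]: "fst (real_pair w) = of_int (fst w)"
  by (simp add: real_pair_def)

lemma act_of_int: "act (real_param x) (of_int s) (real_pair w) = real_pair (act x s w)"
  by (cases x; cases w) (auto simp: real_param_def real_pair_def)

lemma run_of_int:
  "run (map real_param xs) (map of_int ss) (real_pair w) = real_pair (run xs ss w)"
  by (induction xs ss w rule: run.induct) (simp_all add: act_of_int)

lemma sup_norm_nonneg: "0 \<le> sup_norm w"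
  by (simp add: sup_norm_def le_max_iff_disj)

lemma weight_nonneg: "0 \<le> weight x"
  by (simp add: weight_def split: prod.split)

lemma sup_norm_act_le_weight:
  "\<bar>s\<bar> \<le> 1 \<Longrightarrow> sup_norm (act x s w) \<le> weight x * sup_norm w"
  using sup_norm_act_le[of s 1] by (cases x) (simp add: weight_def)

lemma sup_norm_run_le:
  "\<forall>s\<in>set ss. \<bar>s\<bar> \<le> 1 \<Longrightarrow> length ss = length xs \<Longrightarrow>
    sup_norm (run xs ss w) \<le> prod_list (map weight xs) * sup_norm w"
proof (induction xs ss w rule: run.induct)
  case (1 x xs s ss w)
  have "sup_norm (run (x # xs) (s # ss) w) \<le> prod_list (map weight xs) * sup_norm (act x s w)"
    using 1 by simp
  also have "\<dots> \<le> prod_list (map weight xs) * (weight x * sup_norm w)"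
    using 1 by (intro mult_left_mono sup_norm_act_le_weight prod_list_nonneg)
      (auto simp: weight_nonneg)
  finally show ?case by (simp add: mult_ac)
qed auto

text \<open>
  Cramer's rule for a multiaffine integer polynomial: along an edge of the cube on which it
  changes, it has a root of size at most its value, because the slope is an integer.
\<close>

lemma run_bounded_zero_edge:
  assumes "length ss = length xs" "length ts = length xs" "set ss \<union> set ts \<subseteq> {0, 1::int}"
    and "fst (run xs ss w) \<noteq> fst (run xs ts w)"
    and "prod_list (map weight xs) * sup_norm w \<le> B" "1 \<le> B"
  shows "\<exists>rs. length rs = length xs \<and> (\<forall>r\<in>set rs. \<bar>r\<bar> \<le> of_int B) \<and>
     fst (run (map real_param xs) rs (real_pair w)) = 0"
  using assms
proof (induction xs arbitrary: ss ts w)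
  case Nil
  then show ?case by simp
next
  case (Cons x xs)
  obtain s ss' where ss: "ss = s # ss'"
    using Cons.prems(1) by (cases ss) auto
  obtain t ts' where ts: "ts = t # ts'"
    using Cons.prems(2) by (cases ts) auto
  let ?f = "\<lambda>r. fst (run xs ts' (act x r w))"
  have s: "\<bar>s\<bar> \<le> 1" and t: "\<bar>t\<bar> \<le> 1"
    using Cons.prems(3) ss ts by auto
  show ?case
  proof (cases "?f s = ?f t")
    case True
    \<comment> \<open>With the head fixed at \<open>s\<close>, its weight passes from the product to
      the norm of the new start vector, so that the same \<open>B\<close> serves for the induction
      hypothesis.\<close>
    have "prod_list (map weight xs) * sup_norm (act x s w)
        \<le> prod_list (map weight xs) * (weight x * sup_norm w)"
      using s by (intro mult_left_mono sup_norm_act_le_weight prod_list_nonneg)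
        (auto simp: weight_nonneg)
    then have "prod_list (map weight xs) * sup_norm (act x s w) \<le> B"
      using Cons.prems(5) by (simp add: mult_ac)
    moreover have "fst (run xs ss' (act x s w)) \<noteq> ?f s"
      using Cons.prems(4) True ss ts by simp
    ultimately obtain rs where "length rs = length xs" "\<forall>r\<in>set rs. \<bar>r\<bar> \<le> of_int B"
      "fst (run (map real_param xs) rs (real_pair (act x s w))) = 0"
      using Cons.IH[of ss' ts' "act x s w"] Cons.prems ss ts by auto
    moreover have "\<bar>real_of_int s\<bar> \<le> of_int B"
      using s Cons.prems(6) by linarith
    ultimately show ?thesis
      by (intro exI[of _ "of_int s # rs"]) (auto simp: act_of_int)
  next
    case False
    then have st: "{s, t} = {0, 1}"
      using Cons.prems(3) ss ts by auto
    have ne: "?f 0 \<noteq> ?f 1"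
      using False st by (auto simp: doubleton_eq_iff)
    let ?rs = "map real_of_int ts'"
    let ?g = "\<lambda>r. fst (run (map real_param xs) ?rs (act (real_param x) r (real_pair w)))"
    have g: "?g (of_int r) = of_int (?f r)" for r
      by (simp add: act_of_int run_of_int)
    have g0: "?g 0 = of_int (?f 0)" and g1: "?g 1 = of_int (?f 1)"
      using g[of 0] g[of 1] by simp_all
    define r where "r = - ?g 0 / (?g 1 - ?g 0)"
    have "?g (?g 1 / (?g 1 - ?g 0) * 0 + r * 1) = 0"
      unfolding r_def by (rule fst_run_zero_between) (use ne g0 g1 in auto)
    then have zero: "?g r = 0" by simp
    have "1 \<le> \<bar>?g 1 - ?g 0\<bar>"
      using ne unfolding g0 g1 of_int_diff[symmetric] of_int_abs[symmetric] by linarith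
    then have "\<bar>?g 0\<bar> / \<bar>?g 1 - ?g 0\<bar> \<le> \<bar>?g 0\<bar> / 1"
      by (intro divide_left_mono) auto
    then have "\<bar>r\<bar> \<le> \<bar>?g 0\<bar>"
      by (simp add: r_def abs_divide)
    also have "\<dots> = of_int \<bar>?f 0\<bar>"
      by (simp add: g0)
    also have "\<bar>?f 0\<bar> \<le> prod_list (map weight (x # xs)) * sup_norm w"
    proof -
      have "\<bar>?f 0\<bar> \<le> sup_norm (run (x # xs) (0 # ts') w)"
        by (simp add: sup_norm_def)
      also have "\<dots> \<le> prod_list (map weight (x # xs)) * sup_norm w"
        using Cons.prems ts by (intro sup_norm_run_le) auto
      finally show ?thesis .
    qed
    then have "of_int \<bar>?f 0\<bar> \<le> real_of_int B"
      using Cons.prems(5) by linarith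
    finally have "\<bar>r\<bar> \<le> of_int B" by simp
    moreover have "\<bar>r\<bar> \<le> of_int B" if "r \<in> set ?rs" for r
      using that Cons.prems(3,6) ts by auto
    ultimately show ?thesis
      using zero Cons.prems(2) ts by (intro exI[of _ "r # ?rs"]) auto
  qed
qed

text \<open>Either two corners of the unit cube disagree and an edge carries a bounded zero, or the
  function is constant. In the second case the given zero makes it vanish identically, and the list
  of zeros will do.\<close>

lemma run_bounded_zero:
  assumes "length rs = length xs" "fst (run (map real_param xs) rs (real_pair w)) = 0"
    and "prod_list (map weight xs) * sup_norm w \<le> B" "1 \<le> B"
  shows "\<exists>rs. length rs = length xs \<and> (\<forall>r\<in>set rs. \<bar>r\<bar> \<le> of_int B) \<and>
     fst (run (map real_param xs) rs (real_pair w)) = 0"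
proof (cases "\<exists>ss ts. length ss = length xs \<and> length ts = length xs \<and>
    set ss \<union> set ts \<subseteq> {0, 1::int} \<and> fst (run xs ss w) \<noteq> fst (run xs ts w)")
  case True
  then show ?thesis
    using run_bounded_zero_edge assms by blast
next
  case False
  define z where "z = replicate (length xs) (0::int)"
  have z: "length z = length xs" "set z \<subseteq> {0, 1}"
    by (auto simp: z_def)
  let ?c = "real_of_int (fst (run xs z w))"
  have "fst (run (map real_param xs) ss (real_pair w)) = ?c"
    if ss: "length ss = length xs" "set ss \<subseteq> {0, 1}" for ss
  proof -
    define ts where "ts = map floor ss"
    have "ss = map of_int ts"
      using ss(2) unfolding ts_def by (induction ss) auto
    moreover have "length ts = length xs" "set ts \<subseteq> {0, 1}"
      using ss by (auto simp: ts_def)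
    then have "fst (run xs ts w) = fst (run xs z w)"
      using False z by blast
    ultimately show ?thesis
      by (simp add: run_of_int)
  qed
  then have "fst (run (map real_param xs) ss (real_pair w)) = ?c" if "length ss = length xs" for ss
    using run_const_from_vertices[of "map real_param xs" "real_pair w" ?c ss] that by simp
  then have "fst (run (map real_param xs) (replicate (length xs) 0) (real_pair w)) = 0"
    using assms(1,2) by simp
  then show ?thesis
    using assms(4) by (intro exI[of _ "replicate (length xs) 0"]) auto
qed

section \<open>Cones in the plane\<close>

definition cross :: "'a \<times> 'a \<Rightarrow> 'a \<times> 'a \<Rightarrow> 'a::linordered_idom" where
  "cross u v = fst u * snd v - snd u * fst v"

definition dot :: "'a \<times> 'a \<Rightarrow> 'a \<times> 'a \<Rightarrow> 'a::linordered_idom" where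
  "dot u v = fst u * fst v + snd u * snd v"

text \<open>
  The closed cone spanned by \<open>u\<close> and \<open>v\<close> is pointed and \<open>v\<close> lies counterclockwise of \<open>u\<close>;
  the two rays may coincide.
\<close>

definition pointed :: "'a \<times> 'a \<Rightarrow> 'a \<times> 'a::linordered_idom \<Rightarrow> bool" where
  "pointed u v \<longleftrightarrow> 0 < cross u v \<or> cross u v = 0 \<and> 0 < dot u v"

text \<open>Integer vectors require a definition without division: \<open>comb c w 0 w\<close> is
  \<open>c\<close> times \<open>w\<close>, with a positive scale factor \<open>c\<close>. The
  condition \<open>0 < \<alpha> + \<beta>\<close> rules out the zero combination.\<close>

definition in_cone :: "'a \<times> 'a \<Rightarrow> 'a \<times> 'a \<Rightarrow> 'a \<times> 'a::linordered_idom \<Rightarrow> bool" where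
  "in_cone u v w \<longleftrightarrow> (\<exists>c \<alpha> \<beta>. 0 < c \<and> 0 \<le> \<alpha> \<and> 0 \<le> \<beta> \<and> 0 < \<alpha> + \<beta> \<and>
     comb c w 0 w = comb \<alpha> u \<beta> v)"

lemma in_coneI:
  "0 < c \<Longrightarrow> 0 \<le> \<alpha> \<Longrightarrow> 0 \<le> \<beta> \<Longrightarrow> 0 < \<alpha> + \<beta> \<Longrightarrow> comb c w 0 w = comb \<alpha> u \<beta> v \<Longrightarrow> in_cone u v w"
  unfolding in_cone_def by blast

lemma in_cone_left: "in_cone u v u" and in_cone_right: "in_cone u v v"
  by (rule in_coneI[of 1 1 0]; simp add: comb_def) (rule in_coneI[of 1 0 1]; simp add: comb_def)

text \<open>The scale factors \<open>c1\<close> of \<open>x\<close> and \<open>c2\<close> of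
  \<open>y\<close> cannot be divided out, so the equation for \<open>w\<close> is multiplied by
  both; this is the origin of the products in the witnesses.\<close>

lemma in_cone_comb:
  assumes "in_cone u v x" "in_cone u v y" "0 < c" "0 \<le> \<alpha>" "0 \<le> \<beta>" "0 < \<alpha> + \<beta>"
    and "comb c w 0 w = comb \<alpha> x \<beta> y"
  shows "in_cone u v w"
proof -
  obtain c1 a1 b1 where 1: "0 < c1" "0 \<le> a1" "0 \<le> b1" "0 < a1 + b1" "comb c1 x 0 x = comb a1 u b1 v"
    using assms(1) unfolding in_cone_def by blast
  obtain c2 a2 b2 where 2: "0 < c2" "0 \<le> a2" "0 \<le> b2" "0 < a2 + b2" "comb c2 y 0 y = comb a2 u b2 v"
    using assms(2) unfolding in_cone_def by blast
  show ?thesis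
  proof (rule in_coneI)
    show "0 < c * c1 * c2"
      using assms 1 2 by simp
    show "0 \<le> \<alpha> * c2 * a1 + \<beta> * c1 * a2" "0 \<le> \<alpha> * c2 * b1 + \<beta> * c1 * b2"
      using assms 1 2 by simp_all
    have "0 < \<alpha> * (c2 * (a1 + b1)) + \<beta> * (c1 * (a2 + b2))"
    proof (cases "\<alpha> = 0")
      case True
      then show ?thesis using assms 1 2 by simp
    next
      case False
      then have "0 < \<alpha>" using assms by simp
      then show ?thesis using assms 1 2 by (intro add_pos_nonneg) simp_all
    qed
    then show "0 < (\<alpha> * c2 * a1 + \<beta> * c1 * a2) + (\<alpha> * c2 * b1 + \<beta> * c1 * b2)"
      by (simp add: algebra_simps)
    have lin: "c * c1 * c2 * r = (\<alpha> * c2 * a1 + \<beta> * c1 * a2) * p + (\<alpha> * c2 * b1 + \<beta> * c1 * b2) * q"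
      if "c * r = \<alpha> * r1 + \<beta> * r2" "c1 * r1 = a1 * p + b1 * q" "c2 * r2 = a2 * p + b2 * q" for r r1 r2 p q
    proof -
      have "c * c1 * c2 * r - ((\<alpha> * c2 * a1 + \<beta> * c1 * a2) * p + (\<alpha> * c2 * b1 + \<beta> * c1 * b2) * q) =
          c1 * c2 * (c * r - (\<alpha> * r1 + \<beta> * r2)) + \<alpha> * c2 * (c1 * r1 - (a1 * p + b1 * q)) +
          \<beta> * c1 * (c2 * r2 - (a2 * p + b2 * q))"
        by (simp add: algebra_simps)
      then show ?thesis
        using that by simp
    qed
    show "comb (c * c1 * c2) w 0 w =
        comb (\<alpha> * c2 * a1 + \<beta> * c1 * a2) u (\<alpha> * c2 * b1 + \<beta> * c1 * b2) v"
      using assms(7) 1(5) 2(5) lin[of "fst w" "fst x" "fst y"] lin[of "snd w" "snd x" "snd y"]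
      by (simp add: comb_def)
  qed
qed

lemma in_cone_trans:
  assumes "in_cone u' v' u" "in_cone u' v' v" "in_cone u v w"
  shows "in_cone u' v' w"
  using assms(3) in_cone_comb[OF assms(1,2)] unfolding in_cone_def[of u v w] by blast

text \<open>The sign of \<open>cross u w\<close> tells on which side of \<open>u\<close> the vector
  \<open>w\<close> lies. On the left, \<open>w\<close> becomes the new left ray if it passes
  \<open>v\<close>; on the right, it becomes the new right ray, provided that \<open>v\<close> is
  still less than a half-turn away; on the line of \<open>u\<close>, it has to point in the
  direction of \<open>u\<close>. For a pointed pair, \<open>ok\<close> is lost if no open half-plane
  contains all three vectors.\<close>

fun ins :: "'a \<times> 'a \<Rightarrow> ('a \<times> 'a) \<times> ('a \<times> 'a) \<times> bool \<Rightarrow> ('a \<times> 'a) \<times> ('a \<times> 'a::linordered_idom) \<times> bool" where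
  "ins w (u, v, ok) =
     (if 0 < cross u w then (u, if cross w v < 0 then w else v, ok)
      else if cross u w < 0 then (if 0 < cross w v then (w, v, ok) else (u, v, False))
      else (u, v, ok \<and> 0 < dot u w))"

lemma dot_self_pos: "u \<noteq> (0, 0) \<Longrightarrow> 0 < dot u u"
  by (cases u) (auto simp: dot_def add_pos_nonneg add_nonneg_pos
      zero_less_mult_iff linorder_neq_iff sum_squares_gt_zero_iff)

lemma pointed_nonzero: "pointed u v \<Longrightarrow> u \<noteq> (0, 0)" "pointed u v \<Longrightarrow> v \<noteq> (0, 0)"
  by (auto simp: pointed_def cross_def dot_def)

lemma pointed_self: "pointed u u \<longleftrightarrow> u \<noteq> (0, 0)"
  using dot_self_pos[of u] pointed_nonzero(1)[of u u]
  by (auto simp: pointed_def cross_def mult.commute)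

text \<open>Cramer's rule in the plane, with the denominator \<open>cross u v\<close> multiplied
  out.\<close>

lemma cross_expand: "comb (cross u v) w 0 w = comb (cross w v) u (cross u w) v"
  by (simp add: comb_def cross_def algebra_simps)

text \<open>A vector on the line of \<open>u\<close> is its own orthogonal projection onto this
  line.\<close>

lemma parallel_expand:
  assumes "cross u w = 0"
  shows "comb (dot u u) w 0 w = comb (dot u w) u 0 u"
proof -
  have "dot u u * fst w - dot u w * fst u = - snd u * cross u w"
    "dot u u * snd w - dot u w * snd u = fst u * cross u w"
    by (simp_all add: cross_def dot_def algebra_simps)
  then show ?thesis
    using assms by (simp add: comb_def)
qed

text \<open>The two memberships at the end matter as much as the cone: extremal vectors are always
  taken from the given ones, so that they remain reachable vectors, and a functional that is
  positive on all given vectors stays positive on them.\<close>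

lemma ins_cone:
  assumes "pointed u v" "ins w (u, v, True) = (u', v', True)"
  shows "pointed u' v'" "in_cone u' v' u" "in_cone u' v' v" "in_cone u' v' w"
    "u' \<in> {u, v, w}" "v' \<in> {u, v, w}"
proof -
  have uv: "0 \<le> cross u v" "cross u v = 0 \<Longrightarrow> 0 < dot u v"
    using assms(1) by (auto simp: pointed_def)
  have u0: "0 < dot u u" and v0: "0 < dot v v"
    using dot_self_pos[OF pointed_nonzero(1)[OF assms(1)]]
      dot_self_pos[OF pointed_nonzero(2)[OF assms(1)]] .
  have anti: "cross a b = - cross b a" for a b :: "'a \<times> 'a"
    by (simp add: cross_def)
  consider (keep) "0 < cross u w" "0 \<le> cross w v" "u' = u" "v' = v"
    | (right) "0 < cross u w" "cross w v < 0" "u' = u" "v' = w"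
    | (left) "cross u w < 0" "0 < cross w v" "u' = w" "v' = v"
    | (ray) "cross u w = 0" "0 < dot u w" "u' = u" "v' = v"
  proof (cases "cross u w" "0 :: 'a" rule: linorder_cases)
    case less
    then have "(if 0 < cross w v then (w, v, True) else (u, v, False)) = (u', v', True)"
      using assms(2) by simp
    then have "0 < cross w v" "u' = w" "v' = v"
      by (simp_all split: if_splits)
    with less show ?thesis
      by (rule left)
  next
    case equal
    have "(u, v, 0 < dot u w) = (u', v', True)"
      unfolding assms(2)[symmetric] ins.simps by (simp add: equal)
    then have "0 < dot u w" "u' = u" "v' = v"
      unfolding prod.inject by blast+
    with equal show ?thesis
      by (rule ray)
  next
    case greater
    then have "(u, if cross w v < 0 then w else v, True) = (u', v', True)"
      using assms(2) by simp
    then have *: "u' = u" "v' = (if cross w v < 0 then w else v)"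
      by simp_all
    show ?thesis
    proof (cases "cross w v < 0")
      case True
      show ?thesis
        by (rule right) (use greater True * in simp_all)
    next
      case False
      show ?thesis
        by (rule keep) (use greater False * in simp_all)
    qed
  qed
  then have "pointed u' v' \<and> in_cone u' v' u \<and> in_cone u' v' v \<and> in_cone u' v' w \<and>
      u' \<in> {u, v, w} \<and> v' \<in> {u, v, w}"
  proof cases
    case keep
    \<comment> \<open>If \<open>u\<close> and \<open>v\<close> spanned the same ray, a vector
      strictly to the left of \<open>u\<close> would also be strictly to the left of
      \<open>v\<close>, contrary to \<open>0 \<le> cross w v\<close>.\<close>
    have "cross u v \<noteq> 0"
    proof
      assume 0: "cross u v = 0"
      have "comb (dot u u) v 0 v = comb (dot u v) u 0 u"
        by (rule parallel_expand[OF 0])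
      then have "dot u u * cross w v = dot u v * cross w u"
      proof -
        have "dot u u * cross w v - dot u v * cross w u =
            fst w * (dot u u * snd v - dot u v * snd u) - snd w * (dot u u * fst v - dot u v * fst u)"
          by (simp add: cross_def algebra_simps)
        then show ?thesis
          using \<open>comb (dot u u) v 0 v = comb (dot u v) u 0 u\<close> by (simp add: comb_def)
      qed
      moreover have "dot u v * cross w u < 0"
        using uv(2)[OF 0] keep(1) anti[of w u] by (simp add: mult_pos_neg)
      moreover have "0 \<le> dot u u * cross w v"
        using u0 keep(2) by simp
      ultimately show False by simp
    qed
    then have "0 < cross u v"
      using uv by simp
    then have "in_cone u v w"
      using keep cross_expand[of u v w] by (intro in_coneI) auto
    then show ?thesis
      using keep assms(1) by (simp add: in_cone_left in_cone_right)
  next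
    case right
    have "in_cone u w v"
      using right uv(1) cross_expand[of u w v] anti[of v w] by (intro in_coneI) auto
    then show ?thesis
      using right by (simp add: pointed_def in_cone_left in_cone_right)
  next
    case left
    have "in_cone w v u"
      using left uv(1) cross_expand[of w v u] anti[of w u] by (intro in_coneI) auto
    then show ?thesis
      using left by (simp add: pointed_def in_cone_left in_cone_right)
  next
    case ray
    have "in_cone u v w"
      using ray u0 parallel_expand[OF ray(1)]
      by (intro in_coneI[of "dot u u" "dot u w" 0]) (auto simp: comb_def)
    then show ?thesis
      using ray assms(1) by (simp add: in_cone_left in_cone_right)
  qed
  then show "pointed u' v'" "in_cone u' v' u" "in_cone u' v' v" "in_cone u' v' w"
    "u' \<in> {u, v, w}" "v' \<in> {u, v, w}"
    by auto
qed

text \<open>A rejection comes with an equation between a nonnegative multiple of \<open>w\<close>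
  and a combination of \<open>u\<close> and \<open>v\<close> whose coefficients are at most zero.
  Applying \<open>dot z\<close> to it gives the sign.\<close>

lemma ins_fail:
  assumes "pointed u v" "ins w (u, v, True) = (u', v', False)" "0 < dot z u" "0 < dot z v"
  shows "dot z w \<le> 0"
proof -
  have u0: "0 < dot u u"
    using dot_self_pos[OF pointed_nonzero(1)[OF assms(1)]] .
  consider (both) "cross u w < 0" "cross w v \<le> 0" | (ray) "cross u w = 0" "dot u w \<le> 0"
    using assms(2) by (auto split: if_splits)
  then show ?thesis
  proof cases
    case both
    have "cross u v * dot z w = cross w v * dot z u + cross u w * dot z v"
      by (simp add: dot_def cross_def algebra_simps)
    also have "\<dots> < 0"
      using both assms(3,4) by (intro add_nonpos_neg) (auto simp: mult_nonpos_nonneg mult_neg_pos)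
    finally have "cross u v * dot z w < 0" .
    then show ?thesis
      using assms(1) by (auto simp: pointed_def mult_less_0_iff)
  next
    case ray
    have "dot u u * dot z w = dot u w * dot z u"
    proof -
      have "dot u u * dot z w - dot u w * dot z u =
          fst z * (dot u u * fst w - dot u w * fst u) + snd z * (dot u u * snd w - dot u w * snd u)"
        by (simp add: dot_def algebra_simps)
      then show ?thesis
        using parallel_expand[OF ray(1)] by (simp add: comb_def)
    qed
    also have "\<dots> \<le> 0"
      using ray assms(3) by (simp add: mult_nonpos_nonneg)
    finally show ?thesis
      using u0 by (simp add: mult_le_0_iff)
  qed
qed

lemma fold_ins_fail: "\<exists>u' v'. fold ins ws (u, v, False) = (u', v', False)"
  by (induction ws arbitrary: u v) auto

lemma fold_ins_cone:
  assumes "pointed u v" "fold ins ws (u, v, True) = (u', v', True)"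
  shows "pointed u' v' \<and> in_cone u' v' u \<and> in_cone u' v' v \<and> (\<forall>w\<in>set ws. in_cone u' v' w) \<and>
    u' \<in> {u, v} \<union> set ws \<and> v' \<in> {u, v} \<union> set ws"
  using assms
proof (induction ws arbitrary: u v)
  case Nil
  then show ?case by (auto simp: in_cone_left in_cone_right)
next
  case (Cons w ws)
  obtain u1 v1 ok where i: "ins w (u, v, True) = (u1, v1, ok)"
    by (cases "ins w (u, v, True)") auto
  have ok
    using Cons.prems(2) i fold_ins_fail[of ws u1 v1] by (cases ok) (auto simp del: ins.simps)
  with i have i: "ins w (u, v, True) = (u1, v1, True)" by simp
  note 1 = ins_cone[OF Cons.prems(1) i]
  have "fold ins ws (u1, v1, True) = (u', v', True)"
    using Cons.prems(2) i by (simp del: ins.simps)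
  note 2 = Cons.IH[OF 1(1) this]
  have "in_cone u' v' x" if "in_cone u1 v1 x" for x
    using in_cone_trans 2 that by blast
  then show ?case
    using 1 2 by auto
qed

lemma fold_ins_cone_fail:
  assumes "pointed u v" "fold ins ws (u, v, True) = (u', v', False)" "0 < dot z u" "0 < dot z v"
  shows "\<exists>w\<in>set ws. dot z w \<le> 0"
  using assms
proof (induction ws arbitrary: u v)
  case Nil
  then show ?case by simp
next
  case (Cons w ws)
  obtain u1 v1 ok where i: "ins w (u, v, True) = (u1, v1, ok)"
    by (cases "ins w (u, v, True)") auto
  show ?case
  proof (cases ok)
    case True
    with i have i: "ins w (u, v, True) = (u1, v1, True)" by simp
    note 1 = ins_cone[OF Cons.prems(1) i]
    have "fold ins ws (u1, v1, True) = (u', v', False)"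
      using Cons.prems(2) i by (simp del: ins.simps)
    \<comment> \<open>A new extremal vector on which \<open>z\<close> is not positive can only be
      \<open>w\<close>, as \<open>z\<close> is positive on \<open>u\<close> and
      \<open>v\<close>.\<close>
    moreover have "\<exists>w\<in>set (w # ws). dot z w \<le> 0" if "dot z u1 \<le> 0 \<or> dot z v1 \<le> 0"
      using that 1(5,6) Cons.prems(3,4) by auto
    ultimately show ?thesis
      using Cons.IH[OF 1(1)] by (auto simp: not_le[symmetric])
  next
    case False
    then show ?thesis
      using ins_fail[OF Cons.prems(1) _ Cons.prems(3,4)] i by auto
  qed
qed

section \<open>Propagation of the reachable cone along the recurrence\<close>

definition cone_step ::
  "int \<Rightarrow> bool \<times> int \<times> int \<times> int \<Rightarrow> (int \<times> int) \<times> (int \<times> int) \<times> bool \<Rightarrow> (int \<times> int) \<times> (int \<times> int) \<times> bool" where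
  "cone_step s x = (\<lambda>(u, v, ok).
     fold ins [act x s u, act x (- s) u, act x s v, act x (- s) v] (act x s u, act x s u, ok))"

definition same_sign :: "int \<Rightarrow> (bool \<times> int \<times> int \<times> int) list \<Rightarrow> (int \<times> int) set \<Rightarrow> bool" where
  "same_sign s xs S \<longleftrightarrow>
     (\<forall>w\<in>S. \<forall>ss. length ss = length xs \<longrightarrow> set ss \<subseteq> {s, - s} \<longrightarrow> 0 < fst (run xs ss w)) \<or>
     (\<forall>w\<in>S. \<forall>ss. length ss = length xs \<longrightarrow> set ss \<subseteq> {s, - s} \<longrightarrow> fst (run xs ss w) < 0)"

lemma same_sign_Cons:
  "same_sign s (x # xs) S \<longleftrightarrow> same_sign s xs ((\<lambda>(r, w). act x r w) ` ({s, - s} \<times> S))"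
proof -
  have "(\<forall>w\<in>S. \<forall>ss. length ss = length (x # xs) \<longrightarrow> set ss \<subseteq> {s, - s} \<longrightarrow> P (run (x # xs) ss w)) \<longleftrightarrow>
        (\<forall>w\<in>(\<lambda>(r, w). act x r w) ` ({s, - s} \<times> S).
          \<forall>ss. length ss = length xs \<longrightarrow> set ss \<subseteq> {s, - s} \<longrightarrow> P (run xs ss w))" (is "?L \<longleftrightarrow> ?R") for P
  proof
    assume L: ?L
    show ?R
    proof (intro ballI allI impI)
      fix y ss
      assume *: "y \<in> (\<lambda>(r, w). act x r w) ` ({s, - s} \<times> S)"
        "length ss = length xs" "set ss \<subseteq> {s, - s}"
      from *(1) obtain r w where "r \<in> {s, - s}" "w \<in> S" "y = act x r w"
        by (elim imageE SigmaE) simp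
      then show "P (run xs ss y)"
        using L[rule_format, of w "r # ss"] * by simp
    qed
  next
    assume R: ?R
    show ?L
    proof (intro ballI allI impI)
      fix w ss
      assume *: "w \<in> S" "length ss = length (x # xs)" "set ss \<subseteq> {s, - s}"
      then obtain r ss' where ss: "ss = r # ss'"
        by (cases ss) auto
      with * have "act x r w \<in> (\<lambda>(r, w). act x r w) ` ({s, - s} \<times> S)"
        by (intro image_eqI[of _ _ "(r, w)"]) auto
      with R show "P (run (x # xs) ss w)"
        using * ss by auto
    qed
  qed
  from this[of "\<lambda>w. 0 < fst w"] this[of "\<lambda>w. fst w < 0"] show ?thesis
    unfolding same_sign_def by blast
qed

lemma fold_cone_step_fail: "\<exists>u' v'. fold (cone_step s) xs (u, v, False) = (u', v', False)"
proof (induction xs arbitrary: u v)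
  case (Cons x xs)
  have "\<exists>u' v'. cone_step s x (u, v, False) = (u', v', False)"
    unfolding cone_step_def prod.case by (rule fold_ins_fail)
  then show ?case
    using Cons by auto
qed simp

text \<open>
  The remaining steps act by a linear functional on the current vectors, so that these lie in an
  open half-plane if no sign change is possible. Conversely, the two extremal vectors decide about
  all signs at the end.
\<close>

lemma cone_test:
  assumes "pointed u v" "\<forall>w\<in>S. in_cone u v w" "u \<in> S" "v \<in> S"
  shows "(case fold (cone_step s) xs (u, v, True) of (u', v', ok) \<Rightarrow> ok \<and> 0 < fst u' * fst v')
    \<longleftrightarrow> same_sign s xs S"
  using assms
proof (induction xs arbitrary: u v S)
  case Nil
  show ?case
  proof
    assume *: "case fold (cone_step s) [] (u, v, True) of (u', v', ok) \<Rightarrow> ok \<and> 0 < fst u' * fst v'"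
    \<comment> \<open>The first component is a linear functional with the same strict sign on both
      extremal vectors, hence on the whole cone.\<close>
    have pos: "0 < fst w * fst u" if "w \<in> S" for w
    proof -
      obtain c \<alpha> \<beta> where c: "0 < c" "0 \<le> \<alpha>" "0 \<le> \<beta>" "0 < \<alpha> + \<beta>" "comb c w 0 w = comb \<alpha> u \<beta> v"
        using Nil.prems(2) \<open>w \<in> S\<close> unfolding in_cone_def by blast
      have "c * (fst w * fst u) = \<alpha> * (fst u * fst u) + \<beta> * (fst u * fst v)"
      proof -
        have "c * (fst w * fst u) - (\<alpha> * (fst u * fst u) + \<beta> * (fst u * fst v)) =
            fst u * (c * fst w - (\<alpha> * fst u + \<beta> * fst v))"
          by (simp add: algebra_simps)
        then show ?thesis
          using c(5) by (simp add: comb_def)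
      qed
      moreover have uv: "0 < fst u * fst u" "0 < fst u * fst v"
        using * by (auto simp: zero_less_mult_iff)
      have "0 < \<alpha> * (fst u * fst u) + \<beta> * (fst u * fst v)"
      proof (cases "\<alpha> = 0")
        case True
        then show ?thesis using c uv by simp
      next
        case False
        then show ?thesis using c uv by (intro add_pos_nonneg) auto
      qed
      ultimately have "0 < c * (fst w * fst u)"
        by simp
      then show ?thesis
        using c(1) zero_less_mult_pos by blast
    qed
    show "same_sign s [] S"
      unfolding same_sign_def using pos by (cases "0 < fst u") (auto simp: zero_less_mult_iff)
  next
    assume "same_sign s [] S"
    then show "case fold (cone_step s) [] (u, v, True) of (u', v', ok) \<Rightarrow> ok \<and> 0 < fst u' * fst v'"
      using Nil.prems by (auto simp: same_sign_def zero_less_mult_iff)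
  qed
next
  case (Cons x xs)
  let ?G = "[act x s u, act x (- s) u, act x s v, act x (- s) v]"
  let ?S = "(\<lambda>(r, w). act x r w) ` ({s, - s} \<times> S)"
  have G: "set ?G \<subseteq> ?S"
    using Cons.prems(3,4) by auto
  obtain u' v' ok where step: "cone_step s x (u, v, True) = (u', v', ok)"
    by (cases "cone_step s x (u, v, True)") auto
  then have f: "fold ins ?G (act x s u, act x s u, True) = (u', v', ok)"
    by (simp add: cone_step_def del: ins.simps)
  show ?case
  proof (cases ok)
    case True
    \<comment> \<open>\<open>cone_step\<close> starts from the degenerate cone of its first
      generator and then inserts this generator once more; the ray case of \<open>ins\<close>
      thereby rejects a zero vector.\<close>
    have "pointed (act x s u) (act x s u)"
    proof (rule ccontr)
      assume "\<not> pointed (act x s u) (act x s u)"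
      then have "act x s u = (0, 0)"
        using pointed_self by blast
      then have "ins (act x s u) (act x s u, act x s u, True) = (act x s u, act x s u, False)"
        by (simp add: cross_def dot_def)
      then show False
        using f True fold_ins_fail[of "tl ?G" "act x s u" "act x s u"] by (simp del: ins.simps)
    qed
    from fold_ins_cone[OF this f[unfolded eqTrueI[OF True]]]
    have uv': "pointed u' v'" "\<forall>w\<in>set ?G. in_cone u' v' w" "u' \<in> set ?G" "v' \<in> set ?G"
      by auto
    \<comment> \<open>For either sign \<open>r\<close> the map \<open>act x r\<close> is linear, so
      that the images of \<open>u\<close> and \<open>v\<close> span a cone that contains the image
      of every vector of \<open>S\<close>.\<close>
    have "in_cone u' v' w" if "w \<in> ?S" for w
    proof -
      from \<open>w \<in> ?S\<close> obtain r y where w: "w = act x r y" "r \<in> {s, - s}" "y \<in> S"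
        by (elim imageE SigmaE) simp
      obtain c \<alpha> \<beta> where c: "0 < c" "0 \<le> \<alpha>" "0 \<le> \<beta>" "0 < \<alpha> + \<beta>" "comb c y 0 y = comb \<alpha> u \<beta> v"
        using Cons.prems(2) w(3) unfolding in_cone_def by blast
      have "act x r u \<in> set ?G" "act x r v \<in> set ?G"
        using w(2) by auto
      then have "in_cone u' v' (act x r u)" "in_cone u' v' (act x r v)"
        using uv'(2) by blast+
      moreover have "comb c w 0 w = comb \<alpha> (act x r u) \<beta> (act x r v)"
        unfolding w(1) act_comb[symmetric] c(5) ..
      ultimately show ?thesis
        by (rule in_cone_comb[OF _ _ c(1-4)])
    qed
    then have "(case fold (cone_step s) xs (u', v', True) of (u', v', ok) \<Rightarrow> ok \<and> 0 < fst u' * fst v')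
        \<longleftrightarrow> same_sign s xs ?S"
      using subsetD[OF G uv'(3)] subsetD[OF G uv'(4)] by (intro Cons.IH[OF uv'(1)] ballI)
    then show ?thesis
      using step True by (simp add: same_sign_Cons)
  next
    case False
    have "\<not> same_sign s (x # xs) S"
    proof
      assume same: "same_sign s (x # xs) S"
      \<comment> \<open>Any single completion will do: it yields a functional \<open>z\<close> of
        constant strict sign on all vectors of \<open>?S\<close>. Then \<open>z\<close> or
        \<open>- z\<close> is positive on the four generators, and no insertion could have
        failed.\<close>
      define ss where "ss = replicate (length xs) s"
      have ss: "length ss = length xs" "set ss \<subseteq> {s, - s}"
        by (auto simp: ss_def)
      define z where "z = (fst (run xs ss (1, 0)), fst (run xs ss (0, 1)))"
      have z: "fst (run xs ss w) = dot z w" for w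
        unfolding z_def dot_def fst_conv snd_conv fst_run_linear[of xs ss w] by (simp add: mult.commute)
      have "\<exists>z. \<forall>w\<in>set ?G. 0 < dot z w"
      proof (cases "\<forall>w\<in>?S. 0 < dot z w")
        case True
        then show ?thesis using G by blast
      next
        case False
        then have "\<forall>w\<in>?S. dot z w < 0"
          using same[unfolded same_sign_Cons] ss unfolding same_sign_def z[symmetric] by blast
        then have "\<forall>w\<in>?S. 0 < dot (- fst z, - snd z) w"
          by (auto simp: dot_def)
        then show ?thesis using G by blast
      qed
      then obtain z' where z': "\<forall>w\<in>set ?G. 0 < dot z' w"
        by blast
      then have "act x s u \<noteq> (0, 0)"
        by (auto simp: dot_def)
      then have pt: "pointed (act x s u) (act x s u)"
        by (rule iffD2[OF pointed_self])
      have pos: "0 < dot z' (act x s u)"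
        by (rule bspec[OF z']) simp
      have "\<exists>w\<in>set ?G. dot z' w \<le> 0"
        using pt f[unfolded Eq_FalseI[OF False]] pos pos by (rule fold_ins_cone_fail)
      with z' show False
        by (meson linorder_not_less)
    qed
    then show ?thesis
      using step False fold_cone_step_fail[of s xs u' v'] by auto
  qed
qed

section \<open>Determinants of tridiagonal matrices\<close>

lemma invertible_mat_iff_det:
  fixes A :: "'a::field mat"
  assumes A: "A \<in> carrier_mat n n"
  shows "invertible_mat A \<longleftrightarrow> det A \<noteq> 0"
proof
  assume "invertible_mat A"
  then obtain B where B: "A * B = 1\<^sub>m n" "B * A = 1\<^sub>m (dim_row B)"
    using A unfolding invertible_mat_def inverts_mat_def by auto
  then have "B \<in> carrier_mat n n"
    using A by (metis carrier_matD(2) carrier_mat_triv index_mult_mat(2,3) index_one_mat(2,3))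
  with B det_mult[OF A, of B] show "det A \<noteq> 0"
    by (metis det_one mult_zero_left zero_neq_one)
next
  assume "det A \<noteq> 0"
  from det_non_zero_imp_unit[OF A this, of "()"]
  obtain B where "B \<in> carrier_mat n n" "A * B = 1\<^sub>m n" "B * A = 1\<^sub>m n"
    unfolding Units_def ring_mat_def by auto
  then show "invertible_mat A"
    using A unfolding invertible_mat_def inverts_mat_def by auto
qed

definition leading_minor :: "(nat \<Rightarrow> nat \<Rightarrow> 'a) \<Rightarrow> nat \<Rightarrow> 'a::comm_ring_1" where
  "leading_minor F k = det (mat k k (\<lambda>(i, j). F i j))"

lemma leading_minor_0: "leading_minor F 0 = 1"
  by (simp add: leading_minor_def)

lemma leading_minor_1: "leading_minor F (Suc 0) = F 0 0"
  unfolding leading_minor_def by (subst det_single) auto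

text \<open>Expansion along the last row leaves two cofactors; the one off the diagonal is expanded
  along its last column, where only \<open>F k (k + 1)\<close> survives.\<close>

lemma leading_minor_Suc_Suc:
  assumes tri: "\<And>i j. i < k + 2 \<Longrightarrow> j < k + 2 \<Longrightarrow> \<bar>int i - int j\<bar> > 1 \<Longrightarrow> F i j = 0"
  shows "leading_minor F (k + 2) =
    F (k + 1) (k + 1) * leading_minor F (k + 1) - F (k + 1) k * F k (k + 1) * leading_minor F k"
proof -
  let ?A = "mat (k + 2) (k + 2) (\<lambda>(i, j). F i j)"
  let ?B = "mat_delete ?A (k + 1) k"
  have A: "?A \<in> carrier_mat (k + 2) (k + 2)"
    by simp
  have B: "?B \<in> carrier_mat (k + 1) (k + 1)"
    by (simp add: mat_delete_def)
  have "det ?B = (\<Sum>i<k + 1. ?B $$ (i, k) * cofactor ?B i k)"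
    by (rule laplace_expansion_column[OF B]) simp
  also have "\<dots> = (\<Sum>i\<in>{k}. ?B $$ (i, k) * cofactor ?B i k)"
    by (rule sum.mono_neutral_right) (auto simp: mat_delete_def tri)
  also have "\<dots> = F k (k + 1) * cofactor ?B k k"
    by (simp add: mat_delete_def)
  also have "mat_delete ?B k k = mat k k (\<lambda>(i, j). F i j)"
    by (intro eq_matI) (auto simp: mat_delete_def)
  then have "cofactor ?B k k = leading_minor F k"
    by (simp add: cofactor_def leading_minor_def)
  finally have detB: "det ?B = F k (k + 1) * leading_minor F k" .
  have "det ?A = (\<Sum>j<k + 2. ?A $$ (k + 1, j) * cofactor ?A (k + 1) j)"
    by (rule laplace_expansion_row[OF A]) simp
  also have "\<dots> = (\<Sum>j\<in>{k, k + 1}. ?A $$ (k + 1, j) * cofactor ?A (k + 1) j)"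
    by (rule sum.mono_neutral_right) (auto simp: tri)
  also have "\<dots> = F (k + 1) k * cofactor ?A (k + 1) k + F (k + 1) (k + 1) * cofactor ?A (k + 1) (k + 1)"
    by simp
  also have "cofactor ?A (k + 1) k = - (F k (k + 1) * leading_minor F k)"
    using detB by (simp add: cofactor_def)
  also have "mat_delete ?A (k + 1) (k + 1) = mat (k + 1) (k + 1) (\<lambda>(i, j). F i j)"
    by (intro eq_matI) (auto simp: mat_delete_def)
  then have "cofactor ?A (k + 1) (k + 1) = leading_minor F (k + 1)"
    by (simp add: cofactor_def leading_minor_def)
  finally show ?thesis
    by (simp add: leading_minor_def algebra_simps)
qed

section \<open>The parameters of a tridiagonal matrix\<close>

text \<open>
  The entries are enumerated by \<open>j < 3 * n - 2\<close> in the order in which the recurrence for the leading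
  principal minors consumes them: \<open>(k, k)\<close>, \<open>(k + 1, k)\<close>, \<open>(k, k + 1)\<close>, \<open>(k + 1, k + 1)\<close> and so on.
\<close>

definition param_row :: "nat \<Rightarrow> nat" where
  "param_row j = j div 3 + (if j mod 3 = 1 then 1 else 0)"

definition param_col :: "nat \<Rightarrow> nat" where
  "param_col j = j div 3 + (if j mod 3 = 2 then 1 else 0)"

lemma run_append:
  "length ss = length xs \<Longrightarrow> run (xs @ ys) (ss @ ts) w = run ys ts (run xs ss w)"
  by (induction xs ss w rule: run.induct) auto

text \<open>\<open>act\<close> multiplies both components by the denominator \<open>d j\<close>, so
  that the pair stays proportional to two consecutive minors. The two off-diagonal factors gather in
  the second component before the next diagonal parameter completes the recurrence. The start
  \<open>(1, 0)\<close> plays the minors of orders 0 and -1.\<close>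

lemma run_leading_minors:
  fixes x :: "nat \<Rightarrow> bool \<times> 'a \<times> 'a \<times> 'a::comm_ring_1"
  assumes tri: "\<And>i j. i \<le> k \<Longrightarrow> j \<le> k \<Longrightarrow> \<bar>int i - int j\<bar> > 1 \<Longrightarrow> F i j = 0"
    and x: "\<And>j. j < 3 * k + 1 \<Longrightarrow> x j = (j mod 3 = 0, a j, e j, d j)"
    and s: "\<And>j. j < 3 * k + 1 \<Longrightarrow> a j + s j * e j = d j * F (param_row j) (param_col j)"
  shows "run (map x [0..<3 * k + 1]) (map s [0..<3 * k + 1]) (1, 0) =
    ((\<Prod>j<3 * k + 1. d j) * leading_minor F (k + 1), (\<Prod>j<3 * k + 1. d j) * leading_minor F k)"
  using assms
proof (induction k)
  case 0
  then show ?case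
    by (simp add: leading_minor_0 leading_minor_1 param_row_def param_col_def)
next
  case (Suc k)
  let ?m = "3 * k + 1" and ?P = "\<Prod>j<3 * k + 1. d j"
  have m: "3 * Suc k + 1 = ?m + 3"
    by simp
  have "[0..<m + 3] = [0..<m] @ [m, m + 1, m + 2]" for m
    by (simp add: numeral_3_eq_3)
  from this[of ?m] have upt: "[0..<3 * Suc k + 1] = [0..<?m] @ [?m, ?m + 1, ?m + 2]"
    unfolding m .
  have "(\<Prod>j<m + 3. d j) = (\<Prod>j<m. d j) * d m * d (m + 1) * d (m + 2)" for m
    by (simp add: numeral_3_eq_3)
  from this[of ?m] have prod: "(\<Prod>j<3 * Suc k + 1. d j) = ?P * d ?m * d (?m + 1) * d (?m + 2)"
    unfolding m .
  have IH: "run (map x [0..<?m]) (map s [0..<?m]) (1, 0) = (?P * leading_minor F (k + 1), ?P * leading_minor F k)"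
    by (rule Suc.IH) (use Suc.prems in auto)
  have rec: "leading_minor F (Suc k + 1) =
      F (k + 1) (k + 1) * leading_minor F (k + 1) - F (k + 1) k * F k (k + 1) * leading_minor F k"
    using leading_minor_Suc_Suc[of k F] Suc.prems(1) by simp
  have mods: "?m mod 3 = 1" "(?m + 1) mod 3 = 2" "(?m + 2) mod 3 = 0"
    "?m div 3 = k" "(?m + 1) div 3 = k" "(?m + 2) div 3 = k + 1"
    by presburger+
  have xs: "x ?m = (False, a ?m, e ?m, d ?m)" "x (?m + 1) = (False, a (?m + 1), e (?m + 1), d (?m + 1))"
    "x (?m + 2) = (True, a (?m + 2), e (?m + 2), d (?m + 2))"
    using Suc.prems(2)[of ?m] Suc.prems(2)[of "?m + 1"] Suc.prems(2)[of "?m + 2"] mods by simp_all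
  have ss: "a ?m + s ?m * e ?m = d ?m * F (k + 1) k"
    "a (?m + 1) + s (?m + 1) * e (?m + 1) = d (?m + 1) * F k (k + 1)"
    "a (?m + 2) + s (?m + 2) * e (?m + 2) = d (?m + 2) * F (k + 1) (k + 1)"
    using Suc.prems(3)[of ?m] Suc.prems(3)[of "?m + 1"] Suc.prems(3)[of "?m + 2"] mods
    by (simp_all add: param_row_def param_col_def)
  have "run (map x [0..<3 * Suc k + 1]) (map s [0..<3 * Suc k + 1]) (1, 0) =
      run [x ?m, x (?m + 1), x (?m + 2)] [s ?m, s (?m + 1), s (?m + 2)]
        (?P * leading_minor F (k + 1), ?P * leading_minor F k)"
    unfolding upt map_append by (subst run_append) (simp_all only: IH list.map length_map)
  also have "\<dots> = (?P * d ?m * d (?m + 1) * d (?m + 2) * leading_minor F (Suc k + 1),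
      ?P * d ?m * d (?m + 1) * d (?m + 2) * leading_minor F (Suc k))"
    unfolding xs run.simps act.simps if_True if_False ss rec by (simp add: algebra_simps)
  finally show ?case
    unfolding prod .
qed

definition num :: "rat \<Rightarrow> int" where "num q = fst (quotient_of q)"
definition den :: "rat \<Rightarrow> int" where "den q = snd (quotient_of q)"

lemma den_pos: "0 < den q"
  by (simp add: den_def quotient_of_denom_pos')

lemma of_rat_num_den: "real_of_rat q = of_int (num q) / of_int (den q)"
  by (metis num_def den_def of_rat_divide of_rat_of_int_eq prod.collapse quotient_of_div)

text \<open>Centre and radius of an entry are put over the common denominator
  \<open>den p * den q\<close>, so that the numerator is affine in \<open>s\<close> with integer
  coefficients.\<close>

definition param :: "rat mat \<Rightarrow> rat mat \<Rightarrow> nat \<Rightarrow> bool \<times> int \<times> int \<times> int" where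
  "param A \<Delta> j = (let p = A $$ (param_row j, param_col j); q = \<Delta> $$ (param_row j, param_col j)
     in (j mod 3 = 0, num p * den q, num q * den p, den p * den q))"

lemma param_entry:
  "of_int (num p * den q) + s * of_int (num q * den p) =
    of_int (den p * den q) * (real_of_rat p + s * real_of_rat q)"
  using den_pos[of p] den_pos[of q] by (simp add: of_rat_num_den field_simps)

abbreviation real_mat :: "rat mat \<Rightarrow> real mat" where
  "real_mat \<equiv> map_mat real_of_rat"

lemma interval_matrix_iff:
  assumes "A \<in> carrier_mat n n" "\<Delta> \<in> carrier_mat n n"
  shows "A' \<in> interval_matrix A \<Delta> \<delta> \<longleftrightarrow> A' \<in> carrier_mat n n \<and>
    (\<forall>i<n. \<forall>j<n. \<bar>A' $$ (i, j) - A $$ (i, j)\<bar> \<le> \<delta> * \<Delta> $$ (i, j))"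
proof -
  have [simp]: "dim_row A = n" "dim_col A = n" "dim_row \<Delta> = n" "dim_col \<Delta> = n"
    using assms by auto
  have abs: "\<bar>x - a\<bar> \<le> b \<longleftrightarrow> a - b \<le> x \<and> x \<le> a + b" for x a b :: real
    by linarith
  show ?thesis
  proof (cases "A' \<in> carrier_mat n n")
    case True
    then show ?thesis
      unfolding abs interval_matrix_def atLeastAtMost_iff less_eq_mat_def by (simp; blast)
  next
    case False
    then show ?thesis
      unfolding interval_matrix_def atLeastAtMost_iff less_eq_mat_def carrier_mat_def by simp metis
  qed
qed

locale tridiagonal_input =
  fixes A \<Delta> :: "rat mat" and n :: nat
  assumes n: "1 \<le> n" and A: "A \<in> carrier_mat n n" and \<Delta>: "\<Delta> \<in> carrier_mat n n"
    and tri: "tridiagonal A"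
    and nonneg: "\<And>i j. i < n \<Longrightarrow> j < n \<Longrightarrow> 0 \<le> \<Delta> $$ (i, j)"
    and zero: "\<And>i j. i < n \<Longrightarrow> j < n \<Longrightarrow> A $$ (i, j) = 0 \<Longrightarrow> \<Delta> $$ (i, j) = 0"
begin

text \<open>The band has \<open>n\<close> diagonal and \<open>2 * (n - 1)\<close> off-diagonal
  entries.\<close>

definition params :: "(bool \<times> int \<times> int \<times> int) list" where
  "params = map (param A \<Delta>) [0..<3 * n - 2]"

definition singular_at :: "real \<Rightarrow> bool" where
  "singular_at \<delta> \<longleftrightarrow> \<not> regular_interval (interval_matrix (real_mat A) (real_mat \<Delta>) \<delta>)"

lemma length_params: "length params = 3 * n - 2"
  by (simp add: params_def)

lemma param_row_col_less: "j < 3 * n - 2 \<Longrightarrow> param_row j < n" "j < 3 * n - 2 \<Longrightarrow> param_col j < n"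
  unfolding param_row_def param_col_def by (cases "j mod 3 = 1"; cases "j mod 3 = 2"; simp; presburger)+

text \<open>Outside the band the radii vanish together with the centres. All matrices of the
  interval are therefore tridiagonal, and the recurrence applies to each of them.\<close>

lemma tri_zero:
  assumes "i < n" "j < n" "\<bar>int i - int j\<bar> > 1"
  shows "A $$ (i, j) = 0" "\<Delta> $$ (i, j) = 0"
  using assms tri A zero[of i j] by (auto simp: tridiagonal_def)

text \<open>\<open>run\<close> computes the determinant up to the product of all denominators, which
  is nonzero.\<close>

lemma run_params_det:
  assumes F: "\<And>i j. i < n \<Longrightarrow> j < n \<Longrightarrow> \<bar>int i - int j\<bar> > 1 \<Longrightarrow> F i j = 0"
    and rs: "\<And>j. j < 3 * n - 2 \<Longrightarrow> F (param_row j) (param_col j) =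
      real_of_rat (A $$ (param_row j, param_col j)) + s j * real_of_rat (\<Delta> $$ (param_row j, param_col j))"
  shows "fst (run (map real_param params) (map s [0..<3 * n - 2]) (1, 0)) = 0 \<longleftrightarrow> leading_minor F n = 0"
proof -
  obtain k where k: "n = Suc k"
    using n by (cases n) auto
  then have m: "3 * n - 2 = 3 * k + 1" by simp
  let ?p = "\<lambda>j. A $$ (param_row j, param_col j)" and ?q = "\<lambda>j. \<Delta> $$ (param_row j, param_col j)"
  let ?d = "\<lambda>j. real_of_int (den (?p j) * den (?q j))"
  have R: "run (map (\<lambda>j. real_param (param A \<Delta> j)) [0..<3 * k + 1]) (map s [0..<3 * k + 1]) (1, 0) =
      ((\<Prod>j<3 * k + 1. ?d j) * leading_minor F (k + 1), (\<Prod>j<3 * k + 1. ?d j) * leading_minor F k)"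
  proof (rule run_leading_minors)
    fix j
    assume "j < 3 * k + 1"
    then show "real_of_int (num (?p j) * den (?q j)) + s j * of_int (num (?q j) * den (?p j)) =
        ?d j * F (param_row j) (param_col j)"
      using rs[of j] m unfolding param_entry by simp
  qed (use F k in \<open>auto simp: param_def real_param_def Let_def\<close>)
  have "?d j \<noteq> 0" for j
    using den_pos[of "?p j"] den_pos[of "?q j"] by simp
  then have P: "(\<Prod>j<3 * k + 1. ?d j) \<noteq> 0"
    by (simp add: prod_zero_iff del: of_int_mult)
  show ?thesis
    unfolding params_def m map_map comp_def R fst_conv mult_eq_0_iff using P by (simp add: k)
qed

text \<open>An entry on the band is \<open>A + r * \<Delta>\<close> with a parameter
  \<open>r\<close> of its own between \<open>- \<delta>\<close> and \<open>\<delta>\<close>, so that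
  matrices of the interval correspond to parameter lists.\<close>

lemma singular_at_iff:
  "singular_at \<delta> \<longleftrightarrow> (\<exists>rs. length rs = length params \<and> (\<forall>r\<in>set rs. \<bar>r\<bar> \<le> \<delta>) \<and>
     fst (run (map real_param params) rs (1, 0)) = 0)" if "0 \<le> \<delta>"
proof -
  have RA: "real_mat A \<in> carrier_mat n n" "real_mat \<Delta> \<in> carrier_mat n n"
    using A \<Delta> by auto
  have ent: "i < n \<Longrightarrow> j < n \<Longrightarrow> real_mat A $$ (i, j) = real_of_rat (A $$ (i, j))"
    "i < n \<Longrightarrow> j < n \<Longrightarrow> real_mat \<Delta> $$ (i, j) = real_of_rat (\<Delta> $$ (i, j))" for i j
    using A \<Delta> by auto
  have sing: "singular_at \<delta> \<longleftrightarrow> (\<exists>A'. A' \<in> carrier_mat n n \<and> det A' = 0 \<and>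
      (\<forall>i<n. \<forall>j<n. \<bar>A' $$ (i, j) - real_of_rat (A $$ (i, j))\<bar> \<le> \<delta> * real_of_rat (\<Delta> $$ (i, j))))"
    unfolding singular_at_def regular_interval_def Ball_def interval_matrix_iff[OF RA]
    using invertible_mat_iff_det[where ?'a = real and n = n] by (auto simp: ent)
  show ?thesis
  proof
    assume "singular_at \<delta>"
    then obtain A' where A': "A' \<in> carrier_mat n n" "det A' = 0"
      "\<And>i j. i < n \<Longrightarrow> j < n \<Longrightarrow>
        \<bar>A' $$ (i, j) - real_of_rat (A $$ (i, j))\<bar> \<le> \<delta> * real_of_rat (\<Delta> $$ (i, j))"
      unfolding sing by blast
    define F where "F i j = A' $$ (i, j)" for i j
    \<comment> \<open>Where \<open>\<Delta>\<close> is zero, division by zero makes the parameter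
      \<open>0\<close>, and the entry has to agree with that of \<open>A\<close>.\<close>
    define s where "s l = (F (param_row l) (param_col l) - real_of_rat (A $$ (param_row l, param_col l))) /
      real_of_rat (\<Delta> $$ (param_row l, param_col l))" for l
    have "mat n n (\<lambda>(i, j). F i j) = A'"
      using A'(1) by (intro eq_matI) (auto simp: F_def)
    then have "leading_minor F n = 0"
      using A'(2) by (simp add: leading_minor_def)
    moreover have "F (param_row l) (param_col l) =
        real_of_rat (A $$ (param_row l, param_col l)) + s l * real_of_rat (\<Delta> $$ (param_row l, param_col l))"
      if "l < 3 * n - 2" for l
      using A'(3)[of "param_row l" "param_col l"] param_row_col_less[OF that]
      by (cases "\<Delta> $$ (param_row l, param_col l) = 0") (auto simp: s_def F_def)
    moreover have "F i j = 0" if "i < n" "j < n" "\<bar>int i - int j\<bar> > 1" for i j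
      using A'(3)[of i j] tri_zero[OF that] that by (simp add: F_def)
    ultimately have "fst (run (map real_param params) (map s [0..<3 * n - 2]) (1, 0)) = 0"
      by (subst run_params_det[where F = F]) auto
    moreover have "\<bar>s l\<bar> \<le> \<delta>" if "l < 3 * n - 2" for l
    proof (cases "\<Delta> $$ (param_row l, param_col l) = 0")
      case True
      then show ?thesis using \<open>0 \<le> \<delta>\<close> by (simp add: s_def)
    next
      case False
      then have "0 < real_of_rat (\<Delta> $$ (param_row l, param_col l))"
        using nonneg[OF param_row_col_less[OF that]] by simp
      then show ?thesis
        using A'(3)[OF param_row_col_less[OF that]] by (simp add: s_def F_def abs_divide divide_le_eq)
    qed
    ultimately show "\<exists>rs. length rs = length params \<and> (\<forall>r\<in>set rs. \<bar>r\<bar> \<le> \<delta>) \<and>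
        fst (run (map real_param params) rs (1, 0)) = 0"
      by (intro exI[of _ "map s [0..<3 * n - 2]"]) (auto simp: length_params)
  next
    assume "\<exists>rs. length rs = length params \<and> (\<forall>r\<in>set rs. \<bar>r\<bar> \<le> \<delta>) \<and>
        fst (run (map real_param params) rs (1, 0)) = 0"
    then obtain rs where rs: "length rs = 3 * n - 2" "\<And>r. r \<in> set rs \<Longrightarrow> \<bar>r\<bar> \<le> \<delta>"
      "fst (run (map real_param params) rs (1, 0)) = 0"
      by (auto simp: length_params)
    \<comment> \<open>The inverse of the enumeration of the band by \<open>param_row\<close> and
      \<open>param_col\<close>.\<close>
    define pos where "pos i j = (if i = j then 3 * i else if i = j + 1 then 3 * j + 1 else 3 * i + 2)"
      for i j :: nat
    define F where "F i j = (if \<bar>int i - int j\<bar> > 1 then 0 else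
      real_of_rat (A $$ (i, j)) + rs ! pos i j * real_of_rat (\<Delta> $$ (i, j)))" for i j
    have row_col: "\<bar>int (param_row l) - int (param_col l)\<bar> \<le> 1" "pos (param_row l) (param_col l) = l" for l
      unfolding pos_def param_row_def param_col_def by (auto split: if_splits; presburger)+
    have "map ((!) rs) [0..<3 * n - 2] = rs"
      using rs(1) by (metis map_nth)
    then have "leading_minor F n = 0"
      using rs(3) by (subst run_params_det[of F "(!) rs", symmetric]) (simp_all add: F_def row_col(2) iffD2[OF not_less row_col(1)])
    moreover have "\<bar>F i j - real_of_rat (A $$ (i, j))\<bar> \<le> \<delta> * real_of_rat (\<Delta> $$ (i, j))"
      if "i < n" "j < n" for i j
    proof (cases "\<bar>int i - int j\<bar> > 1")
      case True
      then show ?thesis using tri_zero[OF that] by (simp add: F_def)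
    next
      case False
      then have "pos i j < 3 * n - 2"
        using that unfolding pos_def by auto
      then have "\<bar>rs ! pos i j\<bar> \<le> \<delta>"
        using rs(1,2) by (metis nth_mem)
      then show ?thesis
        using False nonneg[OF that] by (simp add: F_def abs_mult mult_right_mono)
    qed
    ultimately show "singular_at \<delta>"
      unfolding sing by (intro exI[of _ "mat n n (\<lambda>(i, j). F i j)"]) (auto simp: leading_minor_def)
  qed
qed

lemma singular_at_mono: "singular_at \<delta> \<Longrightarrow> 0 \<le> \<delta> \<Longrightarrow> \<delta> \<le> \<delta>' \<Longrightarrow> singular_at \<delta>'"
  by (subst (asm) singular_at_iff, assumption, subst singular_at_iff) force+

lemma regular_at_iff:
  "\<not> singular_at \<delta> \<longleftrightarrow>
     (\<forall>ss. length ss = length params \<longrightarrow> set ss \<subseteq> {\<delta>, - \<delta>} \<longrightarrow> 0 < fst (run (map real_param params) ss (1, 0))) \<or>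
     (\<forall>ss. length ss = length params \<longrightarrow> set ss \<subseteq> {\<delta>, - \<delta>} \<longrightarrow> fst (run (map real_param params) ss (1, 0)) < 0)"
  if "0 \<le> \<delta>"
  using run_no_zero_iff[OF that, of "map real_param params" "(1, 0)"] singular_at_iff[OF that]
  unfolding length_map by blast

end

text \<open>For a fixed sign pattern the vertex moves linearly with \<open>\<delta>\<close>, and
  only sums and products are formed from it. The start vector depends on \<open>\<delta>\<close> as
  well, because the induction absorbs the first factor into it.\<close>

lemma continuous_run_map:
  fixes w :: "real \<Rightarrow> real \<times> real"
  assumes "continuous_on S (\<lambda>\<delta>. fst (w \<delta>))" "continuous_on S (\<lambda>\<delta>. snd (w \<delta>))"
  shows "continuous_on S (\<lambda>\<delta>. fst (run xs (map (\<lambda>\<sigma>. \<delta> * \<sigma>) ss) (w \<delta>)))"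
  using assms
proof (induction xs arbitrary: ss w)
  case (Cons x xs)
  obtain k a e d where x: "x = (k, a, e, d)"
    by (cases x) auto
  have act: "act x r (w \<delta>) = (if k
      then ((a + r * e) * fst (w \<delta>) - d * snd (w \<delta>), d * fst (w \<delta>))
      else (d * fst (w \<delta>), (a + r * e) * snd (w \<delta>)))" for r \<delta>
    unfolding x by (cases "w \<delta>") simp
  show ?case
  proof (cases ss)
    case (Cons s ss')
    have "continuous_on S (\<lambda>\<delta>. fst (act x (\<delta> * s) (w \<delta>)))"
      "continuous_on S (\<lambda>\<delta>. snd (act x (\<delta> * s) (w \<delta>)))"
      unfolding act by (cases k; simp; intro continuous_intros Cons.prems)+
    from Cons.IH[OF this, of ss'] show ?thesis
      by (simp add: Cons)
  qed (simp add: Cons.prems)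
qed simp

context tridiagonal_input begin

text \<open>
  Regularity is an open condition on the radius, because it is a sign condition on the finitely
  many vertices of a box; hence the least singular radius exists.
\<close>

lemma singular_at_minimum:
  assumes "\<exists>\<delta>\<ge>0. singular_at \<delta>"
  obtains x where "0 \<le> x" "\<And>\<delta>. 0 \<le> \<delta> \<Longrightarrow> singular_at \<delta> \<longleftrightarrow> x \<le> \<delta>"
proof -
  define V where "V = {\<sigma>. set \<sigma> \<subseteq> {1, - 1 :: real} \<and> length \<sigma> = length params}"
  define g where "g \<sigma> \<delta> = fst (run (map real_param params) (map (\<lambda>s. \<delta> * s) \<sigma>) (1, 0))" for \<sigma> \<delta>
  have fin: "finite V"
    unfolding V_def by (rule finite_lists_length_eq) simp
  have vert: "{ss. length ss = length params \<and> set ss \<subseteq> {\<delta>, - \<delta>}} = (map (\<lambda>s. \<delta> * s)) ` V" for \<delta>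
  proof (intro equalityI subsetI)
    fix ss
    assume "ss \<in> {ss. length ss = length params \<and> set ss \<subseteq> {\<delta>, - \<delta>}}"
    moreover from this have "map (\<lambda>s. \<delta> * s) (map (\<lambda>s. if s = \<delta> then 1 else - 1) ss) = ss"
      unfolding map_map by (intro map_idI) auto
    ultimately show "ss \<in> (map (\<lambda>s. \<delta> * s)) ` V"
      by (intro image_eqI[of _ _ "map (\<lambda>s. if s = \<delta> then 1 else - 1) ss"]) (auto simp: V_def)
  next
    fix ss
    assume "ss \<in> (map (\<lambda>s. \<delta> * s)) ` V"
    then obtain \<sigma> where \<sigma>: "ss = map (\<lambda>s. \<delta> * s) \<sigma>" "set \<sigma> \<subseteq> {1, - 1}" "length \<sigma> = length params"
      unfolding V_def by blast
    have "\<delta> * s \<in> {\<delta>, - \<delta>}" if "s \<in> set \<sigma>" for s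
      using subsetD[OF \<sigma>(2) that] by auto
    then show "ss \<in> {ss. length ss = length params \<and> set ss \<subseteq> {\<delta>, - \<delta>}}"
      unfolding \<sigma>(1) mem_Collect_eq set_map length_map using \<sigma>(3) by (intro conjI image_subsetI)
  qed
  have reg: "\<not> singular_at \<delta> \<longleftrightarrow> (\<forall>\<sigma>\<in>V. 0 < g \<sigma> \<delta>) \<or> (\<forall>\<sigma>\<in>V. g \<sigma> \<delta> < 0)" if "0 \<le> \<delta>" for \<delta>
  proof -
    have "(\<forall>ss. length ss = length params \<longrightarrow> set ss \<subseteq> {\<delta>, - \<delta>} \<longrightarrow> P ss) \<longleftrightarrow>
        (\<forall>\<sigma>\<in>V. P (map (\<lambda>s. \<delta> * s) \<sigma>))" for P
      using ball_simps(9)[of "map (\<lambda>s. \<delta> * s)" V P] unfolding vert[symmetric] by blast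
    then show ?thesis
      unfolding regular_at_iff[OF that] g_def by simp
  qed
  have cont: "continuous_on UNIV (g \<sigma>)" for \<sigma>
    unfolding g_def by (rule continuous_run_map) auto
  \<comment> \<open>Defined on the whole line, where openness is immediate; it describes regularity
    for nonnegative \<open>\<delta>\<close> only.\<close>
  define R where "R = (\<Inter>\<sigma>\<in>V. {\<delta>. 0 < g \<sigma> \<delta>}) \<union> (\<Inter>\<sigma>\<in>V. {\<delta>. g \<sigma> \<delta> < 0})"
  have "open R"
    unfolding R_def using fin cont
    by (intro open_Un open_INT ballI open_Collect_less) (auto intro: continuous_intros)
  have R: "singular_at \<delta> \<longleftrightarrow> \<delta> \<notin> R" if "0 \<le> \<delta>" for \<delta>
    using reg[OF that] unfolding R_def by auto
  let ?S = "{\<delta>. 0 \<le> \<delta> \<and> singular_at \<delta>}"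
  define x where "x = Inf ?S"
  have ne: "?S \<noteq> {}" and bdd: "bdd_below ?S"
    using assms by (auto intro: bdd_belowI[of _ 0])
  have x0: "0 \<le> x"
    unfolding x_def using ne by (intro cInf_greatest) auto
  have "singular_at x"
  proof (rule ccontr)
    assume "\<not> singular_at x"
    then have "x \<in> R"
      using R[OF x0] by simp
    with \<open>open R\<close> obtain e where e: "0 < e" "\<And>y. \<bar>y - x\<bar> < e \<Longrightarrow> y \<in> R"
      unfolding open_dist dist_real_def by blast
    have "Inf ?S < x + e"
      using e(1) by (simp add: x_def)
    then obtain y where y: "y \<in> ?S" "y < x + e"
      using cInf_lessD[OF ne] by blast
    moreover have "x \<le> y"
      unfolding x_def using y(1) bdd by (rule cInf_lower)
    ultimately show False
      using R[of y] e(2)[of y] by auto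
  qed
  show thesis
  proof (rule that[OF x0])
    show "singular_at \<delta> \<longleftrightarrow> x \<le> \<delta>" if "0 \<le> \<delta>" for \<delta>
    proof
      assume "singular_at \<delta>"
      then show "x \<le> \<delta>"
        unfolding x_def using that bdd by (intro cInf_lower) auto
    qed (use singular_at_mono \<open>singular_at x\<close> x0 in blast)
  qed
qed

lemma regularity_radius_infinite:
  "\<not> (\<exists>\<delta>\<ge>0. singular_at \<delta>) \<Longrightarrow> regularity_radius (real_mat A) (real_mat \<Delta>) = \<infinity>"
  unfolding regularity_radius_def singular_at_def by (simp only: if_False)

lemma regularity_radius_finite:
  assumes "\<exists>\<delta>\<ge>0. singular_at \<delta>"
  obtains x where "regularity_radius (real_mat A) (real_mat \<Delta>) = ereal x"
    "0 \<le> x" "\<And>\<delta>. 0 \<le> \<delta> \<Longrightarrow> singular_at \<delta> \<longleftrightarrow> x \<le> \<delta>"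
proof -
  obtain x where x: "0 \<le> x" "\<And>\<delta>. 0 \<le> \<delta> \<Longrightarrow> singular_at \<delta> \<longleftrightarrow> x \<le> \<delta>"
    using singular_at_minimum[OF assms] by blast
  have "(LEAST \<delta>. 0 \<le> \<delta> \<and> singular_at \<delta>) = x"
    using x by (intro Least_equality) auto
  then have "regularity_radius (real_mat A) (real_mat \<Delta>) = ereal x"
    using assms unfolding regularity_radius_def singular_at_def by (simp only: if_True)
  with x that show thesis by blast
qed

text \<open>\<open>a * a\<close> bounds the absolute value of an integer \<open>a\<close>, while
  \<open>e\<close> and \<open>d\<close> are nonnegative already, so each factor dominates
  \<open>weight\<close>. This form spares the program absolute values. As each factor is at least
  \<open>1\<close>, partial products never exceed the whole.\<close>

definition radius_bound :: int where
  "radius_bound = (\<Prod>j<3 * n - 2. case param A \<Delta> j of (k, a, e, d) \<Rightarrow> a * a + e + d)"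

lemma param_nonneg:
  assumes "j < 3 * n - 2" "param A \<Delta> j = (k, a, e, d)"
  shows "0 \<le> e" "0 < d"
proof -
  let ?p = "A $$ (param_row j, param_col j)" and ?q = "\<Delta> $$ (param_row j, param_col j)"
  have ed: "e = num ?q * den ?p" "d = den ?p * den ?q"
    using assms(2) by (simp_all add: param_def Let_def)
  have "0 \<le> real_of_rat ?q"
    using nonneg[OF param_row_col_less[OF assms(1)]] by simp
  then have "0 \<le> num ?q"
    using den_pos[of ?q] unfolding of_rat_num_den by (simp add: zero_le_divide_iff)
  then show "0 \<le> e" "0 < d"
    using den_pos[of ?p] den_pos[of ?q] by (simp_all add: ed)
qed

lemma weight_param_le:
  assumes "j < 3 * n - 2" "param A \<Delta> j = (k, a, e, d)"
  shows "weight (param A \<Delta> j) \<le> a * a + e + d" "1 \<le> a * a + e + d"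
proof -
  have "\<bar>a\<bar> \<le> \<bar>a\<bar> * \<bar>a\<bar>"
    using mult_left_mono[of 1 "\<bar>a\<bar>" "\<bar>a\<bar>"] by (cases "a = 0") auto
  then show "weight (param A \<Delta> j) \<le> a * a + e + d"
    using param_nonneg[OF assms] assms(2) by (simp add: weight_def)
  have "0 \<le> a * a" by simp
  then show "1 \<le> a * a + e + d"
    using param_nonneg[OF assms] by linarith
qed

lemma radius_bound_ge_1: "1 \<le> radius_bound"
  unfolding radius_bound_def
  by (intro prod_ge_1) (use weight_param_le(2) in \<open>auto split: prod.split\<close>)

text \<open>\<open>run_bounded_zero\<close> replaces an arbitrary zero of the determinant by one
  whose parameters are at most the product of the weights, as \<open>(1, 0)\<close> has norm
  \<open>1\<close>. Hence a single test at \<open>radius_bound\<close> decides whether the radius is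
  finite.\<close>

lemma singular_at_radius_bound:
  assumes "\<exists>\<delta>\<ge>0. singular_at \<delta>"
  shows "singular_at (of_int radius_bound)"
proof -
  obtain rs where rs: "length rs = length params" "fst (run (map real_param params) rs (1, 0)) = 0"
    using assms singular_at_iff by auto
  have "prod_list (map weight params) = (\<Prod>j<3 * n - 2. weight (param A \<Delta> j))"
    unfolding params_def map_map comp_def
    by (simp flip: prod.distinct_set_conv_list add: atLeast0LessThan)
  also have "\<dots> \<le> radius_bound"
    unfolding radius_bound_def
    by (intro prod_mono) (use weight_param_le(1) weight_nonneg in \<open>auto split: prod.split\<close>)
  finally have "prod_list (map weight params) * sup_norm (1, 0) \<le> radius_bound"
    by (simp add: sup_norm_def)
  from run_bounded_zero[OF rs(1) _ this radius_bound_ge_1] rs(2) radius_bound_ge_1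
  show ?thesis
    by (subst singular_at_iff) (auto simp: real_pair_def)
qed

end

section \<open>The test for regularity in integer arithmetic\<close>

text \<open>At the radius \<open>s / N\<close> the fraction \<open>(a + s / N * e) / d\<close> is
  \<open>(a * N + s * e) / (d * N)\<close>, so that the integer \<open>s\<close> can take the place
  of the radius.\<close>

definition scale_param :: "'a \<Rightarrow> bool \<times> 'a \<times> 'a \<times> 'a \<Rightarrow> bool \<times> 'a \<times> 'a \<times> 'a::comm_ring_1" where
  "scale_param N x = (case x of (k, a, e, d) \<Rightarrow> (k, a * N, e, d * N))"

lemma act_scale_param:
  fixes N :: real
  assumes "N \<noteq> 0"
  shows "act (scale_param N x) s w = comb N (act x (s / N) w) 0 w"
  using assms by (cases x; cases w) (auto simp: scale_param_def comb_def field_simps)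

lemma run_scale_param:
  fixes N :: real
  assumes "N \<noteq> 0"
  shows "length ss = length xs \<Longrightarrow> fst (run (map (scale_param N) xs) ss w) =
    N ^ length xs * fst (run xs (map (\<lambda>s. s / N) ss) w)"
proof (induction xs arbitrary: ss w)
  case (Cons x xs)
  then obtain s ss' where "ss = s # ss'"
    by (cases ss) auto
  with Cons show ?case
    by (simp add: act_scale_param[OF assms] run_comb) (simp add: comb_def)
qed simp

context tridiagonal_input begin

definition regular_test :: "int \<Rightarrow> int \<Rightarrow> bool" where
  "regular_test N s = (case fold (cone_step s) (map (scale_param N) params) ((1, 0), (1, 0), True) of
     (u, v, ok) \<Rightarrow> ok \<and> 0 < fst u * fst v)"

lemma regular_test_iff:
  assumes "0 < N" "0 \<le> s"
  shows "regular_test N s \<longleftrightarrow> \<not> singular_at (of_int s / of_int N)"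
proof -
  let ?N = "real_of_int N" and ?\<delta> = "real_of_int s / of_int N"
  have N: "?N \<noteq> 0" "0 < ?N"
    using assms by auto
  \<comment> \<open>\<open>P\<close> and \<open>Q\<close> stand for one sign condition over the
    reals and over the integers; a single transfer then serves both signs. Integer and real vertex
    values differ by the factor \<open>?N ^ length params\<close>.\<close>
  have vert: "(\<forall>ss. length ss = length params \<longrightarrow> set ss \<subseteq> {?\<delta>, - ?\<delta>} \<longrightarrow> P (fst (run (map real_param params) ss (1, 0)))) \<longleftrightarrow>
      (\<forall>w\<in>{(1, 0)}. \<forall>ss. length ss = length (map (scale_param N) params) \<longrightarrow> set ss \<subseteq> {s, - s} \<longrightarrow>
         Q (fst (run (map (scale_param N) params) ss w)))"
    if PQ: "\<And>x y :: real. \<And>z. of_int z = ?N ^ length params * x \<Longrightarrow> P x \<longleftrightarrow> Q z" for P Q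
  proof -
    have eq: "P (fst (run (map real_param params) (map (\<lambda>r. of_int r / ?N) ss) (1, 0))) \<longleftrightarrow>
        Q (fst (run (map (scale_param N) params) ss (1, 0)))" if "length ss = length params" for ss
    proof (rule PQ)
      have "map (scale_param ?N) (map real_param params) = map real_param (map (scale_param N) params)"
        by (simp add: scale_param_def real_param_def split: prod.split)
      then show "real_of_int (fst (run (map (scale_param N) params) ss (1, 0))) =
          ?N ^ length params * fst (run (map real_param params) (map (\<lambda>r. of_int r / ?N) ss) (1, 0))"
        using run_scale_param[OF N(1), of "map of_int ss" "map real_param params" "real_pair (1, 0)"]
          run_of_int[of "map (scale_param N) params" ss "(1, 0)"] that
        by (simp only: length_map map_map comp_def fst_real_pair) (simp add: real_pair_def)
    qed
    show ?thesis
    proof (intro iffI ballI allI impI)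
      fix w :: "int \<times> int" and ss
      assume L: "\<forall>ss. length ss = length params \<longrightarrow> set ss \<subseteq> {?\<delta>, - ?\<delta>} \<longrightarrow>
          P (fst (run (map real_param params) ss (1, 0)))"
        and w: "w \<in> {(1, 0)}" "length ss = length (map (scale_param N) params)" "set ss \<subseteq> {s, - s}"
      have "set (map (\<lambda>r. real_of_int r / ?N) ss) \<subseteq> {?\<delta>, - ?\<delta>}"
        using w(3) by (auto dest!: subsetD)
      then show "Q (fst (run (map (scale_param N) params) ss w))"
        using L eq[of ss] w(1,2) by simp
    next
      fix rs
      assume R: "\<forall>w\<in>{(1, 0)}. \<forall>ss. length ss = length (map (scale_param N) params) \<longrightarrow> set ss \<subseteq> {s, - s} \<longrightarrow>
         Q (fst (run (map (scale_param N) params) ss w))"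
        and rs: "length rs = length params" "set rs \<subseteq> {?\<delta>, - ?\<delta>}"
      define ss where "ss = map (\<lambda>r. if r = ?\<delta> then s else - s) rs"
      have "map (\<lambda>r. of_int r / ?N) ss = rs"
        unfolding ss_def map_map using rs(2) by (intro map_idI) auto
      moreover have "set ss \<subseteq> {s, - s}" "length ss = length params"
        using rs(1) by (auto simp: ss_def)
      ultimately show "P (fst (run (map real_param params) rs (1, 0)))"
        using R eq[of ss] by simp
    qed
  qed
  have "regular_test N s \<longleftrightarrow> same_sign s (map (scale_param N) params) {(1, 0)}"
    unfolding regular_test_def
    by (rule cone_test) (simp_all add: pointed_def cross_def dot_def in_cone_left)
  also have "\<dots> \<longleftrightarrow> \<not> singular_at ?\<delta>"
  proof -
    have pos: "0 < ?N ^ length params"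
      using N by simp
    have 1: "0 < x \<longleftrightarrow> 0 < z" and 2: "x < 0 \<longleftrightarrow> z < 0" if "of_int z = ?N ^ length params * x" for x z
      using that pos by (metis of_int_0_less_iff zero_less_mult_pos mult_pos_pos)
        (metis that pos of_int_less_0_iff mult_less_0_iff not_less_iff_gr_or_eq)
    have "0 \<le> ?\<delta>"
      using assms by simp
    show ?thesis
      unfolding regular_at_iff[OF \<open>0 \<le> ?\<delta>\<close>] same_sign_def
      using vert[of "\<lambda>x. 0 < x" "\<lambda>x. 0 < x", OF 1] vert[of "\<lambda>x. x < 0" "\<lambda>x. x < 0", OF 2] by blast
  qed
  finally show ?thesis .
qed

end

section \<open>Cost bounds for random access machines\<close>

text \<open>Only contents are bounded; addresses are values of expressions, and
  \<open>expr_val_bounded\<close> controls these in terms of the contents.\<close>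

definition mem_bounded :: "memory \<Rightarrow> nat \<Rightarrow> bool" where
  "mem_bounded m k \<longleftrightarrow> (\<forall>a. \<bar>m a\<bar> \<le> 2 ^ k)"

lemma int_size_le: "\<bar>x\<bar> \<le> 2 ^ b \<Longrightarrow> int_size x \<le> b + 2"
proof -
  assume x: "\<bar>x\<bar> \<le> 2 ^ b"
  have "nat \<bar>x\<bar> < 2 ^ (b + 1)"
  proof -
    have "\<bar>x\<bar> < 2 ^ (b + 1)"
      using x by (simp add: order.strict_trans1)
    then show ?thesis by (simp add: nat_less_iff)
  qed
  then show ?thesis
    unfolding int_size_def using floorlog_leI[of "nat \<bar>x\<bar>" 2 "b + 1"] by simp
qed

lemma abs_less_power_int_size: "\<bar>x\<bar> < 2 ^ int_size x"
proof -
  have "nat \<bar>x\<bar> < 2 ^ int_size x"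
    unfolding int_size_def using floorlog_leD[of 2 "nat \<bar>x\<bar>" "floorlog 2 (nat \<bar>x\<bar>) + 1"] by simp
  then show ?thesis by (simp add: nat_less_iff)
qed

lemma abs_div_le: "\<bar>x div y\<bar> \<le> \<bar>x\<bar>" for x y :: int
proof -
  have pos: "\<bar>x div y\<bar> \<le> \<bar>x\<bar>" if "0 < y" for x y :: int
  proof (cases "0 \<le> x")
    case True
    then show ?thesis
      using that zdiv_mono2[of x 1 y] by (simp add: pos_imp_zdiv_nonneg_iff)
  next
    case False
    then show ?thesis
      using that zdiv_mono2_neg[of x 1 y] div_neg_pos_less0[of x y] by simp
  qed
  consider "0 < y" | "y = 0" | "0 < - y"
    by linarith
  then show ?thesis
  proof cases
    case 3
    then show ?thesis
      using pos[of "- y" "- x"] by simp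
  qed (use pos in auto)
qed

text \<open>Rests on \<open>(2 ^ a - 2) * (2 ^ b - 2) \<ge> 0\<close>. It lets exponents add under
  sums just as under products, at the price of positive exponents.\<close>

lemma add_le_power2:
  assumes "\<bar>x\<bar> \<le> 2 ^ a" "\<bar>y\<bar> \<le> 2 ^ b" "1 \<le> a" "1 \<le> b"
  shows "\<bar>x\<bar> + \<bar>y\<bar> \<le> (2::int) ^ (a + b)"
proof -
  have "(2::int) ^ 1 \<le> 2 ^ a" "(2::int) ^ 1 \<le> 2 ^ b"
    by (rule power_increasing[OF assms(3)], simp, rule power_increasing[OF assms(4)], simp)
  then have "0 \<le> ((2::int) ^ a - 2) * (2 ^ b - 2)"
    by (intro mult_nonneg_nonneg) auto
  then have "(2::int) ^ a + 2 ^ b \<le> 2 ^ a * 2 ^ b"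
    using \<open>(2::int) ^ 1 \<le> 2 ^ a\<close> \<open>(2::int) ^ 1 \<le> 2 ^ b\<close> by (simp add: algebra_simps)
  then show ?thesis
    using assms(1,2) by (simp add: power_add)
qed

lemma abs_add_le_power2:
  assumes "\<bar>x\<bar> \<le> 2 ^ a" "\<bar>y\<bar> \<le> 2 ^ b" "1 \<le> a" "1 \<le> b"
  shows "\<bar>x + y\<bar> \<le> (2::int) ^ (a + b)" "\<bar>x - y\<bar> \<le> (2::int) ^ (a + b)"
  using add_le_power2[OF assms] by linarith+

text \<open>A binary operation at most adds the exponents of its operands, and a load brings the
  exponent back to \<open>k\<close>; so \<open>C\<close> depends on the expression alone.
  \<open>1 \<le> C\<close> and \<open>1 \<le> k\<close> keep the exponents positive, as
  \<open>abs_add_le_power2\<close> demands.\<close>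

lemma expr_val_bounded:
  "\<exists>C\<ge>1. \<forall>m k. 1 \<le> k \<longrightarrow> mem_bounded m k \<longrightarrow> \<bar>expr_val e m\<bar> \<le> 2 ^ (C * k)"
proof (induction e)
  case (Const c)
  have "\<bar>expr_val (Const c) m\<bar> \<le> 2 ^ (Suc (int_size c) * k)" if "1 \<le> k" for m k
  proof -
    have "\<bar>c\<bar> \<le> 2 ^ int_size c"
      using abs_less_power_int_size[of c] by simp
    also have "(2::int) ^ int_size c \<le> 2 ^ (Suc (int_size c) * k)"
      using that by (intro power_increasing) (auto simp: trans_le_add2)
    finally show ?thesis by simp
  qed
  then show ?case
    by (intro exI[of _ "Suc (int_size c)"]) simp
next
  case (Load e)
  show ?case
    by (intro exI[of _ 1]) (simp add: mem_bounded_def)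
next
  case (Div e f)
  then obtain C where C: "1 \<le> C"
    "\<And>m k. 1 \<le> k \<Longrightarrow> mem_bounded m k \<Longrightarrow> \<bar>expr_val e m\<bar> \<le> 2 ^ (C * k)"
    by blast
  have "\<bar>expr_val (Div e f) m\<bar> \<le> 2 ^ (C * k)" if "1 \<le> k" "mem_bounded m k" for m k
    unfolding expr_val.simps by (rule order_trans[OF abs_div_le C(2)[OF that]])
  then show ?case
    using C(1) by blast
next
  case (Add e f)
  then obtain C D where CD: "1 \<le> C" "1 \<le> D"
    "\<And>m k. 1 \<le> k \<Longrightarrow> mem_bounded m k \<Longrightarrow> \<bar>expr_val e m\<bar> \<le> 2 ^ (C * k)"
    "\<And>m k. 1 \<le> k \<Longrightarrow> mem_bounded m k \<Longrightarrow> \<bar>expr_val f m\<bar> \<le> 2 ^ (D * k)"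
    by blast
  have "\<bar>expr_val (Add e f) m\<bar> \<le> 2 ^ ((C + D) * k)" if "1 \<le> k" "mem_bounded m k" for m k
    using abs_add_le_power2(1)[OF CD(3,4)[OF that]] CD(1,2) that by (simp add: add_mult_distrib)
  then show ?case
    using CD(1) by (intro exI[of _ "C + D"]) simp
next
  case (Sub e f)
  then obtain C D where CD: "1 \<le> C" "1 \<le> D"
    "\<And>m k. 1 \<le> k \<Longrightarrow> mem_bounded m k \<Longrightarrow> \<bar>expr_val e m\<bar> \<le> 2 ^ (C * k)"
    "\<And>m k. 1 \<le> k \<Longrightarrow> mem_bounded m k \<Longrightarrow> \<bar>expr_val f m\<bar> \<le> 2 ^ (D * k)"
    by blast
  have "\<bar>expr_val (Sub e f) m\<bar> \<le> 2 ^ ((C + D) * k)" if "1 \<le> k" "mem_bounded m k" for m k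
    using abs_add_le_power2(2)[OF CD(3,4)[OF that]] CD(1,2) that by (simp add: add_mult_distrib)
  then show ?case
    using CD(1) by (intro exI[of _ "C + D"]) simp
next
  case (Mult e f)
  then obtain C D where CD: "1 \<le> C" "1 \<le> D"
    "\<And>m k. 1 \<le> k \<Longrightarrow> mem_bounded m k \<Longrightarrow> \<bar>expr_val e m\<bar> \<le> 2 ^ (C * k)"
    "\<And>m k. 1 \<le> k \<Longrightarrow> mem_bounded m k \<Longrightarrow> \<bar>expr_val f m\<bar> \<le> 2 ^ (D * k)"
    by blast
  have "\<bar>expr_val (Mult e f) m\<bar> \<le> 2 ^ ((C + D) * k)" if "1 \<le> k" "mem_bounded m k" for m k
    using CD(3,4)[OF that] by (simp add: abs_mult add_mult_distrib power_add mult_mono)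
  then show ?case
    using CD(1) by (intro exI[of _ "C + D"]) simp
qed

lemma expr_val_size:
  "\<exists>C. \<forall>m k. 1 \<le> k \<longrightarrow> mem_bounded m k \<longrightarrow> int_size (expr_val e m) \<le> C * k"
proof -
  obtain C where C: "\<And>m k. 1 \<le> k \<Longrightarrow> mem_bounded m k \<Longrightarrow> \<bar>expr_val e m\<bar> \<le> 2 ^ (C * k)"
    using expr_val_bounded by blast
  have "int_size (expr_val e m) \<le> (C + 2) * k" if "1 \<le> k" "mem_bounded m k" for m k
    using int_size_le[OF C[OF that]] that(1) by (simp add: add_mult_distrib)
  then show ?thesis by blast
qed

lemma expr_cost_bounded:
  "\<exists>C. \<forall>m k. 1 \<le> k \<longrightarrow> mem_bounded m k \<longrightarrow> expr_cost e m + int_size (expr_val e m) \<le> C * k"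
proof -
  \<comment> \<open>The four binary operations share one cost rule and are settled together.\<close>
  have operands: "\<exists>C. \<forall>m k. 1 \<le> k \<longrightarrow> mem_bounded m k \<longrightarrow>
      expr_cost e m + expr_cost f m + int_size (expr_val e m) + int_size (expr_val f m) \<le> C * k"
    if "\<exists>C. \<forall>m k. 1 \<le> k \<longrightarrow> mem_bounded m k \<longrightarrow> expr_cost e m \<le> C * k"
      "\<exists>C. \<forall>m k. 1 \<le> k \<longrightarrow> mem_bounded m k \<longrightarrow> expr_cost f m \<le> C * k" for e f
  proof -
    obtain C1 C2 where C: "\<And>m k. 1 \<le> k \<Longrightarrow> mem_bounded m k \<Longrightarrow> expr_cost e m \<le> C1 * k"
      "\<And>m k. 1 \<le> k \<Longrightarrow> mem_bounded m k \<Longrightarrow> expr_cost f m \<le> C2 * k"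
      using \<open>\<exists>C. \<forall>m k. 1 \<le> k \<longrightarrow> mem_bounded m k \<longrightarrow> expr_cost e m \<le> C * k\<close>
        \<open>\<exists>C. \<forall>m k. 1 \<le> k \<longrightarrow> mem_bounded m k \<longrightarrow> expr_cost f m \<le> C * k\<close> by blast
    obtain D1 D2 where D: "\<And>m k. 1 \<le> k \<Longrightarrow> mem_bounded m k \<Longrightarrow> int_size (expr_val e m) \<le> D1 * k"
      "\<And>m k. 1 \<le> k \<Longrightarrow> mem_bounded m k \<Longrightarrow> int_size (expr_val f m) \<le> D2 * k"
      using expr_val_size by metis
    have "expr_cost e m + expr_cost f m + int_size (expr_val e m) + int_size (expr_val f m)
        \<le> (C1 + C2 + D1 + D2) * k" if k: "1 \<le> k" "mem_bounded m k" for m k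
      using C[OF k] D[OF k] by (simp add: add_mult_distrib)
    then show ?thesis by blast
  qed
  have "\<exists>C. \<forall>m k. 1 \<le> k \<longrightarrow> mem_bounded m k \<longrightarrow> expr_cost e m \<le> C * k"
  proof (induction e)
    case (Const c)
    have "expr_cost (Const c) m \<le> int_size c * k" if "1 \<le> k" for m k
      using that by simp
    then show ?case by blast
  next
    case (Load e)
    then obtain C where C: "\<And>m k. 1 \<le> k \<Longrightarrow> mem_bounded m k \<Longrightarrow> expr_cost e m \<le> C * k"
      by blast
    obtain D where D: "\<And>m k. 1 \<le> k \<Longrightarrow> mem_bounded m k \<Longrightarrow> int_size (expr_val e m) \<le> D * k"
      using expr_val_size by blast
    have "expr_cost (Load e) m \<le> (C + D + 3) * k" if k: "1 \<le> k" "mem_bounded m k" for m k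
    proof -
      have "int_size (m (expr_val e m)) \<le> k + 2"
        using k(2) by (intro int_size_le) (simp add: mem_bounded_def)
      then show ?thesis
        using C[OF k] D[OF k] k(1) by (simp add: add_mult_distrib)
    qed
    then show ?case by blast
  qed (unfold expr_cost.simps, (rule operands, assumption, assumption)+)
  then obtain C where C: "\<And>m k. 1 \<le> k \<Longrightarrow> mem_bounded m k \<Longrightarrow> expr_cost e m \<le> C * k"
    by blast
  obtain D where D: "\<And>m k. 1 \<le> k \<Longrightarrow> mem_bounded m k \<Longrightarrow> int_size (expr_val e m) \<le> D * k"
    using expr_val_size by blast
  have "expr_cost e m + int_size (expr_val e m) \<le> (C + D) * k" if k: "1 \<le> k" "mem_bounded m k" for m k
    using C[OF k] D[OF k] by (simp add: add_mult_distrib)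
  then show ?thesis by blast
qed

fun loop_free :: "program \<Rightarrow> bool" where
  "loop_free (Seq P Q) \<longleftrightarrow> loop_free P \<and> loop_free Q"
| "loop_free (Cond e P Q) \<longleftrightarrow> loop_free P \<and> loop_free Q"
| "loop_free (While e P) \<longleftrightarrow> False"
| "loop_free _ \<longleftrightarrow> True"

text \<open>The value at loops is junk.\<close>

fun result :: "program \<Rightarrow> memory \<Rightarrow> memory" where
  "result Skip m = m"
| "result (Store e f) m = m(expr_val e m := expr_val f m)"
| "result (Seq P Q) m = result Q (result P m)"
| "result (Cond e P Q) m = (if expr_val e m > 0 then result P m else result Q m)"
| "result (While e P) m = m"

lemma mem_bounded_mono: "mem_bounded m k \<Longrightarrow> k \<le> l \<Longrightarrow> mem_bounded m l"
  unfolding mem_bounded_def by (meson order_trans power_increasing one_le_numeral)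

text \<open>
  A loop-free program performs a constant number of operations, on numbers of size at most
  constant times the size of the numbers in memory.
\<close>

lemma exec_loop_free:
  "loop_free P \<Longrightarrow> \<exists>C\<ge>1. \<forall>m k. 1 \<le> k \<longrightarrow> mem_bounded m k \<longrightarrow>
     (\<exists>t \<le> C * k. exec P m t (result P m)) \<and> mem_bounded (result P m) (C * k)"
proof (induction P)
  case Skip
  show ?case
    by (rule exI[of _ 1]) (auto intro!: exI[of _ 1] exec.Skip)
next
  case (Store e f)
  obtain C where C: "\<And>m k. 1 \<le> k \<Longrightarrow> mem_bounded m k \<Longrightarrow> expr_cost e m + int_size (expr_val e m) \<le> C * k"
    using expr_cost_bounded by blast
  obtain D where D: "\<And>m k. 1 \<le> k \<Longrightarrow> mem_bounded m k \<Longrightarrow> expr_cost f m + int_size (expr_val f m) \<le> D * k"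
    using expr_cost_bounded by blast
  obtain E where E: "\<And>m k. 1 \<le> k \<Longrightarrow> mem_bounded m k \<Longrightarrow> \<bar>expr_val f m\<bar> \<le> 2 ^ (E * k)"
    using expr_val_bounded by blast
  let ?C = "C + D + E + 1"
  show ?case
  proof (rule exI[of _ ?C], intro conjI allI impI)
    fix m k
    assume k: "1 \<le> k" "mem_bounded m k"
    show "\<exists>t\<le>?C * k. exec (Store e f) m t (result (Store e f) m)"
      using exec.Store[of e f m] C[OF k] D[OF k]
      by (intro exI conjI) (auto simp: add_mult_distrib)
    have "mem_bounded m (?C * k)"
      using k by (elim mem_bounded_mono) simp
    moreover have "\<bar>expr_val f m\<bar> \<le> 2 ^ (?C * k)"
      by (rule order_trans[OF E[OF k]]) (auto intro!: power_increasing simp: add_mult_distrib)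
    ultimately show "mem_bounded (result (Store e f) m) (?C * k)"
      by (simp add: mem_bounded_def)
  qed simp
next
  case (Seq P Q)
  then obtain C D where C: "1 \<le> C" "\<And>m k. 1 \<le> k \<Longrightarrow> mem_bounded m k \<Longrightarrow>
      (\<exists>t \<le> C * k. exec P m t (result P m)) \<and> mem_bounded (result P m) (C * k)"
    and D: "1 \<le> D" "\<And>m k. 1 \<le> k \<Longrightarrow> mem_bounded m k \<Longrightarrow>
      (\<exists>t \<le> D * k. exec Q m t (result Q m)) \<and> mem_bounded (result Q m) (D * k)"
    by auto
  show ?case
  proof (rule exI[of _ "C + D * C"], intro conjI allI impI)
    fix m k
    assume k: "1 \<le> k" "mem_bounded m k"
    have Ck: "1 \<le> C * k"
      using C(1) k(1) by simp
    obtain t where t: "t \<le> C * k" "exec P m t (result P m)" "mem_bounded (result P m) (C * k)"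
      using C(2)[OF k] by blast
    obtain u where u: "u \<le> D * (C * k)" "exec Q (result P m) u (result Q (result P m))"
      "mem_bounded (result Q (result P m)) (D * (C * k))"
      using D(2)[OF Ck t(3)] by blast
    show "\<exists>t\<le>(C + D * C) * k. exec (Seq P Q) m t (result (Seq P Q) m)"
      using exec.Seq[OF t(2) u(2)] t(1) u(1)
      by (intro exI[of _ "t + u"]) (simp add: add_mult_distrib mult.assoc)
    show "mem_bounded (result (Seq P Q) m) ((C + D * C) * k)"
      using mem_bounded_mono[OF u(3)] by (simp add: add_mult_distrib mult.assoc)
  qed (use C(1) in simp)
next
  case (Cond e P Q)
  then obtain C D where C: "1 \<le> C" "\<And>m k. 1 \<le> k \<Longrightarrow> mem_bounded m k \<Longrightarrow>
      (\<exists>t \<le> C * k. exec P m t (result P m)) \<and> mem_bounded (result P m) (C * k)"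
    and D: "1 \<le> D" "\<And>m k. 1 \<le> k \<Longrightarrow> mem_bounded m k \<Longrightarrow>
      (\<exists>t \<le> D * k. exec Q m t (result Q m)) \<and> mem_bounded (result Q m) (D * k)"
    by auto
  obtain E where E: "\<And>m k. 1 \<le> k \<Longrightarrow> mem_bounded m k \<Longrightarrow> expr_cost e m + int_size (expr_val e m) \<le> E * k"
    using expr_cost_bounded by blast
  show ?case
  proof (rule exI[of _ "C + D + E"], intro conjI allI impI)
    fix m k
    assume k: "1 \<le> k" "mem_bounded m k"
    obtain t where t: "t \<le> C * k" "exec P m t (result P m)" "mem_bounded (result P m) (C * k)"
      using C(2)[OF k] by blast
    obtain u where u: "u \<le> D * k" "exec Q m u (result Q m)" "mem_bounded (result Q m) (D * k)"
      using D(2)[OF k] by blast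
    show "\<exists>t\<le>(C + D + E) * k. exec (Cond e P Q) m t (result (Cond e P Q) m)"
    proof (cases "expr_val e m > 0")
      case True
      then show ?thesis
        using exec.CondTrue[OF True t(2), of Q] t(1) E[OF k]
        by (intro exI conjI) (auto simp: add_mult_distrib)
    next
      case False
      then show ?thesis
        using exec.CondFalse[OF False u(2), of P] u(1) E[OF k]
        by (intro exI conjI) (auto simp: add_mult_distrib)
    qed
    show "mem_bounded (result (Cond e P Q) m) ((C + D + E) * k)"
      using mem_bounded_mono[OF t(3)] mem_bounded_mono[OF u(3)] by (simp add: add_mult_distrib)
  qed (use C(1) in simp)
qed simp

section \<open>Total correctness with a time budget\<close>

definition runs :: "nat \<Rightarrow> program \<Rightarrow> memory \<Rightarrow> (memory \<Rightarrow> bool) \<Rightarrow> bool" where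
  "runs T P m Q \<longleftrightarrow> (\<exists>t m'. exec P m t m' \<and> t \<le> T \<and> Q m')"

text \<open>\<open>C\<close> depends only on the program and not on the memory, the size bound or
  the postcondition; the final polynomial has to be uniform in the same way.\<close>

lemma runs_loop_free:
  assumes "loop_free P"
  obtains C where "\<And>m k Q. 1 \<le> k \<Longrightarrow> mem_bounded m k \<Longrightarrow> Q (result P m) \<Longrightarrow> runs (C * k) P m Q"
  using exec_loop_free[OF assms] unfolding runs_def by blast

lemma runs_Seq:
  "runs T P m R \<Longrightarrow> (\<And>m'. R m' \<Longrightarrow> runs T' P' m' Q) \<Longrightarrow> runs (T + T') (Seq P P') m Q"
  unfolding runs_def by (meson add_mono exec.Seq)

lemma runs_Cond:
  assumes "expr_cost e m + int_size (expr_val e m) \<le> T0"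
    and "0 < expr_val e m \<Longrightarrow> runs T P m Q" "\<not> 0 < expr_val e m \<Longrightarrow> runs T P' m Q"
  shows "runs (T0 + T) (Cond e P P') m Q"
proof (cases "0 < expr_val e m")
  case True
  then show ?thesis
    using assms unfolding runs_def by (meson add_mono exec.CondTrue)
next
  case False
  then show ?thesis
    using assms unfolding runs_def by (meson add_mono exec.CondFalse)
qed

lemma runs_mono: "runs T P m Q \<Longrightarrow> T \<le> T' \<Longrightarrow> (\<And>m'. Q m' \<Longrightarrow> Q' m') \<Longrightarrow> runs T' P m Q'"
  unfolding runs_def by (meson order_trans)

text \<open>The measure bounds the number of iterations, each of which costs one test and one body;
  the last \<open>T0\<close> pays for the failing test.\<close>

lemma runs_While:
  fixes \<mu> :: "memory \<Rightarrow> nat"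
  assumes body: "\<And>m. I m \<Longrightarrow> 0 < expr_val e m \<Longrightarrow> runs T P m (\<lambda>m'. I m' \<and> \<mu> m' < \<mu> m)"
    and cost: "\<And>m. I m \<Longrightarrow> expr_cost e m + int_size (expr_val e m) \<le> T0"
    and "I m"
  shows "runs (\<mu> m * (T + T0) + T0) (While e P) m (\<lambda>m'. I m' \<and> \<not> 0 < expr_val e m')"
  using \<open>I m\<close>
proof (induction "\<mu> m" arbitrary: m rule: less_induct)
  case less
  show ?case
  proof (cases "0 < expr_val e m")
    case True
    then obtain t m1 where m1: "exec P m t m1" "t \<le> T" "I m1" "\<mu> m1 < \<mu> m"
      using body[OF less.prems] unfolding runs_def by blast
    obtain t' m2 where m2: "exec (While e P) m1 t' m2" "t' \<le> \<mu> m1 * (T + T0) + T0" "I m2" "\<not> 0 < expr_val e m2"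
      using less.hyps[OF m1(4,3)] unfolding runs_def by blast
    have "(\<mu> m1 + 1) * (T + T0) \<le> \<mu> m * (T + T0)"
      using m1(4) by (intro mult_right_mono) auto
    then have "expr_cost e m + int_size (expr_val e m) + t + t' \<le> \<mu> m * (T + T0) + T0"
      using cost[OF less.prems] m1(2) m2(2) by (simp add: add_mult_distrib)
    with exec.WhileTrue[OF True m1(1) m2(1)] m2(3,4) show ?thesis
      unfolding runs_def by blast
  next
    case False
    have "expr_cost e m + int_size (expr_val e m) \<le> \<mu> m * (T + T0) + T0"
      using cost[OF less.prems] by simp
    with exec.WhileFalse[OF False] False less.prems show ?thesis
      unfolding runs_def by blast
  qed
qed

section \<open>The program\<close>

text \<open>The program keeps its variables at negative addresses, so that the input stays in place.\<close>

abbreviation "r_N \<equiv> - 1 :: int"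
abbreviation "r_s \<equiv> - 2 :: int"
abbreviation "r_j \<equiv> - 3 :: int"
abbreviation "r_u1 \<equiv> - 4 :: int"
abbreviation "r_u2 \<equiv> - 5 :: int"
abbreviation "r_v1 \<equiv> - 6 :: int"
abbreviation "r_v2 \<equiv> - 7 :: int"
abbreviation "r_x1 \<equiv> - 8 :: int"
abbreviation "r_x2 \<equiv> - 9 :: int"
abbreviation "r_y1 \<equiv> - 10 :: int"
abbreviation "r_y2 \<equiv> - 11 :: int"
abbreviation "r_ok \<equiv> - 12 :: int"
abbreviation "r_lo \<equiv> - 13 :: int"
abbreviation "r_hi \<equiv> - 14 :: int"
abbreviation "r_w1 \<equiv> - 15 :: int"
abbreviation "r_w2 \<equiv> - 16 :: int"

abbreviation Var :: "int \<Rightarrow> expr" where "Var a \<equiv> Load (Const a)"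
abbreviation Set :: "int \<Rightarrow> expr \<Rightarrow> program" where "Set a e \<equiv> Store (Const a) e"

fun seqs :: "program list \<Rightarrow> program" where
  "seqs [] = Skip"
| "seqs (P # Ps) = Seq P (seqs Ps)"

section \<open>Arithmetic expressions for the entries and for \<open>act\<close>\<close>

definition e_k :: expr where "e_k = Div (Var r_j) (Const 3)"
definition e_r :: expr where "e_r = Sub (Var r_j) (Mult (Const 3) e_k)"

text \<open>For \<open>r < 3\<close> the factor \<open>r * (2 - r)\<close> tests \<open>r = 1\<close> and \<open>r div 2\<close> tests \<open>r = 2\<close>.\<close>

definition e_index :: expr where
  "e_index = Add (Mult (Add e_k (Mult e_r (Sub (Const 2) e_r))) (Var 0)) (Add e_k (Div e_r (Const 2)))"

text \<open>Cell \<open>0\<close> holds the dimension and each rational takes two cells, so that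
  \<open>c = 1\<close> addresses numerators and \<open>c = 2\<close> denominators.
  \<open>\<Delta>\<close> follows after the \<open>2 * n * n\<close> cells of
  \<open>A\<close>.\<close>

definition e_A :: "int \<Rightarrow> expr" where
  "e_A c = Load (Add (Const c) (Mult (Const 2) e_index))"

definition e_\<Delta> :: "int \<Rightarrow> expr" where
  "e_\<Delta> c = Load (Add (Const c) (Add (Mult (Const 2) (Mult (Var 0) (Var 0))) (Mult (Const 2) e_index)))"

definition e_a :: expr where "e_a = Mult (e_A 1) (e_\<Delta> 2)"
definition e_e :: expr where "e_e = Mult (e_\<Delta> 1) (e_A 2)"
definition e_d :: expr where "e_d = Mult (e_A 2) (e_\<Delta> 2)"

definition e_t :: "int \<Rightarrow> expr" where
  "e_t c = Add (Mult e_a (Var r_N)) (Mult (Mult (Const c) (Var r_s)) e_e)"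

text \<open>The remainders 0, 1, 2 give 1, 0, 0. Expressions have no conditional, so
  \<open>e_act1\<close> and \<open>e_act2\<close> blend the two kinds of steps with this
  indicator.\<close>

definition e_z :: expr where
  "e_z = Sub (Const 1) (Div (Add e_r (Const 1)) (Const 2))"

definition e_act1 :: "int \<Rightarrow> int \<Rightarrow> int \<Rightarrow> expr" where
  "e_act1 c p q = Add
     (Mult e_z (Sub (Mult (e_t c) (Var p)) (Mult (Mult e_d (Var r_N)) (Var q))))
     (Mult (Sub (Const 1) e_z) (Mult (Mult e_d (Var r_N)) (Var p)))"

definition e_act2 :: "int \<Rightarrow> int \<Rightarrow> int \<Rightarrow> expr" where
  "e_act2 c p q = Add
     (Mult e_z (Mult (Mult e_d (Var r_N)) (Var p)))
     (Mult (Sub (Const 1) e_z) (Mult (e_t c) (Var q)))"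

definition e_cross :: "int \<Rightarrow> int \<Rightarrow> int \<Rightarrow> int \<Rightarrow> expr" where
  "e_cross a b c d = Sub (Mult (Var a) (Var d)) (Mult (Var b) (Var c))"

definition e_remaining :: expr where
  "e_remaining = Sub (Sub (Mult (Const 3) (Var 0)) (Const 2)) (Var r_j)"

text \<open>As \<open>r_ok\<close> holds \<open>0\<close> or \<open>1\<close>, positivity of the
  product expresses the conjunction in \<open>regular_test\<close>.\<close>

definition e_regular :: expr where
  "e_regular = Mult (Var r_ok) (Mult (Var r_u1) (Var r_v1))"

text \<open>Conditions only recognise positive values, whence the negated cross products; the test
  of the inner product is reached when \<open>cross u w\<close> vanishes.\<close>

definition insert_prog :: program where
  "insert_prog =
     Cond (e_cross r_x1 r_x2 r_w1 r_w2)
       (Cond (Sub (Const 0) (e_cross r_w1 r_w2 r_y1 r_y2))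
          (Seq (Set r_y1 (Var r_w1)) (Set r_y2 (Var r_w2)))
          Skip)
       (Cond (Sub (Const 0) (e_cross r_x1 r_x2 r_w1 r_w2))
          (Cond (e_cross r_w1 r_w2 r_y1 r_y2)
             (Seq (Set r_x1 (Var r_w1)) (Set r_x2 (Var r_w2)))
             (Set r_ok (Const 0)))
          (Cond (Add (Mult (Var r_x1) (Var r_w1)) (Mult (Var r_x2) (Var r_w2)))
             Skip
             (Set r_ok (Const 0))))"

definition push_prog :: "int \<Rightarrow> int \<Rightarrow> int \<Rightarrow> program" where
  "push_prog c p q = Seq (Set r_w1 (e_act1 c p q)) (Seq (Set r_w2 (e_act2 c p q)) insert_prog)"

text \<open>The new cone is built in cells of its own, because all four images are taken of the old
  pair, which has to survive until the step is complete.\<close>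

definition step_prog :: program where
  "step_prog = seqs
     [Set r_w1 (e_act1 1 r_u1 r_u2), Set r_w2 (e_act2 1 r_u1 r_u2),
      Set r_x1 (Var r_w1), Set r_x2 (Var r_w2), Set r_y1 (Var r_w1), Set r_y2 (Var r_w2),
      push_prog 1 r_u1 r_u2, push_prog (- 1) r_u1 r_u2,
      push_prog 1 r_v1 r_v2, push_prog (- 1) r_v1 r_v2,
      Set r_u1 (Var r_x1), Set r_u2 (Var r_x2), Set r_v1 (Var r_y1), Set r_v2 (Var r_y2),
      Set r_j (Add (Var r_j) (Const 1))]"

definition test_init_prog :: program where
  "test_init_prog = seqs
     [Set r_j (Const 0), Set r_u1 (Const 1), Set r_u2 (Const 0), Set r_v1 (Const 1), Set r_v2 (Const 0),
      Set r_ok (Const 1)]"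

definition test_prog :: program where
  "test_prog = Seq test_init_prog (While e_remaining step_prog)"

definition factor_prog :: program where
  "factor_prog = seqs
     [Set r_hi (Mult (Var r_hi) (Add (Add (Mult e_a e_a) e_e) e_d)), Set r_j (Add (Var r_j) (Const 1))]"

definition bound_prog :: program where
  "bound_prog = Seq (Seq (Set r_hi (Const 1)) (Set r_j (Const 0))) (While e_remaining factor_prog)"

section \<open>Correctness of the straight-line parts\<close>

definition holds_input :: "rat mat \<Rightarrow> rat mat \<Rightarrow> nat \<Rightarrow> memory \<Rightarrow> bool" where
  "holds_input A \<Delta> n m \<longleftrightarrow> m 0 = int n \<and> (\<forall>i<n. \<forall>j<n.
     m (1 + 2 * (int i * int n + int j)) = num (A $$ (i, j)) \<and>
     m (2 + 2 * (int i * int n + int j)) = den (A $$ (i, j)) \<and>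
     m (1 + (2 * (int n * int n) + 2 * (int i * int n + int j))) = num (\<Delta> $$ (i, j)) \<and>
     m (2 + (2 * (int n * int n) + 2 * (int i * int n + int j))) = den (\<Delta> $$ (i, j)))"

lemma holds_input_cong:
  assumes "holds_input A \<Delta> n m" "\<And>a. 0 \<le> a \<Longrightarrow> m' a = m a"
  shows "holds_input A \<Delta> n m'"
  using assms unfolding holds_input_def by simp

definition cone_of :: "memory \<Rightarrow> (int \<times> int) \<times> (int \<times> int) \<times> bool" where
  "cone_of m = ((m r_x1, m r_x2), (m r_y1, m r_y2), 0 < m r_ok)"

lemma result_insert_prog:
  "cone_of (result insert_prog m) = ins (m r_w1, m r_w2) (cone_of m)"
  "result insert_prog m r_ok \<in> {0, m r_ok}"
  "a \<notin> {r_x1, r_x2, r_y1, r_y2, r_ok} \<Longrightarrow> result insert_prog m a = m a"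
  by (auto simp: insert_prog_def cone_of_def e_cross_def cross_def dot_def)

text \<open>These cells change while the old pair is still needed; the larger
  \<open>test_regs\<close> is what a whole test may change. The data of the bisection lie outside
  both.\<close>

definition scratch :: "int set" where
  "scratch = {r_x1, r_x2, r_y1, r_y2, r_ok, r_w1, r_w2}"

definition test_regs :: "int set" where
  "test_regs = {r_j, r_u1, r_u2, r_v1, r_v2} \<union> scratch"

context tridiagonal_input begin

definition at_step :: "int \<Rightarrow> int \<Rightarrow> nat \<Rightarrow> int \<times> int \<Rightarrow> int \<times> int \<Rightarrow> memory \<Rightarrow> bool" where
  "at_step N s j u v m \<longleftrightarrow> holds_input A \<Delta> n m \<and> m r_N = N \<and> m r_s = s \<and> m r_j = int j \<and>
     (m r_u1, m r_u2) = u \<and> (m r_v1, m r_v2) = v"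

lemma at_step_cong:
  assumes "at_step N s j u v m" "\<And>a. a \<notin> scratch \<Longrightarrow> m' a = m a"
  shows "at_step N s j u v m'"
  using assms holds_input_cong[of A \<Delta> n m m'] unfolding at_step_def by (auto simp: scratch_def)

lemma val_e_k: "m r_j = int j \<Longrightarrow> expr_val e_k m = int (j div 3)"
  and val_e_r: "m r_j = int j \<Longrightarrow> expr_val e_r m = int (j mod 3)"
proof -
  assume j: "m r_j = int j"
  then show k: "expr_val e_k m = int (j div 3)"
    by (simp add: e_k_def zdiv_int)
  have "int j = 3 * int (j div 3) + int (j mod 3)"
    by (metis div_mult_mod_eq mult.commute of_nat_add of_nat_mult of_nat_numeral)
  then show "expr_val e_r m = int (j mod 3)"
    using j k by (simp add: e_r_def)
qed

lemma mod_3_cases: "j mod 3 = 0 \<or> j mod 3 = 1 \<or> j mod 3 = 2" for j :: nat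
  by presburger

lemma val_e_index:
  assumes "m r_j = int j" "m 0 = int n"
  shows "expr_val e_index m = int (param_row j) * int n + int (param_col j)"
  using mod_3_cases[of j] assms(2) val_e_k[of m j] val_e_r[of m j] assms(1)
  by (auto simp: e_index_def param_row_def param_col_def)

lemma val_e_aed:
  assumes "holds_input A \<Delta> n m" "m r_j = int j" "j < 3 * n - 2" "param A \<Delta> j = (k, a, e, d)"
  shows "expr_val e_a m = a" "expr_val e_e m = e" "expr_val e_d m = d"
proof -
  have m0: "m 0 = int n"
    using assms(1) by (simp add: holds_input_def)
  note idx = val_e_index[OF assms(2) m0]
  have "expr_val (e_A 1) m = num (A $$ (param_row j, param_col j))"
    "expr_val (e_A 2) m = den (A $$ (param_row j, param_col j))"
    "expr_val (e_\<Delta> 1) m = num (\<Delta> $$ (param_row j, param_col j))"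
    "expr_val (e_\<Delta> 2) m = den (\<Delta> $$ (param_row j, param_col j))"
    using assms(1) param_row_col_less[OF assms(3)] m0
    unfolding e_A_def e_\<Delta>_def expr_val.simps idx holds_input_def by simp_all
  then show "expr_val e_a m = a" "expr_val e_e m = e" "expr_val e_d m = d"
    using assms(4) by (auto simp: e_a_def e_e_def e_d_def param_def Let_def)
qed

lemma val_e_act:
  assumes "at_step N s j u v m" "j < 3 * n - 2"
  shows "(expr_val (e_act1 c p q) m, expr_val (e_act2 c p q) m) =
    act (scale_param N (param A \<Delta> j)) (c * s) (m p, m q)"
proof -
  obtain k a e d where x: "param A \<Delta> j = (k, a, e, d)"
    by (cases "param A \<Delta> j") auto
  have m: "holds_input A \<Delta> n m" "m r_j = int j" "m r_N = N" "m r_s = s"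
    using assms(1) by (simp_all add: at_step_def)
  have k: "k \<longleftrightarrow> j mod 3 = 0"
    using x by (auto simp: param_def Let_def)
  have z: "expr_val e_z m = (if k then 1 else 0)"
    using mod_3_cases[of j] val_e_r[of m j] m(2) k by (auto simp: e_z_def)
  show ?thesis
    using val_e_aed[OF m(1,2) assms(2) x] z m
    by (simp add: e_act1_def e_act2_def e_t_def x scale_param_def)
qed

text \<open>Because \<open>p\<close> and \<open>q\<close> lie outside \<open>scratch\<close>,
  storing the first component of the image does not disturb the evaluation of the second.\<close>

lemma result_push_prog:
  fixes c :: int
  assumes "at_step N s j u v m" "j < 3 * n - 2" "p \<notin> scratch" "q \<notin> scratch"
  defines "w \<equiv> act (scale_param N (param A \<Delta> j)) (c * s) (m p, m q)"
    and "m' \<equiv> result (push_prog c p q) m"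
  shows "cone_of m' = ins w (cone_of m)" "(m' r_w1, m' r_w2) = w" "m' r_ok \<in> {0, m r_ok}"
    "\<And>a. a \<notin> scratch \<Longrightarrow> m' a = m a"
proof -
  define m1 where "m1 = m(r_w1 := expr_val (e_act1 c p q) m)"
  define m2 where "m2 = m1(r_w2 := expr_val (e_act2 c p q) m1)"
  have m': "m' = result insert_prog m2"
    by (simp add: m'_def push_prog_def m1_def m2_def)
  have "at_step N s j u v m1"
    using assms(1) by (rule at_step_cong) (simp add: m1_def scratch_def)
  moreover have "m1 p = m p" "m1 q = m q"
    using assms(3,4) by (auto simp: m1_def scratch_def)
  ultimately have "expr_val (e_act2 c p q) m1 = snd w" "expr_val (e_act1 c p q) m = fst w"
    using val_e_act[of N s j u v m1 c p q] val_e_act[of N s j u v m c p q] assms(1,2)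
    unfolding w_def by (metis snd_conv, metis fst_conv)
  then have w: "(m2 r_w1, m2 r_w2) = w"
    by (simp add: m2_def m1_def)
  have m2: "m2 a = m a" if "a \<notin> {r_w1, r_w2}" for a
    using that by (simp add: m2_def m1_def)
  show "cone_of m' = ins w (cone_of m)"
    unfolding m' result_insert_prog(1) w by (simp add: cone_of_def m2)
  show "(m' r_w1, m' r_w2) = w"
    unfolding m' using w by (simp add: result_insert_prog(3))
  show "m' r_ok \<in> {0, m r_ok}"
    unfolding m' using result_insert_prog(2)[of m2] by (simp add: m2)
  show "m' a = m a" if "a \<notin> scratch" for a
    unfolding m' using that by (simp add: scratch_def result_insert_prog(3) m2)
qed

text \<open>What remains in the scratch cells is recorded as well, since the size bound in the loop
  invariant speaks of every memory cell.\<close>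

lemma result_step_prog:
  assumes "at_step N s j u v m" "j < 3 * n - 2"
    and "cone_step s (scale_param N (param A \<Delta> j)) (u, v, 0 < m r_ok) = (u', v', ok')"
  defines "m' \<equiv> result step_prog m"
  shows "at_step N s (Suc j) u' v' m'" "0 < m' r_ok \<longleftrightarrow> ok'" "m' r_ok \<in> {0, m r_ok}"
    "(m' r_x1, m' r_x2) = u'" "(m' r_y1, m' r_y2) = v'"
    "(m' r_w1, m' r_w2) = act (scale_param N (param A \<Delta> j)) (- s) v"
    "\<And>a. a \<notin> test_regs \<Longrightarrow> m' a = m a"
proof -
  let ?act = "act (scale_param N (param A \<Delta> j))"
  define w where "w = ?act s u"
  define m0 where "m0 = m(r_w1 := expr_val (e_act1 1 r_u1 r_u2) m)"
  define m1 where "m1 = m0(r_w2 := expr_val (e_act2 1 r_u1 r_u2) m0, r_x1 := fst w, r_x2 := snd w,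
    r_y1 := fst w, r_y2 := snd w)"
  define m2 where "m2 = result (push_prog 1 r_u1 r_u2) m1"
  define m3 where "m3 = result (push_prog (- 1) r_u1 r_u2) m2"
  define m4 where "m4 = result (push_prog 1 r_v1 r_v2) m3"
  define m5 where "m5 = result (push_prog (- 1) r_v1 r_v2) m4"
  have s: "r_u1 \<notin> scratch" "r_u2 \<notin> scratch" "r_v1 \<notin> scratch" "r_v2 \<notin> scratch"
    by (auto simp: scratch_def)
  have uv: "(m r_u1, m r_u2) = u" "(m r_v1, m r_v2) = v"
    using assms(1) by (auto simp: at_step_def)
  have at0: "at_step N s j u v m0"
    using assms(1) by (rule at_step_cong) (simp add: m0_def scratch_def)
  have "m0 r_u1 = m r_u1" "m0 r_u2 = m r_u2"
    by (simp_all add: m0_def)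
  then have e: "expr_val (e_act1 1 r_u1 r_u2) m = fst w" "expr_val (e_act2 1 r_u1 r_u2) m0 = snd w"
    using val_e_act[OF assms(1,2), of 1 r_u1 r_u2] val_e_act[OF at0 assms(2), of 1 r_u1 r_u2] uv(1)
    unfolding w_def by (metis fst_conv mult_1, metis snd_conv mult_1)
  have m1: "m1 a = m a" if "a \<notin> scratch" for a
    using that by (simp add: m1_def m0_def scratch_def)
  have at1: "at_step N s j u v m1"
    using assms(1) m1 by (rule at_step_cong)
  have cone1: "cone_of m1 = (w, w, 0 < m r_ok)"
    by (simp add: cone_of_def m1_def m0_def)
  note p2 = result_push_prog[OF at1 assms(2) s(1,2), where c = 1, folded m2_def]
  have at2: "at_step N s j u v m2"
    using at1 p2(4) by (rule at_step_cong)
  note p3 = result_push_prog[OF at2 assms(2) s(1,2), where c = "- 1", folded m3_def]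
  have at3: "at_step N s j u v m3"
    using at2 p3(4) by (rule at_step_cong)
  note p4 = result_push_prog[OF at3 assms(2) s(3,4), where c = 1, folded m4_def]
  have at4: "at_step N s j u v m4"
    using at3 p4(4) by (rule at_step_cong)
  note p5 = result_push_prog[OF at4 assms(2) s(3,4), where c = "- 1", folded m5_def]
  have at5: "at_step N s j u v m5"
    using at4 p5(4) by (rule at_step_cong)
  have uvi: "(m1 r_u1, m1 r_u2) = u" "(m2 r_u1, m2 r_u2) = u" "(m3 r_v1, m3 r_v2) = v" "(m4 r_v1, m4 r_v2) = v"
    using at1 at2 at3 at4 by (simp_all add: at_step_def)
  have "cone_of m5 = cone_step s (scale_param N (param A \<Delta> j)) (u, v, 0 < m r_ok)"
    unfolding cone_step_def prod.case p5(1) p4(1) p3(1) p2(1) cone1 uvi w_def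
    by (simp del: ins.simps)
  then have cone5: "cone_of m5 = (u', v', ok')"
    using assms(3) by simp
  have m': "m' = m5(r_u1 := m5 r_x1, r_u2 := m5 r_x2, r_v1 := m5 r_y1, r_v2 := m5 r_y2, r_j := m5 r_j + 1)"
    unfolding m'_def m5_def m4_def m3_def m2_def m1_def
    using e unfolding m0_def step_prog_def by simp
  show "at_step N s (Suc j) u' v' m'"
    using at5 cone5 holds_input_cong[of A \<Delta> n m5 m'] by (auto simp: m' at_step_def cone_of_def)
  show "0 < m' r_ok \<longleftrightarrow> ok'" "(m' r_x1, m' r_x2) = u'" "(m' r_y1, m' r_y2) = v'"
    using cone5 by (auto simp: m' cone_of_def)
  have "m1 r_ok = m r_ok"
    by (simp add: m1_def m0_def)
  then show "m' r_ok \<in> {0, m r_ok}"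
    using p2(3) p3(3) p4(3) p5(3) by (auto simp: m')
  show "(m' r_w1, m' r_w2) = ?act (- s) v"
    using p5(2) uvi(4) by (simp add: m')
  show "m' a = m a" if "a \<notin> test_regs" for a
    using that by (simp add: m' test_regs_def m1 p2(4) p3(4) p4(4) p5(4))
qed

end

text \<open>Needed after a failure too, where \<open>fold_ins_cone\<close> says nothing: the program
  goes on, and its numbers must remain bounded.\<close>

lemma fold_ins_members:
  "fold ins ws (u, v, ok) = (u', v', ok') \<Longrightarrow> u' \<in> {u, v} \<union> set ws \<and> v' \<in> {u, v} \<union> set ws"
proof (induction ws arbitrary: u v ok)
  case (Cons w ws)
  obtain u1 v1 ok1 where i: "ins w (u, v, ok) = (u1, v1, ok1)"
    by (cases "ins w (u, v, ok)") auto
  have "u1 \<in> {u, v, w}" "v1 \<in> {u, v, w}"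
    using i by (auto split: if_splits)
  moreover have "fold ins ws (u1, v1, ok1) = (u', v', ok')"
    using Cons.prems i by (simp del: ins.simps)
  note Cons.IH[OF this]
  ultimately show ?case by auto
qed simp

text \<open>A new extremal vector is the image of a single old one, so that norms grow by the factor
  \<open>K\<close> only. Taking \<open>\<bar>s\<bar> + 1\<close> instead of
  \<open>\<bar>s\<bar>\<close> meets the condition \<open>1 \<le> c\<close> of
  \<open>sup_norm_act_le\<close>.\<close>

lemma cone_step_sup_norm_le:
  assumes "cone_step s (k, a, e, d) (u, v, ok) = (u', v', ok')"
    and "\<bar>a\<bar> + (\<bar>s\<bar> + 1) * \<bar>e\<bar> + \<bar>d\<bar> \<le> K" "sup_norm u \<le> L" "sup_norm v \<le> L"
  shows "sup_norm u' \<le> K * L" "sup_norm v' \<le> K * L" "sup_norm (act (k, a, e, d) (- s) v) \<le> K * L"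
proof -
  have K: "0 \<le> K"
    using assms(2) by (rule order_trans[rotated]) simp
  have "sup_norm (act (k, a, e, d) r w) \<le> K * L" if "\<bar>r\<bar> = \<bar>s\<bar>" "sup_norm w \<le> L" for r w
  proof -
    have "sup_norm (act (k, a, e, d) r w) \<le> (\<bar>a\<bar> + (\<bar>s\<bar> + 1) * \<bar>e\<bar> + \<bar>d\<bar>) * sup_norm w"
      by (rule sup_norm_act_le) (use that in auto)
    also have "\<dots> \<le> K * L"
      using assms(2) that(2) K sup_norm_nonneg by (intro mult_mono)
    finally show ?thesis .
  qed
  then have b: "sup_norm (act (k, a, e, d) s u) \<le> K * L" "sup_norm (act (k, a, e, d) (- s) u) \<le> K * L"
    "sup_norm (act (k, a, e, d) s v) \<le> K * L" "sup_norm (act (k, a, e, d) (- s) v) \<le> K * L"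
    using assms(3,4) by (metis abs_minus_cancel)+
  have "u' \<in> {act (k, a, e, d) s u, act (k, a, e, d) (- s) u, act (k, a, e, d) s v, act (k, a, e, d) (- s) v}"
    "v' \<in> {act (k, a, e, d) s u, act (k, a, e, d) (- s) u, act (k, a, e, d) s v, act (k, a, e, d) (- s) v}"
    using fold_ins_members[OF assms(1)[unfolded cone_step_def prod.case]] by auto
  with b show "sup_norm u' \<le> K * L" "sup_norm v' \<le> K * L"
    "sup_norm (act (k, a, e, d) (- s) v) \<le> K * L"
    by (metis insertE singletonD)+
qed

lemma fst_le_sup_norm: "\<bar>fst w\<bar> \<le> sup_norm w" and snd_le_sup_norm: "\<bar>snd w\<bar> \<le> sup_norm w"
  by (simp_all add: sup_norm_def)

section \<open>Loop invariants and the size of the numbers\<close>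

context tridiagonal_input begin

text \<open>All numbers in the tests with numerators up to \<open>s\<close> are bounded by \<open>2 ^ l\<close>.\<close>

definition size_ok :: "int \<Rightarrow> int \<Rightarrow> nat \<Rightarrow> bool" where
  "size_ok N s l \<longleftrightarrow> 1 \<le> l \<and> int (3 * n) \<le> 2 ^ l \<and> (\<exists>K\<ge>1. K ^ (3 * n) \<le> 2 ^ l \<and>
     (\<forall>j<3 * n - 2. case param A \<Delta> j of (k, a, e, d) \<Rightarrow> \<bar>a * N\<bar> + (\<bar>s\<bar> + 1) * \<bar>e\<bar> + \<bar>d * N\<bar> \<le> K))"

lemma size_ok_mono:
  assumes "size_ok N s l" "\<bar>r\<bar> \<le> \<bar>s\<bar>"
  shows "size_ok N r l"
proof -
  obtain K where K: "1 \<le> l" "int (3 * n) \<le> 2 ^ l" "1 \<le> K" "K ^ (3 * n) \<le> 2 ^ l"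
    "\<And>j k a e d. j < 3 * n - 2 \<Longrightarrow> param A \<Delta> j = (k, a, e, d) \<Longrightarrow> \<bar>a * N\<bar> + (\<bar>s\<bar> + 1) * \<bar>e\<bar> + \<bar>d * N\<bar> \<le> K"
    using assms(1) unfolding size_ok_def by (force split: prod.splits)
  have "\<bar>a * N\<bar> + (\<bar>r\<bar> + 1) * \<bar>e\<bar> + \<bar>d * N\<bar> \<le> K"
    if "j < 3 * n - 2" "param A \<Delta> j = (k, a, e, d)" for j k a e d
  proof -
    have "(\<bar>r\<bar> + 1) * \<bar>e\<bar> \<le> (\<bar>s\<bar> + 1) * \<bar>e\<bar>"
      using assms(2) by (intro mult_right_mono) auto
    then show ?thesis
      using K(5)[OF that] by linarith
  qed
  then show ?thesis
    unfolding size_ok_def using K(1-4) by (auto split: prod.split)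
qed

text \<open>\<open>K ^ j\<close> is the growth after \<open>j\<close> parameters, and
  \<open>l\<close> stays the same in all iterations. \<open>m0\<close> is the memory before the
  test, to which the frame clause refers.\<close>

definition test_inv :: "int \<Rightarrow> int \<Rightarrow> int \<Rightarrow> nat \<Rightarrow> memory \<Rightarrow> memory \<Rightarrow> bool" where
  "test_inv N s K l m0 m \<longleftrightarrow> (\<exists>j u v. j \<le> 3 * n - 2 \<and> at_step N s j u v m \<and> m r_ok \<in> {0, 1} \<and>
     fold (cone_step s) (map (scale_param N) (take j params)) ((1, 0), (1, 0), True) = (u, v, 0 < m r_ok) \<and>
     sup_norm u \<le> K ^ j \<and> sup_norm v \<le> K ^ j \<and> mem_bounded m l \<and> (\<forall>a. a \<notin> test_regs \<longrightarrow> m a = m0 a))"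

lemma val_e_remaining:
  assumes "m 0 = int n" "m r_j = int j" "j \<le> 3 * n - 2"
  shows "expr_val e_remaining m = int (3 * n - 2 - j)"
  using assms n by (simp add: e_remaining_def)

lemma test_inv_step:
  assumes inv: "test_inv N s K l m0 m" and pos: "0 < expr_val e_remaining m"
    and K: "1 \<le> K" "K ^ (3 * n) \<le> 2 ^ l" "int (3 * n) \<le> 2 ^ l"
      "\<And>j k a e d. j < 3 * n - 2 \<Longrightarrow> param A \<Delta> j = (k, a, e, d) \<Longrightarrow> \<bar>a * N\<bar> + (\<bar>s\<bar> + 1) * \<bar>e\<bar> + \<bar>d * N\<bar> \<le> K"
  defines "m' \<equiv> result step_prog m"
  shows "test_inv N s K l m0 m' \<and> nat (expr_val e_remaining m') < nat (expr_val e_remaining m)"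
proof -
  obtain j u v where j: "j \<le> 3 * n - 2" and at: "at_step N s j u v m" and ok: "m r_ok \<in> {0, 1}"
    and fold: "fold (cone_step s) (map (scale_param N) (take j params)) ((1, 0), (1, 0), True) = (u, v, 0 < m r_ok)"
    and norm: "sup_norm u \<le> K ^ j" "sup_norm v \<le> K ^ j" and mem: "mem_bounded m l"
    and frame: "\<And>a. a \<notin> test_regs \<Longrightarrow> m a = m0 a"
    using inv unfolding test_inv_def by blast
  have m: "m 0 = int n" "m r_j = int j"
    using at by (auto simp: at_step_def holds_input_def)
  note rem = val_e_remaining[OF m j]
  then have jlt: "j < 3 * n - 2"
    using pos by simp
  obtain k a e d where x: "param A \<Delta> j = (k, a, e, d)"
    by (cases "param A \<Delta> j") auto
  then have sx: "scale_param N (param A \<Delta> j) = (k, a * N, e, d * N)"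
    by (simp add: scale_param_def)
  obtain u' v' ok' where step: "cone_step s (scale_param N (param A \<Delta> j)) (u, v, 0 < m r_ok) = (u', v', ok')"
    by (cases "cone_step s (scale_param N (param A \<Delta> j)) (u, v, 0 < m r_ok)") auto
  note r = result_step_prog[OF at jlt step, folded m'_def]
  note b = cone_step_sup_norm_le[OF step[unfolded sx] K(4)[OF jlt x] norm]
  have K': "K * K ^ j \<le> 2 ^ l"
  proof -
    have "K ^ Suc j \<le> K ^ (3 * n)"
      using K(1) jlt by (intro power_increasing) auto
    then show ?thesis using K(2) by simp
  qed
  have "mem_bounded m' l"
    unfolding mem_bounded_def
  proof
    fix c
    have small: "\<bar>fst w\<bar> \<le> 2 ^ l \<and> \<bar>snd w\<bar> \<le> 2 ^ l" if "sup_norm w \<le> K * K ^ j" for w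
      using fst_le_sup_norm[of w] snd_le_sup_norm[of w] that K' by linarith
    have pair: "\<bar>m' p\<bar> \<le> 2 ^ l" "\<bar>m' q\<bar> \<le> 2 ^ l" if "(m' p, m' q) = w" "sup_norm w \<le> K * K ^ j" for p q w
      using small[OF that(2)] unfolding that(1)[symmetric] by simp_all
    have uv: "(m' r_u1, m' r_u2) = u'" "(m' r_v1, m' r_v2) = v'" and "m' r_j = int (Suc j)"
      using r(1) by (simp_all add: at_step_def)
    moreover have "int (Suc j) \<le> 2 ^ l"
      using K(3) jlt by linarith
    ultimately have rj: "\<bar>m' r_j\<bar> \<le> 2 ^ l"
      by simp
    have rok: "\<bar>m' r_ok\<bar> \<le> 2 ^ l"
      using r(3) ok by auto
    have "\<forall>c\<in>test_regs. \<bar>m' c\<bar> \<le> 2 ^ l"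
      unfolding test_regs_def scratch_def
      using rj rok pair[OF uv(1) b(1)] pair[OF uv(2) b(2)] pair[OF r(4) b(1)] pair[OF r(5) b(2)]
        pair[OF r(6)[unfolded sx] b(3)] by (simp only: ball_Un ball_simps simp_thms)
    then show "\<bar>m' c\<bar> \<le> 2 ^ l"
      using r(7)[of c] mem by (cases "c \<in> test_regs") (simp_all add: mem_bounded_def)
  qed
  moreover have "take (Suc j) params = take j params @ [param A \<Delta> j]"
    using jlt by (simp add: take_Suc_conv_app_nth length_params) (simp add: params_def)
  then have "fold (cone_step s) (map (scale_param N) (take (Suc j) params)) ((1, 0), (1, 0), True)
      = (u', v', 0 < m' r_ok)"
    using fold step r(2) by simp
  moreover have "m' a = m0 a" if "a \<notin> test_regs" for a
    using r(7)[OF that] frame[OF that] by simp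
  moreover have "m' r_ok \<in> {0, 1}"
    using r(3) ok by auto
  ultimately have "test_inv N s K l m0 m'"
    unfolding test_inv_def using r(1) b(1,2) jlt by (intro exI[of _ "Suc j"] exI[of _ u'] exI[of _ v']) simp
  moreover have "expr_val e_remaining m' = int (3 * n - 2 - Suc j)"
    using r(1) jlt by (intro val_e_remaining) (auto simp: at_step_def holds_input_def)
  ultimately show ?thesis
    using rem jlt by simp
qed

lemma test_inv_init:
  assumes "holds_input A \<Delta> n m" "m r_N = N" "m r_s = s" "mem_bounded m l"
  shows "test_inv N s K l m (result test_init_prog m)"
proof -
  let ?m = "result test_init_prog m"
  have m': "?m = m(r_j := 0, r_u1 := 1, r_u2 := 0, r_v1 := 1, r_v2 := 0, r_ok := 1)"
    by (simp add: test_init_prog_def)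
  have "holds_input A \<Delta> n ?m"
    using assms(1) by (rule holds_input_cong) (simp add: m')
  moreover have "mem_bounded ?m l"
    using assms(4) by (simp add: m' mem_bounded_def)
  ultimately show ?thesis
    unfolding test_inv_def using assms(2,3)
    by (intro exI[of _ 0] exI[of _ "(1, 0)"])
      (simp add: m' at_step_def test_regs_def scratch_def sup_norm_def)
qed

lemma test_inv_final:
  assumes "test_inv N s K l m0 m" "\<not> 0 < expr_val e_remaining m"
  shows "mem_bounded m l" "\<And>a. a \<notin> test_regs \<Longrightarrow> m a = m0 a"
    "0 < expr_val e_regular m \<longleftrightarrow> regular_test N s"
proof -
  obtain j u v where j: "j \<le> 3 * n - 2" and at: "at_step N s j u v m" and ok: "m r_ok \<in> {0, 1}"
    and fold: "fold (cone_step s) (map (scale_param N) (take j params)) ((1, 0), (1, 0), True) = (u, v, 0 < m r_ok)"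
    and mem: "mem_bounded m l" and frame: "\<And>a. a \<notin> test_regs \<Longrightarrow> m a = m0 a"
    using assms(1) unfolding test_inv_def by blast
  have m: "m 0 = int n" "m r_j = int j"
    using at by (auto simp: at_step_def holds_input_def)
  have "take j params = params"
    using val_e_remaining[OF m j] assms(2) by (simp add: length_params)
  then have "regular_test N s \<longleftrightarrow> 0 < m r_ok \<and> 0 < fst u * fst v"
    using fold by (simp add: regular_test_def)
  moreover have "fst u = m r_u1" "fst v = m r_v1"
    using at by (auto simp: at_step_def)
  ultimately show "0 < expr_val e_regular m \<longleftrightarrow> regular_test N s"
    using ok by (auto simp: e_regular_def)
  show "mem_bounded m l" "\<And>a. a \<notin> test_regs \<Longrightarrow> m a = m0 a"
    using mem frame by auto
qed

definition bound_inv :: "nat \<Rightarrow> memory \<Rightarrow> memory \<Rightarrow> bool" where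
  "bound_inv l m0 m \<longleftrightarrow> (\<exists>j\<le>3 * n - 2. holds_input A \<Delta> n m \<and> m r_j = int j \<and> mem_bounded m l \<and>
     m r_hi = (\<Prod>i<j. case param A \<Delta> i of (k, a, e, d) \<Rightarrow> a * a + e + d) \<and>
     (\<forall>a. a \<notin> {r_j, r_hi} \<longrightarrow> m a = m0 a))"

lemma bound_inv_step:
  assumes inv: "bound_inv l m0 m" and pos: "0 < expr_val e_remaining m"
    and l: "radius_bound \<le> 2 ^ l" "int (3 * n) \<le> 2 ^ l"
  defines "m' \<equiv> result factor_prog m"
  shows "bound_inv l m0 m' \<and> nat (expr_val e_remaining m') < nat (expr_val e_remaining m)"
proof -
  let ?f = "\<lambda>i. case param A \<Delta> i of (k, a, e, d) \<Rightarrow> a * a + e + d"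
  obtain j where j: "j \<le> 3 * n - 2" and inp: "holds_input A \<Delta> n m" and mj: "m r_j = int j"
    and mem: "mem_bounded m l" and hi: "m r_hi = (\<Prod>i<j. ?f i)"
    and frame: "\<And>a. a \<notin> {r_j, r_hi} \<Longrightarrow> m a = m0 a"
    using inv unfolding bound_inv_def by blast
  have m0: "m 0 = int n"
    using inp by (simp add: holds_input_def)
  note rem = val_e_remaining[OF m0 mj j]
  then have jlt: "j < 3 * n - 2"
    using pos by simp
  obtain k a e d where x: "param A \<Delta> j = (k, a, e, d)"
    by (cases "param A \<Delta> j") auto
  have "m' = m(r_hi := m r_hi * ?f j, r_j := m r_j + 1)"
    using val_e_aed[OF inp mj jlt x] x by (simp add: m'_def factor_prog_def)
  then have m': "m' = m(r_hi := \<Prod>i<Suc j. ?f i, r_j := int (Suc j))"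
    by (simp add: hi mj add.commute)
  have f: "1 \<le> ?f i" if "i < 3 * n - 2" for i
    using weight_param_le(2)[OF that] by (auto split: prod.split)
  \<comment> \<open>The missing factors are all at least \<open>1\<close>.\<close>
  have "(\<Prod>i<Suc j. ?f i) \<le> radius_bound"
    unfolding radius_bound_def using jlt f by (intro prod_mono2) (auto intro: order_trans[OF zero_le_one])
  moreover have "1 \<le> (\<Prod>i<Suc j. ?f i)"
    using jlt f by (intro prod_ge_1) auto
  moreover have "int (Suc j) \<le> 2 ^ l"
    using l(2) jlt by linarith
  ultimately have "mem_bounded m' l"
    using mem l(1) by (auto simp: m' mem_bounded_def simp del: prod.lessThan_Suc)
  moreover have "holds_input A \<Delta> n m'"
    using inp by (rule holds_input_cong) (simp add: m')
  ultimately have "bound_inv l m0 m'"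
    unfolding bound_inv_def using jlt frame
    by (intro exI[of _ "Suc j"]) (simp add: m' del: prod.lessThan_Suc)
  moreover have "expr_val e_remaining m' = int (3 * n - 2 - Suc j)"
    using jlt m0 by (intro val_e_remaining) (auto simp: m')
  ultimately show ?thesis
    using rem jlt by simp
qed

end

text \<open>Stated outside the locale, because the constant has to be fixed before \<open>A\<close>,
  \<open>\<Delta>\<close> and \<open>n\<close>.\<close>

lemma test_prog_runs:
  obtains C where "\<And>A \<Delta> n N s l m. tridiagonal_input A \<Delta> n \<Longrightarrow> holds_input A \<Delta> n m \<Longrightarrow> m r_N = N \<Longrightarrow>
    m r_s = s \<Longrightarrow> mem_bounded m l \<Longrightarrow> tridiagonal_input.size_ok A \<Delta> n N s l \<Longrightarrow>
    runs (C * l * n) test_prog m (\<lambda>m'. mem_bounded m' l \<and> (\<forall>a. a \<notin> test_regs \<longrightarrow> m' a = m a) \<and>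
      (0 < expr_val e_regular m' \<longleftrightarrow> tridiagonal_input.regular_test A \<Delta> n N s))"
proof -
  have "loop_free test_init_prog" "loop_free step_prog"
    by (simp_all add: test_init_prog_def step_prog_def push_prog_def insert_prog_def)
  then obtain C1 C2 where
    C1: "\<And>m k Q. 1 \<le> k \<Longrightarrow> mem_bounded m k \<Longrightarrow> Q (result test_init_prog m) \<Longrightarrow> runs (C1 * k) test_init_prog m Q"
    and C2: "\<And>m k Q. 1 \<le> k \<Longrightarrow> mem_bounded m k \<Longrightarrow> Q (result step_prog m) \<Longrightarrow> runs (C2 * k) step_prog m Q"
    using runs_loop_free by metis
  obtain C3 where C3: "\<And>m k. 1 \<le> k \<Longrightarrow> mem_bounded m k \<Longrightarrow>
      expr_cost e_remaining m + int_size (expr_val e_remaining m) \<le> C3 * k"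
    using expr_cost_bounded by blast
  show thesis
  \<comment> \<open>\<open>C1\<close> pays for the initialisation, \<open>C2 + C3\<close> for body
    and loop condition in up to \<open>3 * n\<close> iterations, and the last \<open>C3\<close> for
    the failing condition; \<open>1 \<le> n\<close> absorbs the terms without
    \<open>n\<close>.\<close>
  proof (rule that[of "C1 + 3 * (C2 + C3) + C3"])
    fix A \<Delta> n N s l m
    assume *: "tridiagonal_input A \<Delta> n" "holds_input A \<Delta> n m" "m r_N = N" "m r_s = s" "mem_bounded m l"
      "tridiagonal_input.size_ok A \<Delta> n N s l"
    interpret tridiagonal_input A \<Delta> n
      by (fact *(1))
    let ?Q = "\<lambda>m'. mem_bounded m' l \<and> (\<forall>a. a \<notin> test_regs \<longrightarrow> m' a = m a) \<and>
      (0 < expr_val e_regular m' \<longleftrightarrow> regular_test N s)"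
    obtain K where K: "1 \<le> l" "int (3 * n) \<le> 2 ^ l" "1 \<le> K" "K ^ (3 * n) \<le> 2 ^ l"
      "\<And>j k a e d. j < 3 * n - 2 \<Longrightarrow> param A \<Delta> j = (k, a, e, d) \<Longrightarrow> \<bar>a * N\<bar> + (\<bar>s\<bar> + 1) * \<bar>e\<bar> + \<bar>d * N\<bar> \<le> K"
      using *(6) unfolding size_ok_def by (force split: prod.splits)
    have mem: "mem_bounded m' l" if "test_inv N s K l m m'" for m'
      using that unfolding test_inv_def by blast
    have loop: "runs (3 * n * (C2 * l + C3 * l) + C3 * l) (While e_remaining step_prog) m'
      ?Q" if "test_inv N s K l m m'" for m'
    proof -
      have "runs (nat (expr_val e_remaining m') * (C2 * l + C3 * l) + C3 * l) (While e_remaining step_prog) m'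
          (\<lambda>m'. test_inv N s K l m m' \<and> \<not> 0 < expr_val e_remaining m')"
      proof (rule runs_While[where I = "test_inv N s K l m" and \<mu> = "\<lambda>m. nat (expr_val e_remaining m)"])
        fix m1
        assume m1: "test_inv N s K l m m1"
        show "expr_cost e_remaining m1 + int_size (expr_val e_remaining m1) \<le> C3 * l"
          using K(1) mem[OF m1] by (rule C3)
        assume "0 < expr_val e_remaining m1"
        from test_inv_step[OF m1 this K(3,4,2,5)]
        show "runs (C2 * l) step_prog m1
            (\<lambda>m'. test_inv N s K l m m' \<and> nat (expr_val e_remaining m') < nat (expr_val e_remaining m1))"
          using K(1) mem[OF m1] by (intro C2)
      qed (fact that)
      moreover have "nat (expr_val e_remaining m') \<le> 3 * n"
        using that val_e_remaining unfolding test_inv_def at_step_def holds_input_def by fastforce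
      then have "nat (expr_val e_remaining m') * (C2 * l + C3 * l) + C3 * l \<le> 3 * n * (C2 * l + C3 * l) + C3 * l"
        by (intro add_mono mult_right_mono) auto
      ultimately show ?thesis
        by (rule runs_mono) (use test_inv_final in blast)
    qed
    have "runs (C1 * l) test_init_prog m (test_inv N s K l m)"
      using K(1) *(2-5) by (intro C1 test_inv_init)
    from runs_Seq[OF this loop]
    have "runs (C1 * l + (3 * n * (C2 * l + C3 * l) + C3 * l)) test_prog m
      ?Q"
      unfolding test_prog_def .
    moreover have "C1 * l + (3 * n * (C2 * l + C3 * l) + C3 * l) \<le> (C1 + 3 * (C2 + C3) + C3) * l * n"
    proof -
      have "C1 * l + (3 * n * (C2 * l + C3 * l) + C3 * l) \<le>
          C1 * l * n + (3 * n * (C2 * l + C3 * l) + C3 * l * n)"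
        using n by (intro add_mono) simp_all
      also have "\<dots> = (C1 + 3 * (C2 + C3) + C3) * l * n"
        by (simp add: algebra_simps)
      finally show ?thesis .
    qed
    ultimately show "runs ((C1 + 3 * (C2 + C3) + C3) * l * n) test_prog m
      ?Q"
      by (rule runs_mono)
  qed
qed

lemma bound_prog_runs:
  obtains C where "\<And>A \<Delta> n l m. tridiagonal_input A \<Delta> n \<Longrightarrow> holds_input A \<Delta> n m \<Longrightarrow> mem_bounded m l \<Longrightarrow>
    1 \<le> l \<Longrightarrow> tridiagonal_input.radius_bound A \<Delta> n \<le> 2 ^ l \<Longrightarrow> int (3 * n) \<le> 2 ^ l \<Longrightarrow>
    runs (C * l * n) bound_prog m (\<lambda>m'. mem_bounded m' l \<and> (\<forall>a. a \<notin> {r_j, r_hi} \<longrightarrow> m' a = m a) \<and>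
      m' r_hi = tridiagonal_input.radius_bound A \<Delta> n)"
proof -
  let ?init = "Seq (Set r_hi (Const 1)) (Set r_j (Const 0))"
  have "loop_free ?init" "loop_free factor_prog"
    by (simp_all add: factor_prog_def)
  then obtain C1 C2 where
    C1: "\<And>m k Q. 1 \<le> k \<Longrightarrow> mem_bounded m k \<Longrightarrow> Q (result ?init m) \<Longrightarrow> runs (C1 * k) ?init m Q"
    and C2: "\<And>m k Q. 1 \<le> k \<Longrightarrow> mem_bounded m k \<Longrightarrow> Q (result factor_prog m) \<Longrightarrow> runs (C2 * k) factor_prog m Q"
    using runs_loop_free by metis
  obtain C3 where C3: "\<And>m k. 1 \<le> k \<Longrightarrow> mem_bounded m k \<Longrightarrow>
      expr_cost e_remaining m + int_size (expr_val e_remaining m) \<le> C3 * k"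
    using expr_cost_bounded by blast
  show thesis
  proof (rule that[of "C1 + 3 * (C2 + C3) + C3"])
    fix A \<Delta> n l m
    assume *: "tridiagonal_input A \<Delta> n" "holds_input A \<Delta> n m" "mem_bounded m l" "1 \<le> l"
      "tridiagonal_input.radius_bound A \<Delta> n \<le> 2 ^ l" "int (3 * n) \<le> 2 ^ l"
    interpret tridiagonal_input A \<Delta> n
      by (fact *(1))
    let ?Q = "\<lambda>m'. mem_bounded m' l \<and> (\<forall>a. a \<notin> {r_j, r_hi} \<longrightarrow> m' a = m a) \<and> m' r_hi = radius_bound"
    have mem: "mem_bounded m' l" if "bound_inv l m m'" for m'
      using that unfolding bound_inv_def by blast
    have loop: "runs (3 * n * (C2 * l + C3 * l) + C3 * l) (While e_remaining factor_prog) m' ?Q"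
      if "bound_inv l m m'" for m'
    proof -
      have "runs (nat (expr_val e_remaining m') * (C2 * l + C3 * l) + C3 * l) (While e_remaining factor_prog) m'
          (\<lambda>m'. bound_inv l m m' \<and> \<not> 0 < expr_val e_remaining m')"
      proof (rule runs_While[where I = "bound_inv l m" and \<mu> = "\<lambda>m. nat (expr_val e_remaining m)"])
        fix m1
        assume m1: "bound_inv l m m1"
        show "expr_cost e_remaining m1 + int_size (expr_val e_remaining m1) \<le> C3 * l"
          using *(4) mem[OF m1] by (rule C3)
        assume "0 < expr_val e_remaining m1"
        from bound_inv_step[OF m1 this *(5,6)]
        show "runs (C2 * l) factor_prog m1
            (\<lambda>m'. bound_inv l m m' \<and> nat (expr_val e_remaining m') < nat (expr_val e_remaining m1))"
          using *(4) mem[OF m1] by (intro C2)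
      qed (fact that)
      moreover have "nat (expr_val e_remaining m') \<le> 3 * n"
        using that val_e_remaining unfolding bound_inv_def holds_input_def by fastforce
      then have "nat (expr_val e_remaining m') * (C2 * l + C3 * l) + C3 * l \<le> 3 * n * (C2 * l + C3 * l) + C3 * l"
        by (intro add_mono mult_right_mono) auto
      moreover have "?Q m2" if final: "bound_inv l m m2 \<and> \<not> 0 < expr_val e_remaining m2" for m2
      proof -
        obtain j where j: "j \<le> 3 * n - 2" "m2 0 = int n" "m2 r_j = int j" "mem_bounded m2 l"
          "m2 r_hi = (\<Prod>i<j. case param A \<Delta> i of (k, a, e, d) \<Rightarrow> a * a + e + d)"
          "\<forall>a. a \<notin> {r_j, r_hi} \<longrightarrow> m2 a = m a"
          using final unfolding bound_inv_def holds_input_def by blast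
        have "int (3 * n - 2 - j) \<le> 0"
          using val_e_remaining[OF j(2,3,1)] final by simp
        then have "j = 3 * n - 2"
          using j(1) by simp
        with j show ?thesis
          by (simp add: radius_bound_def)
      qed
      ultimately show ?thesis
        by (rule runs_mono)
    qed
    have "bound_inv l m (result ?init m)"
    proof -
      have "result ?init m = m(r_hi := 1, r_j := 0)"
        by simp
      moreover have "holds_input A \<Delta> n (m(r_hi := 1, r_j := 0))"
        using *(2) by (rule holds_input_cong) simp
      ultimately show ?thesis
        using *(3) unfolding bound_inv_def by (intro exI[of _ 0]) (simp add: mem_bounded_def)
    qed
    then have "runs (C1 * l) ?init m (bound_inv l m)"
      using * by (intro C1)
    from runs_Seq[OF this loop]
    have "runs (C1 * l + (3 * n * (C2 * l + C3 * l) + C3 * l)) bound_prog m ?Q"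
      unfolding bound_prog_def .
    moreover have "C1 * l + (3 * n * (C2 * l + C3 * l) + C3 * l) \<le> (C1 + 3 * (C2 + C3) + C3) * l * n"
    proof -
      have "C1 * l + (3 * n * (C2 * l + C3 * l) + C3 * l) \<le>
          C1 * l * n + (3 * n * (C2 * l + C3 * l) + C3 * l * n)"
        using n by (intro add_mono) simp_all
      also have "\<dots> = (C1 + 3 * (C2 + C3) + C3) * l * n"
        by (simp add: algebra_simps)
      finally show ?thesis .
    qed
    ultimately show "runs ((C1 + 3 * (C2 + C3) + C3) * l * n) bound_prog m ?Q"
      by (rule runs_mono)
  qed
qed

section \<open>Bisection on the numerator\<close>

definition bisect_prog :: program where
  "bisect_prog = Seq (Set r_s (Div (Add (Var r_lo) (Var r_hi)) (Const 2)))
     (Seq test_prog (Cond e_regular (Set r_lo (Var r_s)) (Set r_hi (Var r_s))))"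

text \<open>Counts the integers strictly between the two ends, so that the loop stops at consecutive
  numerators.\<close>

definition e_gap :: expr where
  "e_gap = Sub (Sub (Var r_hi) (Var r_lo)) (Const 1)"

definition scale_prog :: program where
  "scale_prog = Seq (Set r_hi (Mult (Var r_hi) (Var r_N))) (Set r_s (Var r_hi))"

definition output_prog :: program where
  "output_prog = seqs [Set 1 (Var r_hi), Set 2 (Var r_N), Set 0 (Const 1)]"

definition core_prog :: program where
  "core_prog = Seq bound_prog (Seq scale_prog (Seq test_prog
     (Cond e_regular (Set 0 (Const 0))
       (Seq (Set r_lo (Const (- 1))) (Seq (While e_gap bisect_prog) output_prog)))))"

context tridiagonal_input begin

text \<open>\<open>r_lo\<close> starts at the sentinel \<open>- 1\<close>, about which nothing is
  claimed; in this way a radius \<open>0\<close> needs no separate case.\<close>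

definition bisect_inv :: "int \<Rightarrow> nat \<Rightarrow> memory \<Rightarrow> bool" where
  "bisect_inv N l m \<longleftrightarrow> holds_input A \<Delta> n m \<and> m r_N = N \<and> mem_bounded m l \<and>
     - 1 \<le> m r_lo \<and> m r_lo < m r_hi \<and> m r_hi \<le> radius_bound * N \<and>
     singular_at (of_int (m r_hi) / of_int N) \<and> (0 \<le> m r_lo \<longrightarrow> \<not> singular_at (of_int (m r_lo) / of_int N))"

text \<open>By monotonicity, cell \<open>1\<close> holds the least numerator that is singular over
  \<open>N\<close>: the radius is rounded up to a multiple of \<open>1 / N\<close>.\<close>

definition correct_output :: "int \<Rightarrow> memory \<Rightarrow> bool" where
  "correct_output N m \<longleftrightarrow> (if \<exists>\<delta>\<ge>0. singular_at \<delta>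
     then m 0 = 1 \<and> m 2 = N \<and> 0 \<le> m 1 \<and> singular_at (of_int (m 1) / of_int N) \<and>
       (0 < m 1 \<longrightarrow> \<not> singular_at (of_int (m 1 - 1) / of_int N))
     else m 0 = 0)"

end

text \<open>Halving a positive gap removes a bit; the bit length of the gap is the termination
  measure of the bisection.\<close>

lemma floorlog_half_less:
  assumes "0 < (g :: int)" "g' \<le> g div 2"
  shows "floorlog 2 (nat g') < floorlog 2 (nat g)"
proof -
  have "floorlog 2 (nat g') \<le> floorlog 2 (nat g div 2)"
    using assms by (intro floorlog_mono) (simp add: nat_div_distrib[symmetric] nat_mono)
  also have "\<dots> < floorlog 2 (nat g)"
    using assms(1) by (subst (2) compute_floorlog) simp
  finally show ?thesis .
qed

text \<open>There are \<open>O(l)\<close> bisection steps, each with a test of time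
  \<open>O(l * n)\<close>. The size hypothesis at the largest numerator
  \<open>radius_bound * N\<close> covers all tests.\<close>

lemma core_prog_runs:
  obtains C where "\<And>A \<Delta> n N l m. tridiagonal_input A \<Delta> n \<Longrightarrow> holds_input A \<Delta> n m \<Longrightarrow> m r_N = N \<Longrightarrow> 0 < N \<Longrightarrow>
    mem_bounded m l \<Longrightarrow> tridiagonal_input.size_ok A \<Delta> n N (tridiagonal_input.radius_bound A \<Delta> n * N) l \<Longrightarrow>
    tridiagonal_input.radius_bound A \<Delta> n * N \<le> 2 ^ l \<Longrightarrow>
    runs (C * (l * l * n)) core_prog m (tridiagonal_input.correct_output A \<Delta> N)"
proof -
  let ?mid = "Set r_s (Div (Add (Var r_lo) (Var r_hi)) (Const 2))"
  let ?lo = "Set r_lo (Var r_s)" and ?hi = "Set r_hi (Var r_s)"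
  let ?inf = "Set 0 (Const 0)" and ?init = "Set r_lo (Const (- 1))"
  have lf: "loop_free ?mid" "loop_free ?lo" "loop_free ?hi" "loop_free ?inf" "loop_free ?init"
    "loop_free scale_prog" "loop_free output_prog"
    by (simp_all add: scale_prog_def output_prog_def)
  obtain D1 where D1: "\<And>m k Q. 1 \<le> k \<Longrightarrow> mem_bounded m k \<Longrightarrow> Q (result ?mid m) \<Longrightarrow> runs (D1 * k) ?mid m Q"
    using runs_loop_free[OF lf(1)] by blast
  obtain D2 where D2: "\<And>m k Q. 1 \<le> k \<Longrightarrow> mem_bounded m k \<Longrightarrow> Q (result ?lo m) \<Longrightarrow> runs (D2 * k) ?lo m Q"
    using runs_loop_free[OF lf(2)] by blast
  obtain D3 where D3: "\<And>m k Q. 1 \<le> k \<Longrightarrow> mem_bounded m k \<Longrightarrow> Q (result ?hi m) \<Longrightarrow> runs (D3 * k) ?hi m Q"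
    using runs_loop_free[OF lf(3)] by blast
  obtain D4 where D4: "\<And>m k Q. 1 \<le> k \<Longrightarrow> mem_bounded m k \<Longrightarrow> Q (result ?inf m) \<Longrightarrow> runs (D4 * k) ?inf m Q"
    using runs_loop_free[OF lf(4)] by blast
  obtain D5 where D5: "\<And>m k Q. 1 \<le> k \<Longrightarrow> mem_bounded m k \<Longrightarrow> Q (result ?init m) \<Longrightarrow> runs (D5 * k) ?init m Q"
    using runs_loop_free[OF lf(5)] by blast
  obtain D6 where D6: "\<And>m k Q. 1 \<le> k \<Longrightarrow> mem_bounded m k \<Longrightarrow> Q (result scale_prog m) \<Longrightarrow> runs (D6 * k) scale_prog m Q"
    using runs_loop_free[OF lf(6)] by blast
  obtain D7 where D7: "\<And>m k Q. 1 \<le> k \<Longrightarrow> mem_bounded m k \<Longrightarrow> Q (result output_prog m) \<Longrightarrow> runs (D7 * k) output_prog m Q"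
    using runs_loop_free[OF lf(7)] by blast
  obtain E1 where E1: "\<And>m k. 1 \<le> k \<Longrightarrow> mem_bounded m k \<Longrightarrow>
      expr_cost e_regular m + int_size (expr_val e_regular m) \<le> E1 * k"
    using expr_cost_bounded by blast
  obtain E2 where E2: "\<And>m k. 1 \<le> k \<Longrightarrow> mem_bounded m k \<Longrightarrow>
      expr_cost e_gap m + int_size (expr_val e_gap m) \<le> E2 * k"
    using expr_cost_bounded by blast
  obtain T where T: "\<And>A \<Delta> n N s l m. tridiagonal_input A \<Delta> n \<Longrightarrow> holds_input A \<Delta> n m \<Longrightarrow> m r_N = N \<Longrightarrow>
    m r_s = s \<Longrightarrow> mem_bounded m l \<Longrightarrow> tridiagonal_input.size_ok A \<Delta> n N s l \<Longrightarrow>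
    runs (T * l * n) test_prog m (\<lambda>m'. mem_bounded m' l \<and> (\<forall>a. a \<notin> test_regs \<longrightarrow> m' a = m a) \<and>
      (0 < expr_val e_regular m' \<longleftrightarrow> tridiagonal_input.regular_test A \<Delta> n N s))"
    using test_prog_runs by blast
  obtain F where F: "\<And>A \<Delta> n l m. tridiagonal_input A \<Delta> n \<Longrightarrow> holds_input A \<Delta> n m \<Longrightarrow> mem_bounded m l \<Longrightarrow>
    1 \<le> l \<Longrightarrow> tridiagonal_input.radius_bound A \<Delta> n \<le> 2 ^ l \<Longrightarrow> int (3 * n) \<le> 2 ^ l \<Longrightarrow>
    runs (F * l * n) bound_prog m (\<lambda>m'. mem_bounded m' l \<and> (\<forall>a. a \<notin> {r_j, r_hi} \<longrightarrow> m' a = m a) \<and>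
      m' r_hi = tridiagonal_input.radius_bound A \<Delta> n)"
    using bound_prog_runs by blast
  \<comment> \<open>The factor \<open>2\<close> stems from the at most \<open>2 * l\<close>
    bisection steps.\<close>
  define C where "C = F + D6 + T + E1 + D4 + D5 + 2 * (D1 + T + E1 + D2 + D3 + E2) + E2 + D7"
  show thesis
  proof (rule that[of C])
    fix A \<Delta> n N l m
    assume inp: "tridiagonal_input A \<Delta> n" and holds: "holds_input A \<Delta> n m" and mN: "m r_N = N" and N: "0 < N"
      and mem: "mem_bounded m l"
      and size: "tridiagonal_input.size_ok A \<Delta> n N (tridiagonal_input.radius_bound A \<Delta> n * N) l"
      and bound: "tridiagonal_input.radius_bound A \<Delta> n * N \<le> 2 ^ l"
    interpret tridiagonal_input A \<Delta> n
      by (fact inp)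
    let ?S = "radius_bound * N"
    let ?rest = "Cond e_regular ?inf (Seq ?init (Seq (While e_gap bisect_prog) output_prog))"
    have l: "1 \<le> l" "int (3 * n) \<le> 2 ^ l"
      using size by (auto simp: size_ok_def)
    have S: "radius_bound \<le> ?S" "0 < ?S"
      using radius_bound_ge_1 N by simp_all
    have size': "size_ok N s l" if "0 \<le> s" "s \<le> ?S" for s
      using size by (rule size_ok_mono) (use that S in simp)

    let ?progress = "\<lambda>m m'. bisect_inv N l m' \<and>
      floorlog 2 (nat (expr_val e_gap m')) < floorlog 2 (nat (expr_val e_gap m))"
    have bisect: "runs ((D1 + E1 + D2 + D3) * l + T * l * n) bisect_prog m1 (?progress m1)"
      if inv: "bisect_inv N l m1" and pos: "0 < expr_val e_gap m1" for m1
    proof -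
      define s where "s = (m1 r_lo + m1 r_hi) div 2"
      have m1: "holds_input A \<Delta> n m1" "m1 r_N = N" "mem_bounded m1 l" "- 1 \<le> m1 r_lo" "m1 r_hi \<le> ?S"
        "singular_at (of_int (m1 r_hi) / of_int N)"
        "0 \<le> m1 r_lo \<Longrightarrow> \<not> singular_at (of_int (m1 r_lo) / of_int N)"
        using inv by (auto simp: bisect_inv_def)
      have gap: "expr_val e_gap m1 = m1 r_hi - m1 r_lo - 1"
        by (simp add: e_gap_def)
      have s: "m1 r_lo < s" "s < m1 r_hi"
        using pos unfolding gap s_def by presburger+
      have s0: "0 \<le> s" "s \<le> ?S"
        using s m1(4,5) by linarith+
      let ?m = "m1(r_s := s)"
      have mid: "result ?mid m1 = ?m"
        by (simp add: s_def)
      have "\<bar>s\<bar> \<le> 2 ^ l"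
        using s0 bound by simp
      then have mem': "mem_bounded ?m l"
        using m1(3) by (simp add: mem_bounded_def)
      have "holds_input A \<Delta> n ?m"
        using m1(1) by (rule holds_input_cong) simp
      then have test: "runs (T * l * n) test_prog ?m (\<lambda>m'. mem_bounded m' l \<and> (\<forall>a. a \<notin> test_regs \<longrightarrow> m' a = ?m a) \<and>
          (0 < expr_val e_regular m' \<longleftrightarrow> regular_test N s))"
        using m1(2) mem' size'[OF s0] inp by (intro T) auto
      have branch: "runs (E1 * l + (D2 + D3) * l) (Cond e_regular ?lo ?hi) m2 (?progress m1)"
        if m2: "mem_bounded m2 l \<and> (\<forall>a. a \<notin> test_regs \<longrightarrow> m2 a = ?m a) \<and>
          (0 < expr_val e_regular m2 \<longleftrightarrow> regular_test N s)" for m2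
      proof -
        have fr: "m2 r_s = s" "m2 r_lo = m1 r_lo" "m2 r_hi = m1 r_hi" "m2 r_N = N"
          using m2 m1(2) by (simp_all add: test_regs_def scratch_def)
        have "holds_input A \<Delta> n m2"
          using m1(1) by (rule holds_input_cong) (use m2 in \<open>auto simp: test_regs_def scratch_def\<close>)
        then have h: "holds_input A \<Delta> n (m2(r_lo := s))" "holds_input A \<Delta> n (m2(r_hi := s))"
          by (rule holds_input_cong; simp)+
        have mb: "mem_bounded (m2(r_lo := s)) l" "mem_bounded (m2(r_hi := s)) l"
          using m2 \<open>\<bar>s\<bar> \<le> 2 ^ l\<close> by (simp_all add: mem_bounded_def)
        show ?thesis
        proof (rule runs_Cond)
          show "expr_cost e_regular m2 + int_size (expr_val e_regular m2) \<le> E1 * l"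
            using l(1) m2 by (intro E1) auto
        next
          assume "0 < expr_val e_regular m2"
          then have "\<not> singular_at (of_int s / of_int N)"
            using m2 regular_test_iff[OF N s0(1)] by simp
          then have "bisect_inv N l (m2(r_lo := s))"
            using h mb fr s m1 s0 by (simp add: bisect_inv_def)
          \<comment> \<open>Rounding of the midpoint does no harm, because the gap counts only
            integers strictly between the ends.\<close>
          moreover have "m1 r_hi - s - 1 \<le> (m1 r_hi - m1 r_lo - 1) div 2"
            unfolding s_def by presburger
          then have "floorlog 2 (nat (expr_val e_gap (m2(r_lo := s)))) < floorlog 2 (nat (expr_val e_gap m1))"
            using pos fr unfolding gap by (intro floorlog_half_less) (simp_all add: e_gap_def)
          ultimately have "runs (D2 * l) ?lo m2 (?progress m1)"
            using l(1) m2 fr(1) by (intro D2) auto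
          then show "runs ((D2 + D3) * l) ?lo m2 (?progress m1)"
            by (rule runs_mono) (auto simp: add_mult_distrib)
        next
          assume "\<not> 0 < expr_val e_regular m2"
          then have "singular_at (of_int s / of_int N)"
            using m2 regular_test_iff[OF N s0(1)] by simp
          then have "bisect_inv N l (m2(r_hi := s))"
            using h mb fr s m1 s0 by (simp add: bisect_inv_def)
          moreover have "s - m1 r_lo - 1 \<le> (m1 r_hi - m1 r_lo - 1) div 2"
            unfolding s_def by presburger
          then have "floorlog 2 (nat (expr_val e_gap (m2(r_hi := s)))) < floorlog 2 (nat (expr_val e_gap m1))"
            using pos fr unfolding gap by (intro floorlog_half_less) (simp_all add: e_gap_def)
          ultimately have "runs (D3 * l) ?hi m2 (?progress m1)"
            using l(1) m2 fr(1) by (intro D3) auto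
          then show "runs ((D2 + D3) * l) ?hi m2 (?progress m1)"
            by (rule runs_mono) (auto simp: add_mult_distrib)
        qed
      qed
      have "runs (D1 * l) ?mid m1 (\<lambda>m'. m' = ?m)"
        using l(1) m1(3) mid by (intro D1) auto
      then have "runs (D1 * l + (T * l * n + (E1 * l + (D2 + D3) * l))) bisect_prog m1 (?progress m1)"
        unfolding bisect_prog_def by (rule runs_Seq) (use runs_Seq[OF test branch] in blast)
      then show ?thesis
        by (rule runs_mono) (auto simp: add_mult_distrib)
    qed

    \<comment> \<open>The gap is at most \<open>2 ^ l\<close>, so that its bit length is at most
      \<open>l + 1\<close>, hence at most \<open>2 * l\<close>.\<close>
    define W where "W = 2 * l * (((D1 + E1 + D2 + D3) * l + T * l * n) + E2 * l) + E2 * l"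
    have loop: "runs W (While e_gap bisect_prog) m1 (\<lambda>m'. bisect_inv N l m' \<and> \<not> 0 < expr_val e_gap m')"
      if inv: "bisect_inv N l m1" for m1
    proof -
      have "runs (floorlog 2 (nat (expr_val e_gap m1)) * (((D1 + E1 + D2 + D3) * l + T * l * n) + E2 * l) + E2 * l)
          (While e_gap bisect_prog) m1 (\<lambda>m'. bisect_inv N l m' \<and> \<not> 0 < expr_val e_gap m')"
      proof (rule runs_While[where I = "bisect_inv N l" and \<mu> = "\<lambda>m. floorlog 2 (nat (expr_val e_gap m))"])
        show "expr_cost e_gap m2 + int_size (expr_val e_gap m2) \<le> E2 * l" if "bisect_inv N l m2" for m2
          using l(1) that by (intro E2) (auto simp: bisect_inv_def)
      qed (fact bisect, fact inv)
      moreover have "floorlog 2 (nat (expr_val e_gap m1)) \<le> 2 * l"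
      proof -
        have "expr_val e_gap m1 \<le> 2 ^ l"
          using inv bound by (simp add: bisect_inv_def e_gap_def)
        then have "nat (expr_val e_gap m1) \<le> 2 ^ l"
          by (simp add: nat_le_iff)
        also have "(2::nat) ^ l < 2 ^ (l + 1)"
          by simp
        finally have "floorlog 2 (nat (expr_val e_gap m1)) \<le> l + 1"
          by (intro floorlog_leI) auto
        then show ?thesis using l(1) by simp
      qed
      then have "floorlog 2 (nat (expr_val e_gap m1)) * (((D1 + E1 + D2 + D3) * l + T * l * n) + E2 * l) + E2 * l \<le> W"
        unfolding W_def by (intro add_mono mult_right_mono) auto
      ultimately show ?thesis
        by (rule runs_mono)
    qed

    have out: "runs (D7 * l) output_prog m2 (correct_output N)"
      if "bisect_inv N l m2 \<and> \<not> 0 < expr_val e_gap m2" for m2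
    proof -
      have m2: "m2 r_N = N" "mem_bounded m2 l" "- 1 \<le> m2 r_lo" "m2 r_lo < m2 r_hi"
        "singular_at (of_int (m2 r_hi) / of_int N)"
        "0 \<le> m2 r_lo \<Longrightarrow> \<not> singular_at (of_int (m2 r_lo) / of_int N)"
        using that by (auto simp: bisect_inv_def)
      have lo: "m2 r_lo = m2 r_hi - 1"
        using that m2(4) by (simp add: e_gap_def)
      have "0 \<le> real_of_int (m2 r_hi) / of_int N"
        using m2(3,4) N by simp
      then have "\<exists>\<delta>\<ge>0. singular_at \<delta>"
        using m2(5) by blast
      moreover have "result output_prog m2 = m2(1 := m2 r_hi, 2 := N, 0 := 1)"
        by (simp add: output_prog_def m2(1))
      ultimately have "correct_output N (result output_prog m2)"
        using m2 lo by (simp add: correct_output_def)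
      then show ?thesis
        using l(1) m2(2) by (intro D7)
    qed

    have finish: "runs (E1 * l + (D4 * l + (D5 * l + (W + D7 * l))))
        (?rest) m2 (correct_output N)"
      if m2: "mem_bounded m2 l \<and> (\<forall>a. a \<notin> test_regs \<longrightarrow> m2 a = m1 a) \<and>
        (0 < expr_val e_regular m2 \<longleftrightarrow> regular_test N ?S)"
        and m1: "holds_input A \<Delta> n m1" "m1 r_N = N" "m1 r_hi = ?S" for m1 m2
    proof (rule runs_Cond)
      \<comment> \<open>The first test, with numerator \<open>?S\<close>, is made exactly at the
        radius \<open>radius_bound\<close> and so decides finiteness.\<close>
      have S_sing: "singular_at (of_int ?S / of_int N) \<longleftrightarrow> (\<exists>\<delta>\<ge>0. singular_at \<delta>)"
      proof -
        have "0 \<le> real_of_int radius_bound"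
          using radius_bound_ge_1 by simp
        moreover have "real_of_int ?S / of_int N = of_int radius_bound"
          using N by simp
        ultimately show ?thesis
          using singular_at_radius_bound by metis
      qed
      show "expr_cost e_regular m2 + int_size (expr_val e_regular m2) \<le> E1 * l"
        using l(1) m2 by (intro E1) auto
      {
        assume "0 < expr_val e_regular m2"
        then have "\<not> (\<exists>\<delta>\<ge>0. singular_at \<delta>)"
          using m2 regular_test_iff[OF N, of ?S] S(2) S_sing by simp
        then have "correct_output N (result ?inf m2)"
          unfolding correct_output_def by simp
        then have "runs (D4 * l) ?inf m2 (correct_output N)"
          using l(1) m2 by (intro D4) auto
        then show "runs (D4 * l + (D5 * l + (W + D7 * l))) ?inf m2 (correct_output N)"
          by (rule runs_mono) auto
      }
      {
        assume "\<not> 0 < expr_val e_regular m2"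
        then have sing: "singular_at (of_int ?S / of_int N)"
          using m2 regular_test_iff[OF N, of ?S] S(2) by simp
        have "holds_input A \<Delta> n (m2(r_lo := - 1))"
          using m1(1) by (rule holds_input_cong) (use m2 in \<open>auto simp: test_regs_def scratch_def\<close>)
        moreover have "mem_bounded (m2(r_lo := - 1)) l"
          using m2 by (simp add: mem_bounded_def)
        moreover have "m2 r_N = N" "m2 r_hi = ?S"
          using m1 m2 by (simp_all add: test_regs_def scratch_def)
        ultimately have "bisect_inv N l (result ?init m2)"
          using sing S(2) by (simp add: bisect_inv_def)
        then have "runs (D5 * l) ?init m2 (bisect_inv N l)"
          using l(1) m2 by (intro D5) auto
        then have "runs (D5 * l + (W + D7 * l)) (Seq ?init (Seq (While e_gap bisect_prog) output_prog)) m2 (correct_output N)"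
          by (rule runs_Seq) (use runs_Seq[OF loop out] in blast)
        then show "runs (D4 * l + (D5 * l + (W + D7 * l))) (Seq ?init (Seq (While e_gap bisect_prog) output_prog)) m2 (correct_output N)"
          by (rule runs_mono) auto
      }
    qed

    define R where "R = E1 * l + (D4 * l + (D5 * l + (W + D7 * l)))"
    have after_bound: "runs (D6 * l + (T * l * n + R)) (Seq scale_prog (Seq test_prog
       (?rest))) m1 (correct_output N)"
      if m1: "mem_bounded m1 l \<and> (\<forall>a. a \<notin> {r_j, r_hi} \<longrightarrow> m1 a = m a) \<and> m1 r_hi = radius_bound" for m1
    proof -
      let ?m = "m1(r_hi := ?S, r_s := ?S)"
      have m': "result scale_prog m1 = ?m"
        using m1 mN by (simp add: scale_prog_def)
      have hold: "holds_input A \<Delta> n ?m"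
        using holds by (rule holds_input_cong) (use m1 in auto)
      have memb: "mem_bounded ?m l"
        using m1 bound S(2) by (simp add: mem_bounded_def)
      have N': "?m r_N = N"
        using m1 mN by simp
      have test: "runs (T * l * n) test_prog ?m (\<lambda>m'. mem_bounded m' l \<and> (\<forall>a. a \<notin> test_regs \<longrightarrow> m' a = ?m a) \<and>
          (0 < expr_val e_regular m' \<longleftrightarrow> regular_test N ?S))"
        using inp hold N' memb size by (intro T) auto
      have "runs (D6 * l) scale_prog m1 (\<lambda>m'. m' = ?m)"
        using l(1) m1 m' by (intro D6) auto
      moreover have "runs (T * l * n + R) (Seq test_prog
          (?rest)) ?m (correct_output N)"
        unfolding R_def by (rule runs_Seq[OF test finish[OF _ hold N']]) simp_all
      ultimately show ?thesis
        by (elim runs_Seq) blast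
    qed
    have "radius_bound \<le> 2 ^ l"
      using S(1) bound by linarith
    from runs_Seq[OF F[OF inp holds mem l(1) this l(2)] after_bound]
    have "runs (F * l * n + (D6 * l + (T * l * n + R))) core_prog m (correct_output N)"
      unfolding core_prog_def .
    moreover have "F * l * n + (D6 * l + (T * l * n + R)) \<le> C * (l * l * n)"
    proof -
      have 1: "l * 1 \<le> l * (l * n)"
        using l(1) n by (intro mult_left_mono) auto
      then have 1: "x * l \<le> x * (l * l * n)" for x
        by (intro mult_left_mono) (auto simp: mult.assoc)
      have 2: "x * l * n \<le> x * (l * l * n)" for x
        using l(1) by (simp add: mult.assoc)
      have "l * l * 1 \<le> l * l * n"
        using n by (intro mult_left_mono) auto
      then have 3: "x * (l * l) \<le> x * (l * l * n)" for x
        by (intro mult_left_mono) auto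
      have "W = (2 * (D1 + E1 + D2 + D3 + E2)) * (l * l) + 2 * T * (l * l * n) + E2 * l"
        by (simp add: W_def algebra_simps)
      also have "\<dots> \<le> (2 * (D1 + E1 + D2 + D3 + E2)) * (l * l * n) + 2 * T * (l * l * n) + E2 * (l * l * n)"
        by (intro add_mono order_refl 3 1)
      also have "\<dots> = (2 * (D1 + T + E1 + D2 + D3 + E2) + E2) * (l * l * n)"
        by (simp add: add_mult_distrib add_mult_distrib2)
      finally have "W \<le> (2 * (D1 + T + E1 + D2 + D3 + E2) + E2) * (l * l * n)" .
      then show ?thesis
        using 2[of F] 1[of D6] 2[of T] 1[of E1] 1[of D4] 1[of D5] 1[of D7]
        unfolding R_def C_def add_mult_distrib by linarith
    qed
    ultimately show "runs (C * (l * l * n)) core_prog m (correct_output N)"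
      by (rule runs_mono)
  qed
qed

section \<open>The input\<close>

lemma length_concat_uniform:
  "\<forall>xs\<in>set xss. length xs = L \<Longrightarrow> length (concat xss) = length xss * L"
  by (induction xss) auto

lemma nth_concat_uniform:
  "\<forall>xs\<in>set xss. length xs = L \<Longrightarrow> i < length xss \<Longrightarrow> j < L \<Longrightarrow> concat xss ! (i * L + j) = xss ! i ! j"
proof (induction xss arbitrary: i)
  case (Cons xs xss)
  then show ?case
    by (cases i) (auto simp: nth_append)
qed simp

text \<open>Rows have length \<open>n\<close> and codes of rationals have length \<open>2\<close>;
  \<open>nth_concat_uniform\<close> is applied once for each level of nesting.\<close>

lemma mat_code_nth:
  assumes "A \<in> carrier_mat n n"
  shows "length (mat_code A) = 2 * (n * n)"
    and "i < n \<Longrightarrow> j < n \<Longrightarrow> mat_code A ! (2 * (i * n + j)) = num (A $$ (i, j))"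
    and "i < n \<Longrightarrow> j < n \<Longrightarrow> mat_code A ! (2 * (i * n + j) + 1) = den (A $$ (i, j))"
proof -
  define rows where "rows = map (\<lambda>i. map (\<lambda>j. rat_code (A $$ (i, j))) [0..<n]) [0..<n]"
  have code: "mat_code A = concat (concat rows)"
    using assms by (simp add: mat_code_def rows_def)
  have rows: "\<forall>xs\<in>set rows. length xs = n" "length rows = n"
    by (auto simp: rows_def)
  have len: "length (concat rows) = n * n"
    using length_concat_uniform[OF rows(1)] rows(2) by simp
  have two: "\<forall>xs\<in>set (concat rows). length xs = 2"
    by (auto simp: rows_def rat_code_def)
  show "length (mat_code A) = 2 * (n * n)"
    unfolding code using length_concat_uniform[OF two] len by simp
  assume ij: "i < n" "j < n"
  have lt: "i * n + j < n * n"
  proof -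
    have "i * n + j < (i + 1) * n"
      using ij by simp
    also have "\<dots> \<le> n * n"
      using ij by (intro mult_right_mono) auto
    finally show ?thesis .
  qed
  have "concat rows ! (i * n + j) = rat_code (A $$ (i, j))"
    using nth_concat_uniform[OF rows(1), of i j] rows(2) ij by (simp add: rows_def)
  then show "mat_code A ! (2 * (i * n + j)) = num (A $$ (i, j))"
    "mat_code A ! (2 * (i * n + j) + 1) = den (A $$ (i, j))"
    using nth_concat_uniform[OF two, of "i * n + j" 0] nth_concat_uniform[OF two, of "i * n + j" 1] lt len
    unfolding code by (simp_all add: rat_code_def num_def den_def mult.commute)
qed

lemma rat_size_le_mat_size:
  assumes "A \<in> carrier_mat n n" "i < n" "j < n"
  shows "rat_size (A $$ (i, j)) \<le> mat_size A"
proof -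
  have "rat_size (A $$ (i, j)) \<le> (\<Sum>j<dim_col A. rat_size (A $$ (i, j)))"
    using assms by (intro member_le_sum) auto
  also have "\<dots> \<le> mat_size A"
    unfolding mat_size_def using assms
    by (intro member_le_sum[of i _ "\<lambda>i. \<Sum>j<dim_col A. rat_size (A $$ (i, j))"]) auto
  finally show ?thesis .
qed

lemma abs_num_den_le:
  "\<bar>num q\<bar> \<le> 2 ^ rat_size q" "\<bar>den q\<bar> \<le> 2 ^ rat_size q"
proof -
  have "\<bar>x\<bar> \<le> 2 ^ b" if "int_size x \<le> b" for x b
    using abs_less_power_int_size[of x] power_increasing[OF that, of "2 :: int"] by linarith
  then show "\<bar>num q\<bar> \<le> 2 ^ rat_size q" "\<bar>den q\<bar> \<le> 2 ^ rat_size q"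
    by (simp_all add: rat_size_def num_def den_def)
qed

lemma abs_entry_le:
  assumes "A \<in> carrier_mat n n" "i < n" "j < n" "mat_size A \<le> M"
  shows "\<bar>num (A $$ (i, j))\<bar> \<le> 2 ^ M" "\<bar>den (A $$ (i, j))\<bar> \<le> 2 ^ M"
proof -
  have "(2::int) ^ rat_size (A $$ (i, j)) \<le> 2 ^ M"
    using rat_size_le_mat_size[OF assms(1-3)] assms(4) by (intro power_increasing) auto
  then show "\<bar>num (A $$ (i, j))\<bar> \<le> 2 ^ M" "\<bar>den (A $$ (i, j))\<bar> \<le> 2 ^ M"
    using abs_num_den_le[of "A $$ (i, j)"] by linarith+
qed

lemma abs_mat_code_le:
  assumes "A \<in> carrier_mat n n" "mat_size A \<le> M" "x \<in> set (mat_code A)"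
  shows "\<bar>x\<bar> \<le> 2 ^ M"
proof -
  obtain i j where "i < n" "j < n" "x = num (A $$ (i, j)) \<or> x = den (A $$ (i, j))"
    using assms(1,3) by (auto simp: mat_code_def rat_code_def num_def den_def)
  then show ?thesis
    using abs_entry_le[OF assms(1) _ _ assms(2)] by blast
qed

text \<open>Even a zero entry takes at least one bit, so that the dimension is polynomially
  harmless.\<close>

lemma dim_le_mat_size:
  assumes "A \<in> carrier_mat n n"
  shows "n \<le> mat_size A"
proof -
  have "1 \<le> rat_size q" for q
    by (simp add: rat_size_def int_size_def)
  then have "(\<Sum>i<n. \<Sum>j<n. 1) \<le> (\<Sum>i<n. \<Sum>j<n. rat_size (A $$ (i, j)))"
    by (intro sum_mono)
  also have "\<dots> = mat_size A"
    using assms by (simp add: mat_size_def)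
  finally have "n * n \<le> mat_size A"
    by simp
  moreover have "n \<le> n * n"
    by (cases n) auto
  ultimately show ?thesis by linarith
qed

text \<open>\<open>\<epsilon>\<close> is stored behind the dimension and \<open>2 * n * n\<close>
  cells for each matrix, which explains the two addresses.\<close>

definition prepared_memory :: "rat mat \<Rightarrow> rat mat \<Rightarrow> nat \<Rightarrow> rat \<Rightarrow> int \<Rightarrow> memory" where
  "prepared_memory A \<Delta> n \<epsilon> N =
     (initial_memory (input_code A \<Delta> \<epsilon>))
       (r_N := N, 1 + 4 * (int n * int n) := 0, 2 + 4 * (int n * int n) := 0)"

lemma initial_memory_input:
  fixes \<epsilon> :: rat
  assumes A: "A \<in> carrier_mat n n" and \<Delta>: "\<Delta> \<in> carrier_mat n n"
  defines "m \<equiv> initial_memory (input_code A \<Delta> \<epsilon>)"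
  shows "holds_input A \<Delta> n m" "m (1 + 4 * (int n * int n)) = num \<epsilon>" "m (2 + 4 * (int n * int n)) = den \<epsilon>"
    "\<And>M a. mat_size A \<le> M \<Longrightarrow> mat_size \<Delta> \<le> M \<Longrightarrow> a \<noteq> 1 + 4 * (int n * int n) \<Longrightarrow> a \<noteq> 2 + 4 * (int n * int n) \<Longrightarrow>
      \<bar>m a\<bar> \<le> 2 ^ M"
proof -
  note cA = mat_code_nth[OF A] and cD = mat_code_nth[OF \<Delta>]
  let ?xs = "input_code A \<Delta> \<epsilon>"
  have len: "length ?xs = 3 + 4 * (n * n)"
    using A cA(1) cD(1) by (simp add: input_code_def rat_code_def)
  have m: "m (int k) = ?xs ! k" if "k < 3 + 4 * (n * n)" for k
  proof -
    have "int k < int (length ?xs)"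
      unfolding len using that by (simp only: of_nat_less_iff)
    then show ?thesis
      by (simp add: m_def initial_memory_def)
  qed
  have xs0: "?xs ! 0 = int n"
    using A by (simp add: input_code_def)
  have xsA: "?xs ! (1 + k) = mat_code A ! k" if "k < 2 * (n * n)" for k
    using that cA(1) by (simp add: input_code_def nth_append)
  have xsD: "?xs ! (1 + (2 * (n * n) + k)) = mat_code \<Delta> ! k" if "k < 2 * (n * n)" for k
    using that cA(1) cD(1) by (simp add: input_code_def nth_append)
  have xse: "?xs ! (1 + (4 * (n * n) + k)) = rat_code \<epsilon> ! k" for k
    using cA(1) cD(1) by (simp add: input_code_def nth_append)
  have lt: "2 * (i * n + j) + 1 < 2 * (n * n)" if "i < n" "j < n" for i j
  proof -
    have "i * n + j + 1 \<le> (i + 1) * n"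
      using that by simp
    also have "\<dots> \<le> n * n"
      using that by (intro mult_right_mono) auto
    finally show ?thesis by simp
  qed
  show "holds_input A \<Delta> n m"
    unfolding holds_input_def
  proof (intro conjI allI impI)
    show "m 0 = int n"
      using m[of 0] xs0 by simp
    fix i j
    assume ij: "i < n" "j < n"
    note lt = lt[OF ij]
    show "m (1 + 2 * (int i * int n + int j)) = num (A $$ (i, j))"
      using m[of "1 + 2 * (i * n + j)"] xsA[of "2 * (i * n + j)"] cA(2)[OF ij] lt by simp
    show "m (2 + 2 * (int i * int n + int j)) = den (A $$ (i, j))"
      using m[of "1 + (2 * (i * n + j) + 1)"] xsA[of "2 * (i * n + j) + 1"] cA(3)[OF ij] lt by simp
    show "m (1 + (2 * (int n * int n) + 2 * (int i * int n + int j))) = num (\<Delta> $$ (i, j))"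
      using m[of "1 + (2 * (n * n) + 2 * (i * n + j))"] xsD[of "2 * (i * n + j)"] cD(2)[OF ij] lt by simp
    show "m (2 + (2 * (int n * int n) + 2 * (int i * int n + int j))) = den (\<Delta> $$ (i, j))"
      using m[of "1 + (2 * (n * n) + (2 * (i * n + j) + 1))"] xsD[of "2 * (i * n + j) + 1"] cD(3)[OF ij] lt
      by (simp add: add.assoc)
  qed
  show "m (1 + 4 * (int n * int n)) = num \<epsilon>"
    using m[of "1 + (4 * (n * n) + 0)"] xse[of 0] by (simp add: rat_code_def num_def)
  show "m (2 + 4 * (int n * int n)) = den \<epsilon>"
    using m[of "1 + (4 * (n * n) + 1)"] xse[of 1] by (simp add: rat_code_def den_def)
  fix M a
  assume M: "mat_size A \<le> M" "mat_size \<Delta> \<le> M"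
    and a: "a \<noteq> 1 + 4 * (int n * int n)" "a \<noteq> 2 + 4 * (int n * int n)"
  show "\<bar>m a\<bar> \<le> 2 ^ M"
  proof (cases "0 \<le> a \<and> a < int (3 + 4 * (n * n))")
    case False
    then show ?thesis
      unfolding m_def initial_memory_def len by (simp only: if_False abs_zero) simp
  next
    case True
    then obtain k where k: "a = int k" "k < 3 + 4 * (n * n)"
      by (metis nonneg_int_cases of_nat_less_iff)
    have "k < 1 + 4 * (n * n)"
    proof -
      have "k \<noteq> 1 + 4 * (n * n)" "k \<noteq> 2 + 4 * (n * n)"
        using a k(1) by auto
      then show ?thesis using k(2) by linarith
    qed
    then consider "k = 0" | i where "k = 1 + i" "i < 2 * (n * n)"
      | i where "k = 1 + (2 * (n * n) + i)" "i < 2 * (n * n)"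
    proof (atomize_elim, goal_cases)
      case 1
      show ?case
      proof (cases "k \<le> 2 * (n * n)")
        case True
        then show ?thesis
          by (cases k) auto
      next
        case False
        then have "k = 1 + (2 * (n * n) + (k - 1 - 2 * (n * n)))" "k - 1 - 2 * (n * n) < 2 * (n * n)"
          using 1 by linarith+
        then show ?thesis by blast
      qed
    qed
    then show ?thesis
    proof cases
      case 1
      have "n \<le> M"
        using dim_le_mat_size[OF A] M(1) by simp
      also have "M < 2 ^ M"
        by (rule less_exp)
      finally have "int n \<le> 2 ^ M"
        by (metis less_imp_le of_nat_le_iff of_nat_numeral of_nat_power)
      then show ?thesis
        using 1 m[of 0] xs0 k(1) by simp
    next
      case (2 i)
      then have "m a = mat_code A ! i"
        using m[OF k(2)] k(1) xsA by simp
      moreover have "mat_code A ! i \<in> set (mat_code A)"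
        using 2 cA(1) by simp
      ultimately show ?thesis
        using abs_mat_code_le[OF A M(1)] by simp
    next
      case (3 i)
      then have "m a = mat_code \<Delta> ! i"
        using m[OF k(2)] k(1) xsD by simp
      moreover have "mat_code \<Delta> ! i \<in> set (mat_code \<Delta>)"
        using 3 cD(1) by simp
      ultimately show ?thesis
        using abs_mat_code_le[OF \<Delta> M(2)] by simp
    qed
  qed
qed

lemma prepared_memory:
  assumes A: "A \<in> carrier_mat n n" and \<Delta>: "\<Delta> \<in> carrier_mat n n"
    and l: "mat_size A \<le> l" "mat_size \<Delta> \<le> l" "\<bar>N\<bar> \<le> 2 ^ l"
  shows "holds_input A \<Delta> n (prepared_memory A \<Delta> n \<epsilon> N)" "prepared_memory A \<Delta> n \<epsilon> N r_N = N"
    "mem_bounded (prepared_memory A \<Delta> n \<epsilon> N) l"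
proof -
  let ?init = "initial_memory (input_code A \<Delta> \<epsilon>)" and ?m = "prepared_memory A \<Delta> n \<epsilon> N"
  have nn: "0 \<le> int n * int n"
    by simp
  show "?m r_N = N"
  proof -
    have "1 + 4 * (int n * int n) \<noteq> r_N" "2 + 4 * (int n * int n) \<noteq> r_N"
      using nn by linarith+
    then show ?thesis
      unfolding prepared_memory_def fun_upd_apply by metis
  qed
  show "mem_bounded ?m l"
    unfolding mem_bounded_def prepared_memory_def
    using initial_memory_input(4)[OF A \<Delta> l(1,2)] l(3) by simp
  have eq: "?m a = ?init a" if "0 \<le> a" "a < 1 + 4 * (int n * int n)" for a
    using that unfolding prepared_memory_def by simp
  have lt: "2 * (int n * int n) + 2 * (int i * int n + int j) + 2 < 1 + 4 * (int n * int n)"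
    if "i < n" "j < n" for i j
  proof -
    have "i * n + j + 1 \<le> (i + 1) * n"
      using that by simp
    also have "\<dots> \<le> n * n"
      using that by (intro mult_right_mono) auto
    finally have "int i * int n + int j + 1 \<le> int n * int n"
      by (metis of_nat_1 of_nat_add of_nat_le_iff of_nat_mult)
    moreover have "k + 1 \<le> q \<Longrightarrow> 2 * q + 2 * k + 2 < 1 + 4 * q" for k q :: int
      by linarith
    ultimately show ?thesis by blast
  qed
  show "holds_input A \<Delta> n ?m"
    unfolding holds_input_def
  proof (intro conjI allI impI)
    show "?m 0 = int n"
    proof -
      have "?m 0 = ?init 0"
        using nn by (intro eq) linarith+
      also have "?init 0 = int n"
        using initial_memory_input(1)[OF A \<Delta>, of \<epsilon>] unfolding holds_input_def by (rule conjunct1)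
      finally show ?thesis .
    qed
    fix i j
    assume ij: "i < n" "j < n"
    define p where "p = int i * int n + int j"
    define q where "q = int n * int n"
    have "0 \<le> p" "0 \<le> q" "2 * q + 2 * p + 2 < 1 + 4 * q"
      using lt[OF ij] by (simp_all add: p_def q_def)
    then have "?m (1 + 2 * p) = ?init (1 + 2 * p)" "?m (2 + 2 * p) = ?init (2 + 2 * p)"
      "?m (1 + (2 * q + 2 * p)) = ?init (1 + (2 * q + 2 * p))"
      "?m (2 + (2 * q + 2 * p)) = ?init (2 + (2 * q + 2 * p))"
      by (intro eq[folded q_def]; linarith)+
    then show "?m (1 + 2 * (int i * int n + int j)) = num (A $$ (i, j))"
      "?m (2 + 2 * (int i * int n + int j)) = den (A $$ (i, j))"
      "?m (1 + (2 * (int n * int n) + 2 * (int i * int n + int j))) = num (\<Delta> $$ (i, j))"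
      "?m (2 + (2 * (int n * int n) + 2 * (int i * int n + int j))) = den (\<Delta> $$ (i, j))"
      using initial_memory_input(1)[OF A \<Delta>, of \<epsilon>] ij unfolding p_def q_def by (simp_all only: holds_input_def)
  qed
qed

definition e_eps :: expr where
  "e_eps = Add (Const 1) (Mult (Const 4) (Mult (Var 0) (Var 0)))"

definition precision_prog :: program where
  "precision_prog = Seq
     (Set r_N (Add (Div (Load (Add e_eps (Const 1))) (Load e_eps)) (Const 1)))
     (Seq (Store e_eps (Const 0)) (Store (Add e_eps (Const 1)) (Const 0)))"

text \<open>
  Only the first instruction touches \<open>\<epsilon>\<close>, whose size need not be bounded by \<open>l\<close>; the cells of
  \<open>\<epsilon>\<close> are cleared, so that the rest of the program runs in a memory of small numbers.
\<close>

lemma precision_prog_runs: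
  obtains C where "\<And>A \<Delta> n \<epsilon> N l. A \<in> carrier_mat n n \<Longrightarrow> \<Delta> \<in> carrier_mat n n \<Longrightarrow> 1 \<le> l \<Longrightarrow> mat_size A \<le> l \<Longrightarrow>
    N = den \<epsilon> div num \<epsilon> + 1 \<Longrightarrow> 0 \<le> den \<epsilon> div num \<epsilon> \<Longrightarrow> N \<le> 2 ^ l \<Longrightarrow>
    runs (C * l + 2 * rat_size \<epsilon>) precision_prog (initial_memory (input_code A \<Delta> \<epsilon>))
      (\<lambda>m'. m' = prepared_memory A \<Delta> n \<epsilon> N)"
proof -
  let ?e = "Add e_eps (Const 1)"
  obtain C1 where C1: "\<And>m k. 1 \<le> k \<Longrightarrow> mem_bounded m k \<Longrightarrow> expr_cost e_eps m + int_size (expr_val e_eps m) \<le> C1 * k"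
    using expr_cost_bounded by blast
  obtain C2 where C2: "\<And>m k. 1 \<le> k \<Longrightarrow> mem_bounded m k \<Longrightarrow> expr_cost ?e m + int_size (expr_val ?e m) \<le> C2 * k"
    using expr_cost_bounded by blast
  define c where "c = 2 * int_size r_N + 2 * int_size 1 + 6"
  define C where "C = (C1 + C2 + c) + (C1 + 2 * int_size 0) + (C2 + 2 * int_size 0)"
  show thesis
  proof (rule that[of C])
    fix A \<Delta> :: "rat mat" and n \<epsilon> N and l :: nat
    assume A: "A \<in> carrier_mat n n" and \<Delta>: "\<Delta> \<in> carrier_mat n n" and l: "1 \<le> l" "mat_size A \<le> l"
      and N: "N = den \<epsilon> div num \<epsilon> + 1" "0 \<le> den \<epsilon> div num \<epsilon>" "N \<le> 2 ^ l"
    let ?a = "1 + 4 * (int n * int n)"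
    define m0 where "m0 = initial_memory (input_code A \<Delta> \<epsilon>)"
    define m1 where "m1 = m0(r_N := N)"
    define m2 where "m2 = m1(?a := 0)"
    have a0: "?a \<noteq> 0"
      using zero_le_square[of "int n"] by linarith
    have m0: "m0 0 = int n" "m0 ?a = num \<epsilon>" "m0 (?a + 1) = den \<epsilon>"
      using initial_memory_input(1-3)[OF A \<Delta>, of \<epsilon>] by (simp_all add: m0_def holds_input_def)
    have m12: "m1 0 = int n" "m2 0 = int n"
      using m0(1) a0 by (simp_all add: m1_def m2_def)
    have vals: "expr_val e_eps m = ?a" "expr_val ?e m = ?a + 1" if "m 0 = int n" for m
      using that by (simp_all add: e_eps_def)
    have costs: "expr_cost e_eps m + int_size ?a \<le> C1 * l" "expr_cost ?e m + int_size (?a + 1) \<le> C2 * l"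
      if "m 0 = int n" for m
    proof -
      \<comment> \<open>The cost of the address depends on cell \<open>0\<close> only. It is
        measured in a memory where all other cells are zero, so that the general bounds apply
        however long \<open>\<epsilon>\<close> is.\<close>
      define m' where "m' = (\<lambda>a :: int. if a = 0 then int n else 0)"
      have "n \<le> l"
        using dim_le_mat_size[OF A] l(2) by simp
      also have "l < 2 ^ l"
        by (rule less_exp)
      finally have "int n \<le> 2 ^ l"
        by (metis less_imp_le of_nat_le_iff of_nat_numeral of_nat_power)
      then have "mem_bounded m' l"
        by (simp add: mem_bounded_def m'_def)
      moreover have "expr_cost e_eps m' = expr_cost e_eps m" "expr_cost ?e m' = expr_cost ?e m" "m' 0 = int n"
        using that by (simp_all add: e_eps_def m'_def)
      ultimately show "expr_cost e_eps m + int_size ?a \<le> C1 * l" "expr_cost ?e m + int_size (?a + 1) \<le> C2 * l"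
        using C1[of l m'] C2[of l m'] l(1) vals[of m'] by simp_all
    qed
    have size: "int_size N \<le> l + 2" "int_size (den \<epsilon> div num \<epsilon>) \<le> l + 2"
      using N by (intro int_size_le; linarith)+

    have "runs ((C1 + C2 + c) * l + 2 * rat_size \<epsilon>) (Set r_N (Add (Div (Load ?e) (Load e_eps)) (Const 1))) m0
        (\<lambda>m'. m' = m1)"
    proof -
      let ?E = "Add (Div (Load ?e) (Load e_eps)) (Const 1)"
      have val: "expr_val ?E m0 = N"
        unfolding expr_val.simps(1-6) vals[of m0, OF m0(1)] m0 by (simp add: N)
      \<comment> \<open>Numerator and denominator of \<open>\<epsilon>\<close> are charged twice,
        when they are loaded and when they are divided; this is the term
        \<open>2 * rat_size \<epsilon>\<close>.\<close>
      have "expr_cost ?E m0 = (expr_cost ?e m0 + int_size (?a + 1)) + (expr_cost e_eps m0 + int_size ?a) +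
          2 * rat_size \<epsilon> + int_size (den \<epsilon> div num \<epsilon>) + 2 * int_size 1"
        unfolding expr_cost.simps(2,3,6) expr_val.simps(2,6) vals[of m0, OF m0(1)] m0
        by (simp add: rat_size_def num_def den_def)
      then have "expr_cost (Const r_N) m0 + expr_cost ?E m0 + int_size r_N + int_size N
          \<le> (C1 * l + C2 * l) + 2 * rat_size \<epsilon> + (2 * l + 4 + 2 * int_size 1 + 2 * int_size r_N)"
        using costs[of m0, OF m0(1)] size by simp
      also have "2 * l + 4 + 2 * int_size 1 + 2 * int_size r_N \<le> c * l"
      proof -
        have "4 + 2 * int_size 1 + 2 * int_size r_N \<le> (4 + 2 * int_size 1 + 2 * int_size r_N) * l"
          using l(1) by simp
        then show ?thesis
          unfolding c_def add_mult_distrib by linarith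
      qed
      finally have "expr_cost (Const r_N) m0 + expr_cost ?E m0 + int_size r_N + int_size N
          \<le> (C1 + C2 + c) * l + 2 * rat_size \<epsilon>"
        by (simp add: add_mult_distrib)
      then show ?thesis
        using exec.Store[of "Const r_N" ?E m0] unfolding runs_def val expr_val.simps(1) m1_def by blast
    qed
    moreover have "runs ((C1 + 2 * int_size 0) * l) (Store e_eps (Const 0)) m1 (\<lambda>m'. m' = m2)"
    proof -
      have "2 * int_size 0 \<le> 2 * int_size 0 * l"
        using l(1) by simp
      then have "expr_cost e_eps m1 + expr_cost (Const 0) m1 + int_size ?a + int_size 0 \<le> (C1 + 2 * int_size 0) * l"
        using costs(1)[of m1, OF m12(1)] unfolding expr_cost.simps(1) add_mult_distrib by linarith
      then show ?thesis
        using exec.Store[of e_eps "Const 0" m1]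
        unfolding runs_def vals(1)[of m1, OF m12(1)] expr_val.simps(1) m2_def by blast
    qed
    moreover have "runs ((C2 + 2 * int_size 0) * l) (Store ?e (Const 0)) m2 (\<lambda>m'. m' = prepared_memory A \<Delta> n \<epsilon> N)"
    proof -
      have "2 * int_size 0 \<le> 2 * int_size 0 * l"
        using l(1) by simp
      then have "expr_cost ?e m2 + expr_cost (Const 0) m2 + int_size (?a + 1) + int_size 0 \<le> (C2 + 2 * int_size 0) * l"
        using costs(2)[of m2, OF m12(2)] unfolding expr_cost.simps(1) add_mult_distrib by linarith
      moreover have "m2(?a + 1 := 0) = prepared_memory A \<Delta> n \<epsilon> N"
        by (simp add: m2_def m1_def m0_def prepared_memory_def)
      ultimately show ?thesis
        using exec.Store[of ?e "Const 0" m2]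
        unfolding runs_def vals(2)[of m2, OF m12(2)] expr_val.simps(1) by metis
    qed
    ultimately have "runs ((C1 + C2 + c) * l + 2 * rat_size \<epsilon> + ((C1 + 2 * int_size 0) * l + (C2 + 2 * int_size 0) * l))
        precision_prog m0 (\<lambda>m'. m' = prepared_memory A \<Delta> n \<epsilon> N)"
      unfolding precision_prog_def by (elim runs_Seq) (blast intro: runs_Seq)
    then show "runs (C * l + 2 * rat_size \<epsilon>) precision_prog (initial_memory (input_code A \<Delta> \<epsilon>))
        (\<lambda>m'. m' = prepared_memory A \<Delta> n \<epsilon> N)"
      unfolding m0_def by (rule runs_mono) (simp_all add: C_def add_mult_distrib)
  qed
qed

section \<open>Size of the numbers in terms of the input, and accuracy of the output\<close>

context tridiagonal_input begin

text \<open>The integers in \<open>params\<close> have \<open>O(X)\<close> bits.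
  \<open>radius_bound\<close> has fewer than \<open>3 * n\<close> factors, so that
  \<open>radius_bound * N\<close> has \<open>O(X ^ 2)\<close> bits, and so has the growth factor
  \<open>K\<close>. Its power \<open>K ^ (3 * n)\<close> accounts for the cube.\<close>

lemma size_bounds:
  fixes L :: nat
  assumes "mat_size A + mat_size \<Delta> < X" "L < X" "0 < N" "N \<le> 2 ^ (L + 1)"
  shows "size_ok N (radius_bound * N) (48 * X ^ 3)" "radius_bound * N \<le> 2 ^ (48 * X ^ 3)"
proof -
  define M where "M = mat_size A + mat_size \<Delta>"
  define E where "E = (4 * M + 2) * (3 * n) + (L + 1)"
  have X: "M + 1 \<le> X" "L + 1 \<le> X" "n \<le> X"
    using assms(1,2) dim_le_mat_size[OF A] by (auto simp: M_def)
  have entry: "\<bar>a\<bar> \<le> 2 ^ (2 * M)" "\<bar>e\<bar> \<le> 2 ^ (2 * M)" "\<bar>d\<bar> \<le> 2 ^ (2 * M)"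
    if "j < 3 * n - 2" "param A \<Delta> j = (k, a, e, d)" for j k a e d
  proof -
    have le: "mat_size A \<le> M" "mat_size \<Delta> \<le> M"
      by (simp_all add: M_def)
    let ?p = "A $$ (param_row j, param_col j)" and ?q = "\<Delta> $$ (param_row j, param_col j)"
    note b = abs_entry_le[OF A param_row_col_less[OF that(1)] le(1)]
      abs_entry_le[OF \<Delta> param_row_col_less[OF that(1)] le(2)]
    have "\<bar>x * y\<bar> \<le> 2 ^ (2 * M)" if "\<bar>x\<bar> \<le> 2 ^ M" "\<bar>y\<bar> \<le> 2 ^ M" for x y :: int
      unfolding abs_mult mult_2 power_add using that by (intro mult_mono) auto
    then show "\<bar>a\<bar> \<le> 2 ^ (2 * M)" "\<bar>e\<bar> \<le> 2 ^ (2 * M)" "\<bar>d\<bar> \<le> 2 ^ (2 * M)"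
      using that(2) b by (auto simp: param_def Let_def)
  qed
  \<comment> \<open>Three summands of at most \<open>2 ^ (4 * M)\<close> each fit below
    \<open>4 * 2 ^ (4 * M)\<close>.\<close>
  have "radius_bound \<le> (\<Prod>j<3 * n - 2. 2 ^ (4 * M + 2))"
    unfolding radius_bound_def
  proof (rule prod_mono)
    fix j
    assume j: "j \<in> {..<3 * n - 2}"
    obtain k a e d where x: "param A \<Delta> j = (k, a, e, d)"
      by (cases "param A \<Delta> j") auto
    have "a * a \<le> \<bar>a\<bar> * \<bar>a\<bar>"
      by simp
    also have "\<dots> \<le> 2 ^ (2 * M) * 2 ^ (2 * M)"
      using entry(1)[OF _ x] j by (intro mult_mono) auto
    also have "\<dots> = 2 ^ (4 * M)"
      by (simp flip: power_add)
    finally have "a * a \<le> 2 ^ (4 * M)" .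
    moreover have "(2::int) ^ (2 * M) \<le> 2 ^ (4 * M)"
      by (intro power_increasing) auto
    moreover have "e \<le> 2 ^ (2 * M)" "d \<le> 2 ^ (2 * M)"
      using entry(2,3)[OF _ x] j by (auto dest: abs_le_D1)
    moreover have "(2::int) ^ (4 * M + 2) = 4 * 2 ^ (4 * M)" "(0::int) < 2 ^ (4 * M)"
      by (simp_all add: power_add)
    ultimately have "a * a + e + d \<le> 2 ^ (4 * M + 2)"
      by linarith
    then show "0 \<le> (case param A \<Delta> j of (k, a, e, d) \<Rightarrow> a * a + e + d) \<and>
        (case param A \<Delta> j of (k, a, e, d) \<Rightarrow> a * a + e + d) \<le> 2 ^ (4 * M + 2)"
      using weight_param_le(2)[OF _ x] j x by simp
  qed
  also have "\<dots> = 2 ^ ((4 * M + 2) * (3 * n - 2))"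
    by (simp only: prod_constant card_lessThan power_mult)
  also have "\<dots> \<le> 2 ^ ((4 * M + 2) * (3 * n))"
    by (intro power_increasing mult_le_mono2) auto
  finally have "radius_bound * N \<le> 2 ^ ((4 * M + 2) * (3 * n)) * 2 ^ (L + 1)"
    using assms(3,4) by (intro mult_mono) auto
  then have S: "radius_bound * N \<le> 2 ^ E"
    by (simp add: E_def power_add)
  have S0: "0 < radius_bound * N"
    using radius_bound_ge_1 assms(3) by simp

  have X1: "1 \<le> X"
    using X(1) by simp
  then have XX: "X \<le> X ^ 2" "X ^ 2 \<le> X ^ 3"
    using power_increasing[of 1 2 X] power_increasing[of 2 3 X] by simp_all
  \<comment> \<open>\<open>12 * X ^ 2\<close> from this product, \<open>X\<close> from
    \<open>L + 1\<close> and \<open>3 * X\<close> from \<open>2 * M + 3\<close> add up to at most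
    \<open>16 * X ^ 2\<close>; a further factor \<open>3 * X\<close> gives the constant 48.\<close>
  have "(4 * M + 2) * (3 * n) \<le> (4 * X) * (3 * X)"
    using X by (intro mult_le_mono) auto
  moreover have "(4 * X) * (3 * X) = 12 * X ^ 2"
    by (simp add: power2_eq_square)
  ultimately have E: "E + 2 * M + 3 \<le> 16 * X ^ 2"
    using X X1 XX unfolding E_def by linarith
  have "(E + 2 * M + 3) * (3 * n) \<le> (16 * X ^ 2) * (3 * X)"
    using E X by (intro mult_le_mono) auto
  also have "\<dots> = 48 * X ^ 3"
    by (simp add: power2_eq_square power3_eq_cube)
  finally have exponent: "(E + 2 * M + 3) * (3 * n) \<le> 48 * X ^ 3" .
  have "E \<le> 48 * X ^ 3"
    using E XX by linarith
  then show S': "radius_bound * N \<le> 2 ^ (48 * X ^ 3)"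
    using S by (meson order_trans power_increasing one_le_numeral)

  show "size_ok N (radius_bound * N) (48 * X ^ 3)"
    unfolding size_ok_def
  proof (intro conjI exI[of _ "2 ^ (E + 2 * M + 3)"] allI impI)
    show "1 \<le> 48 * X ^ 3" "(1::int) \<le> 2 ^ (E + 2 * M + 3)"
      using X1 by simp_all
    have "3 * n \<le> 48 * X ^ 3"
      using X(3) XX by linarith
    also have "\<dots> < 2 ^ (48 * X ^ 3)"
      by (rule less_exp)
    finally show "int (3 * n) \<le> 2 ^ (48 * X ^ 3)"
      by (metis less_imp_le of_nat_le_iff of_nat_numeral of_nat_power)
    show "((2::int) ^ (E + 2 * M + 3)) ^ (3 * n) \<le> 2 ^ (48 * X ^ 3)"
      unfolding power_mult[symmetric] using exponent by (intro power_increasing) auto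
    fix j
    assume j: "j < 3 * n - 2"
    obtain k a e d where x: "param A \<Delta> j = (k, a, e, d)"
      by (cases "param A \<Delta> j") auto
    note entry = entry[OF j x]
    have "N \<le> 2 ^ E"
      using assms(4) by (rule order_trans) (auto intro!: power_increasing simp: E_def)
    then have N: "\<bar>b * N\<bar> \<le> 2 ^ (2 * M) * 2 ^ E" if "\<bar>b\<bar> \<le> 2 ^ (2 * M)" for b
      unfolding abs_mult using that assms(3) by (intro mult_mono) auto
    have "\<bar>radius_bound * N\<bar> + 1 \<le> 2 * 2 ^ E"
    proof -
      have "(1::int) \<le> 2 ^ E" by simp
      then show ?thesis using S S0 by simp
    qed
    then have "(\<bar>radius_bound * N\<bar> + 1) * \<bar>e\<bar> \<le> (2 * 2 ^ E) * 2 ^ (2 * M)"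
      using entry(2) by (intro mult_mono) auto
    then have "\<bar>a * N\<bar> + (\<bar>radius_bound * N\<bar> + 1) * \<bar>e\<bar> + \<bar>d * N\<bar> \<le> 4 * (2 ^ E * 2 ^ (2 * M))"
      using N[OF entry(1)] N[OF entry(3)] by (simp add: mult.commute)
    also have "\<dots> \<le> 2 ^ (E + 2 * M + 3)"
      by (simp add: power_add)
    finally show "case param A \<Delta> j of (k, a, e, d) \<Rightarrow>
        \<bar>a * N\<bar> + (\<bar>radius_bound * N\<bar> + 1) * \<bar>e\<bar> + \<bar>d * N\<bar> \<le> 2 ^ (E + 2 * M + 3)"
      by (simp add: x)
  qed
qed

text \<open>Minimality of the numerator confines the radius to an interval of length
  \<open>1 / N\<close> below the output; for numerator \<open>0\<close> the radius is exactly
  \<open>0\<close>.\<close>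

lemma correct_output_approx:
  assumes N: "0 < N" "1 / of_int N \<le> \<epsilon>" and out: "correct_output N m"
  shows "output_approx m (regularity_radius (real_mat A) (real_mat \<Delta>)) \<epsilon>"
proof (cases "\<exists>\<delta>\<ge>0. singular_at \<delta>")
  case False
  then show ?thesis
    using out regularity_radius_infinite by (simp add: correct_output_def output_approx_def)
next
  case True
  then obtain x where x: "regularity_radius (real_mat A) (real_mat \<Delta>) = ereal x" "0 \<le> x"
    "\<And>\<delta>. 0 \<le> \<delta> \<Longrightarrow> singular_at \<delta> \<longleftrightarrow> x \<le> \<delta>"
    using regularity_radius_finite by blast
  have m: "m 0 = 1" "m 2 = N" "0 \<le> m 1" "singular_at (of_int (m 1) / of_int N)"
    "0 < m 1 \<Longrightarrow> \<not> singular_at (of_int (m 1 - 1) / of_int N)"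
    using out True by (auto simp: correct_output_def)
  have upper: "x \<le> of_int (m 1) / of_int N"
    using x(3) m(3,4) N(1) by simp
  have "of_int (m 1) / of_int N - x \<le> 1 / of_int N"
  proof (cases "0 < m 1")
    case True
    then have "\<not> x \<le> of_int (m 1 - 1) / of_int N"
      using x(3)[of "of_int (m 1 - 1) / of_int N"] m(5) N(1) by simp
    then show ?thesis
      using N(1) by (simp add: diff_divide_distrib)
  next
    case False
    then have "of_int (m 1) / of_int N - x \<le> 0"
      using m(3) x(2) by simp
    also have "0 \<le> 1 / real_of_int N"
      using N(1) by simp
    finally show ?thesis .
  qed
  then show ?thesis
    using x(1) m N upper by (simp add: output_approx_def)
qed

end

theorem proposition2p1:
  shows "poly_time_arbitrary_precision
    {(A, \<Delta>). \<exists>n \<ge> 1.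
       A \<in> carrier_mat n n \<and> \<Delta> \<in> carrier_mat n n \<and>
       unreduced_tridiagonal A \<and>
       (\<forall>i < n. \<forall>j < n. \<Delta> $$ (i, j) \<ge> 0) \<and>
       (\<forall>i < n. \<forall>j < n. A $$ (i, j) = 0 \<longrightarrow> \<Delta> $$ (i, j) = 0)}
    (\<lambda>A \<Delta>. regularity_radius (map_mat real_of_rat A) (map_mat real_of_rat \<Delta>))"
proof -
  obtain C where C: "\<And>A \<Delta> n N l m. tridiagonal_input A \<Delta> n \<Longrightarrow> holds_input A \<Delta> n m \<Longrightarrow> m r_N = N \<Longrightarrow> 0 < N \<Longrightarrow>
    mem_bounded m l \<Longrightarrow> tridiagonal_input.size_ok A \<Delta> n N (tridiagonal_input.radius_bound A \<Delta> n * N) l \<Longrightarrow>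
    tridiagonal_input.radius_bound A \<Delta> n * N \<le> 2 ^ l \<Longrightarrow>
    runs (C * (l * l * n)) core_prog m (tridiagonal_input.correct_output A \<Delta> N)"
    using core_prog_runs by blast
  obtain D where D: "\<And>A \<Delta> n \<epsilon> N l. A \<in> carrier_mat n n \<Longrightarrow> \<Delta> \<in> carrier_mat n n \<Longrightarrow> 1 \<le> l \<Longrightarrow> mat_size A \<le> l \<Longrightarrow>
    N = den \<epsilon> div num \<epsilon> + 1 \<Longrightarrow> 0 \<le> den \<epsilon> div num \<epsilon> \<Longrightarrow> N \<le> 2 ^ l \<Longrightarrow>
    runs (D * l + 2 * rat_size \<epsilon>) precision_prog (initial_memory (input_code A \<Delta> \<epsilon>))
      (\<lambda>m'. m' = prepared_memory A \<Delta> n \<epsilon> N)"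
    using precision_prog_runs by blast
  let ?P = "Seq precision_prog core_prog"
  \<comment> \<open>The linear factor evaluates to one plus the size, called \<open>X\<close> below.
    As \<open>l = 48 * X ^ 3\<close> and \<open>n \<le> X\<close>, the product
    \<open>l * l * n\<close> is at most \<open>2304 * X ^ 7\<close>.\<close>
  let ?p = "[:48 * D + 2304 * C:] * [:1, 1:] ^ 7 :: nat poly"
  have main: "\<exists>t m. exec ?P (initial_memory (input_code A \<Delta> \<epsilon>)) t m \<and>
      t \<le> poly ?p (mat_size A + mat_size \<Delta> + nat \<lceil>log 2 (1 / real_of_rat \<epsilon>)\<rceil>) + 2 * rat_size \<epsilon> \<and>
      output_approx m (regularity_radius (real_mat A) (real_mat \<Delta>)) (real_of_rat \<epsilon>)"
    if "tridiagonal_input A \<Delta> n" and \<epsilon>: "0 < \<epsilon>" for A \<Delta> n \<epsilon>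
  proof -
    interpret tridiagonal_input A \<Delta> n
      by (fact that(1))
    define L where "L = nat \<lceil>log 2 (1 / real_of_rat \<epsilon>)\<rceil>"
    define X where "X = 1 + (mat_size A + mat_size \<Delta> + L)"
    define l where "l = 48 * X ^ 3"
    \<comment> \<open>One more than the floor of \<open>1 / \<epsilon>\<close>: obtained by a single
      division, large enough for the precision, and at most \<open>2 ^ L + 1\<close>.\<close>
    define N where "N = den \<epsilon> div num \<epsilon> + 1"
    have d: "0 < den \<epsilon>"
      by (rule den_pos)
    have "0 < real_of_rat \<epsilon>"
      using \<epsilon> by simp
    then have num: "0 < num \<epsilon>"
      using d unfolding of_rat_num_den by (simp add: zero_less_divide_iff)
    have inv: "1 / real_of_rat \<epsilon> = of_int (den \<epsilon>) / of_int (num \<epsilon>)"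
      by (simp add: of_rat_num_den)
    have q: "0 \<le> den \<epsilon> div num \<epsilon>"
      using d num by (simp add: pos_imp_zdiv_nonneg_iff)
    have N0: "0 < N"
      using q by (simp add: N_def)
    have floor: "den \<epsilon> div num \<epsilon> = \<lfloor>1 / real_of_rat \<epsilon>\<rfloor>"
      unfolding inv by (rule floor_divide_of_int_eq[symmetric])
    have "1 / real_of_rat \<epsilon> \<le> of_int N"
      unfolding N_def floor by linarith
    then have prec: "1 / of_int N \<le> real_of_rat \<epsilon>"
      using \<open>0 < real_of_rat \<epsilon>\<close> N0 by (simp add: field_simps)
    have "N \<le> 2 ^ (L + 1)"
    proof -
      have "log 2 (1 / real_of_rat \<epsilon>) \<le> L"
        unfolding L_def by linarith
      then have "1 / real_of_rat \<epsilon> \<le> 2 powr L"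
        using \<open>0 < real_of_rat \<epsilon>\<close> by (subst (asm) log_le_iff) auto
      then have "real_of_int (den \<epsilon> div num \<epsilon>) \<le> of_int (2 ^ L)"
        unfolding floor by (intro order_trans[OF of_int_floor_le]) (simp add: powr_realpow)
      then have "den \<epsilon> div num \<epsilon> \<le> 2 ^ L"
        by (simp only: of_int_le_iff)
      moreover have "(1::int) \<le> 2 ^ L" "(2::int) ^ (L + 1) = 2 * 2 ^ L"
        by simp_all
      ultimately show ?thesis
        unfolding N_def by linarith
    qed
    have X: "mat_size A + mat_size \<Delta> < X" "L < X"
      by (simp_all add: X_def)
    note size = size_bounds[OF X N0 \<open>N \<le> 2 ^ (L + 1)\<close>, folded l_def]
    have l1: "1 \<le> l"
      using X(1) by (simp add: l_def)
    have Xl: "X \<le> l"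
    proof -
      have "X ^ 1 \<le> X ^ 3"
        using X(1) by (intro power_increasing) auto
      then show ?thesis by (simp add: l_def)
    qed
    then have sizes: "mat_size A \<le> l" "mat_size \<Delta> \<le> l"
      using X(1) by linarith+
    have "N * 1 \<le> N * radius_bound"
      using radius_bound_ge_1 N0 by (intro mult_left_mono) auto
    then have Nl: "N \<le> 2 ^ l"
      using size(2) by (simp add: mult.commute)
    note prep = prepared_memory[OF A \<Delta> sizes, of N \<epsilon>]
    have "runs (C * (l * l * n)) core_prog (prepared_memory A \<Delta> n \<epsilon> N) (correct_output N)"
      using prep Nl N0 that(1) size by (intro C) auto
    then have "runs (D * l + 2 * rat_size \<epsilon> + C * (l * l * n)) ?P (initial_memory (input_code A \<Delta> \<epsilon>)) (correct_output N)"
      by (intro runs_Seq[OF D[OF A \<Delta> l1 sizes(1) N_def q Nl]]) simp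
    then obtain t m where t: "exec ?P (initial_memory (input_code A \<Delta> \<epsilon>)) t m"
      "t \<le> D * l + 2 * rat_size \<epsilon> + C * (l * l * n)" "correct_output N m"
      unfolding runs_def by blast
    have "D * l + C * (l * l * n) \<le> (48 * D + 2304 * C) * X ^ 7"
    proof -
      have "X ^ 3 \<le> X ^ 7"
        using X(1) by (intro power_increasing) auto
      then have "D * l \<le> 48 * D * X ^ 7"
        by (simp add: l_def)
      moreover have "l * l * n \<le> l * l * X"
        using dim_le_mat_size[OF A] X(1) by (intro mult_le_mono2) linarith
      moreover have "X ^ 3 * X ^ 3 * X = X ^ 7"
        by (simp flip: power_add power_Suc2)
      then have "l * l * X = 2304 * X ^ 7"
        by (simp add: l_def)
      ultimately have "C * (l * l * n) \<le> C * (2304 * X ^ 7)"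
        by (intro mult_le_mono2) linarith
      also have "\<dots> = 2304 * C * X ^ 7"
        by simp
      finally show ?thesis
        using \<open>D * l \<le> 48 * D * X ^ 7\<close> unfolding add_mult_distrib by linarith
    qed
    moreover have "poly ?p (mat_size A + mat_size \<Delta> + L) = (48 * D + 2304 * C) * X ^ 7"
      by (simp add: X_def)
    ultimately have "t \<le> poly ?p (mat_size A + mat_size \<Delta> + L) + 2 * rat_size \<epsilon>"
      using t(2) by linarith
    then show ?thesis
      using t(1) correct_output_approx[OF N0 prec t(3)] unfolding L_def by blast
  qed
  show ?thesis
    unfolding poly_time_arbitrary_precision_def
  proof (intro exI[of _ ?P] exI[of _ ?p] exI[of _ 2] ballI, clarify)
    fix A \<Delta> :: "rat mat" and n :: nat and \<epsilon> :: rat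
    assume "1 \<le> n" "A \<in> carrier_mat n n" "\<Delta> \<in> carrier_mat n n" "unreduced_tridiagonal A"
      "\<forall>i<n. \<forall>j<n. 0 \<le> \<Delta> $$ (i, j)" "\<forall>i<n. \<forall>j<n. A $$ (i, j) = 0 \<longrightarrow> \<Delta> $$ (i, j) = 0" "0 < \<epsilon>"
    then have "tridiagonal_input A \<Delta> n"
      by unfold_locales (auto simp: unreduced_tridiagonal_def)
    from main[OF this \<open>0 < \<epsilon>\<close>]
    show "\<exists>t m. exec ?P (initial_memory (input_code A \<Delta> \<epsilon>)) t m \<and>
      t \<le> poly ?p (mat_size A + mat_size \<Delta> + nat \<lceil>log 2 (1 / real_of_rat \<epsilon>)\<rceil>) + 2 * rat_size \<epsilon> \<and>
      output_approx m (regularity_radius (real_mat A) (real_mat \<Delta>)) (real_of_rat \<epsilon>)" .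
  qed
qed

end
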